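(* Let $A_L=(a_{ij}^L)$ and $A_R=(a_{ij}^R)$ be real $2\times 2$ matrices with $a_{12}^L=a_{12}^R=:a_{12}$ and $a_{22}^L=a_{22}^R=:a_{22}$, let $\mathbf{b}=(b_1,b_2)^T\in\mathbb{R}^2$, and consider the continuous planar piecewise linear differential system $$ \dot{\mathbf{x}}=\begin{cases}A_L\mathbf{x}+\mathbf{b}, & \text{if } x_1\leqslant 0,\\ A_R\mathbf{x}+\mathbf{b}, & \text{if } x_1\geqslant 0,\end{cases}\qquad \mathbf{x}=(x_1,x_2)^T\in\mathbb{R}^2 . $$ Then this system has at most one limit cycle, and the limit cycle, if it exists, is hyperbolic. Moreover, if a limit cycle exists, then $(a_{12}b_2-a_{22}b_1)\,\mathrm{tr}(A_L)\neq 0$, and the limit cycle is attracting provided that $(a_{12}b_2-a_{22}b_1)\,\mathrm{tr}(A_L)<0$, and repelling provided that $(a_{12}b_2-a_{22}b_1)\,\mathrm{tr}(A_L)>0$. Here $\mathrm{tr}$ denotes the trace of a matrix.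
   Context: The conditions $a_{12}^L=a_{12}^R$ and $a_{22}^L=a_{22}^R$, together with the common vector $\mathbf{b}$, make the vector field continuous across the line $\{x_1=0\}$ (indeed globally Lipschitz), so solutions exist, are unique and are defined for all time. A limit cycle is a non-trivial closed orbit (i.e. the orbit of a non-constant periodic solution) that is isolated from other closed orbits, i.e. it has a neighbourhood that contains no other closed orbit. A limit cycle is hyperbolic if the first-return (Poincaré) map defined on a small segment transversal to the closed orbit is differentiable at the corresponding fixed point with derivative different from $1$. It is attracting (resp. repelling) if all orbits starting sufficiently close to it approach it as $t\to+\infty$ (resp. as $t\to-\infty$). *)

theory Defs
  imports "HOL-Analysis.Analysis"
begin

definition pwl_field :: "real^2^2 \<Rightarrow> real^2^2 \<Rightarrow> real^2 \<Rightarrow> real^2 \<Rightarrow> real^2" where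
  "pwl_field A\<^sub>L A\<^sub>R b x = (if x $ 1 \<le> 0 then A\<^sub>L *v x + b else A\<^sub>R *v x + b)"

text \<open>If the second columns agree, the right-hand formula is also valid on the
  switching line, so the choice made by the conditional there is immaterial.\<close>

lemma pwl_field_right:
  assumes "A\<^sub>L $ 1 $ 2 = A\<^sub>R $ 1 $ 2" "A\<^sub>L $ 2 $ 2 = A\<^sub>R $ 2 $ 2" "x $ 1 \<ge> 0"
  shows "pwl_field A\<^sub>L A\<^sub>R b x = A\<^sub>R *v x + b"
  using assms
  by (auto simp: pwl_field_def vec_eq_iff matrix_vector_mult_def sum_2 forall_2)

text \<open>Solutions are global in time. For the globally Lipschitz fields considered here
  every maximal solution is of this kind.\<close>

definition solution :: "('a::real_normed_vector \<Rightarrow> 'a) \<Rightarrow> (real \<Rightarrow> 'a) \<Rightarrow> bool" where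
  "solution f x \<longleftrightarrow> (\<forall>t. (x has_vector_derivative f (x t)) (at t))"

definition closed_orbit :: "('a::real_normed_vector \<Rightarrow> 'a) \<Rightarrow> 'a set \<Rightarrow> bool" where
  "closed_orbit f \<Gamma> \<longleftrightarrow>
     (\<exists>x T. solution f x \<and> T > 0 \<and> (\<forall>t. x (t + T) = x t) \<and> (\<exists>t. x t \<noteq> x 0) \<and> \<Gamma> = range x)"

definition limit_cycle :: "('a::real_normed_vector \<Rightarrow> 'a) \<Rightarrow> 'a set \<Rightarrow> bool" where
  "limit_cycle f \<Gamma> \<longleftrightarrow> closed_orbit f \<Gamma> \<and>
     (\<exists>U. open U \<and> \<Gamma> \<subseteq> U \<and> (\<forall>\<Gamma>'. closed_orbit f \<Gamma>' \<and> \<Gamma>' \<subseteq> U \<longrightarrow> \<Gamma>' = \<Gamma>))"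

definition section_segment :: "real^2 \<Rightarrow> real^2 \<Rightarrow> real \<Rightarrow> (real^2) set" where
  "section_segment p v \<epsilon> = closed_segment (p - \<epsilon> *\<^sub>R v) (p + \<epsilon> *\<^sub>R v)"

text \<open>Points of the segment are parametrised as \<open>p + s *\<^sub>R v\<close> with \<open>\<bar>s\<bar> \<le> \<epsilon>\<close>. The orbit
  starting at parameter \<open>s\<close> hits the segment for the first time after time 0 at
  parameter \<open>r\<close>.\<close>

definition first_return ::
    "(real^2 \<Rightarrow> real^2) \<Rightarrow> real^2 \<Rightarrow> real^2 \<Rightarrow> real \<Rightarrow> real \<Rightarrow> real \<Rightarrow> bool" where
  "first_return f p v \<epsilon> s r \<longleftrightarrow> \<bar>r\<bar> \<le> \<epsilon> \<and>
     (\<exists>x \<tau>. solution f x \<and> x 0 = p + s *\<^sub>R v \<and> \<tau> > 0 \<and> x \<tau> = p + r *\<^sub>R v \<and>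
        (\<forall>t. 0 < t \<and> t < \<tau> \<longrightarrow> x t \<notin> section_segment p v \<epsilon>))"

text \<open>The condition is imposed at every point \<open>p\<close> of the closed orbit and for every
  direction \<open>v\<close> transversal to it at \<open>p\<close>. The segment has to be small enough to meet
  the closed orbit only at \<open>p\<close>, so that parameter 0 is the fixed point of the
  first-return map \<open>P\<close>, which is needed only near 0.\<close>

definition hyperbolic :: "(real^2 \<Rightarrow> real^2) \<Rightarrow> (real^2) set \<Rightarrow> bool" where
  "hyperbolic f \<Gamma> \<longleftrightarrow>
     (\<forall>p\<in>\<Gamma>. \<forall>v. v \<notin> span {f p} \<longrightarrow>
        (\<exists>\<epsilon>>0. \<Gamma> \<inter> section_segment p v \<epsilon> = {p} \<and>
          (\<exists>P D. (\<forall>\<^sub>F s in nhds 0. first_return f p v \<epsilon> s (P s)) \<and>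
                 (P has_real_derivative D) (at 0) \<and> D \<noteq> 1)))"

definition attracting :: "('a::real_normed_vector \<Rightarrow> 'a) \<Rightarrow> 'a set \<Rightarrow> bool" where
  "attracting f \<Gamma> \<longleftrightarrow>
     (\<exists>U. open U \<and> \<Gamma> \<subseteq> U \<and>
        (\<forall>x. solution f x \<and> x 0 \<in> U \<longrightarrow> ((\<lambda>t. infdist (x t) \<Gamma>) \<longlongrightarrow> 0) at_top))"

definition repelling :: "('a::real_normed_vector \<Rightarrow> 'a) \<Rightarrow> 'a set \<Rightarrow> bool" where
  "repelling f \<Gamma> \<longleftrightarrow>
     (\<exists>U. open U \<and> \<Gamma> \<subseteq> U \<and>
        (\<forall>x. solution f x \<and> x 0 \<in> U \<longrightarrow> ((\<lambda>t. infdist (x t) \<Gamma>) \<longlongrightarrow> 0) at_bot))"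

end

theory Submission
  imports Defs "HOL-Analysis.Analysis"
begin

text \<open>If the common second column has \<open>a12 \<noteq> 0\<close>, the coordinates \<open>x = x\<^sub>1\<close>,
  \<open>y = a22 x\<^sub>1 - a12 x\<^sub>2 - b\<^sub>1\<close> turn the system into \<open>x' = T x - y\<close>, \<open>y' = D x - a\<close>, where \<open>T\<close>
  and \<open>D\<close> are the trace and the determinant of the zone and \<open>a = a12 b\<^sub>2 - a22 b\<^sub>1\<close>; if \<open>a12 = 0\<close>,
  both equations are scalar and there is no closed orbit. A closed orbit in one zone, and every
  closed orbit if \<open>a = 0\<close>, can be rescaled, so it is not isolated. Reflection and time reversal
  leave the case \<open>a > 0\<close>.

  The energy \<open>(T x - y)\<^sup>2 / 2 + D x\<^sup>2 / 2 - a x\<close> has the derivative \<open>T x'\<^sup>2\<close> along an arc. Hence a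
  closed orbit in both zones needs traces of opposite signs, or two vanishing traces; in the
  latter case the energy is a first integral and the orbit is not isolated. So let
  \<open>T\<^sub>L < 0 < T\<^sub>R\<close>. The arcs between two points of \<open>x = 0\<close> form a curve \<open>(u, v)\<close>, \<open>u > 0 > v\<close>, in each zone,
  parametrised by the flight time \<open>t\<close>, on which \<open>W(y) = D y\<^sup>2 - T y + 1\<close> is multiplied by \<open>exp(T t)\<close>
  from the start to the end. One has \<open>W\<^sub>L(u) W\<^sub>R(v) - W\<^sub>L(v) W\<^sub>R(u) = (u - v) F(u, v)\<close> with a
  polynomial \<open>F\<close> that increases at its zeros along the left curve and is positive at its origin,
  so \<open>F > 0\<close> there. This says that \<open>exp(T\<^sub>L t\<^sub>L + T\<^sub>R t\<^sub>R) < 1\<close>, which is the derivative of the return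
  map, and that \<open>G(u) - G(v)\<close> with \<open>G'(y) = y / W\<^sub>R(y)\<close> is strictly increasing along the left curve.
  It is constant along the right curve, so the curves meet at most once.\<close>

section \<open>Globally Lipschitz vector fields\<close>

text \<open>The sign \<open>a > 0\<close> makes the zones unequal. At the first zero of the kernel
  \<open>S\<close> of a zone, every orbit from \<open>x = 0\<close> has \<open>x > 0\<close>: a left
  arc ends earlier, while a right arc from \<open>y < 0\<close> with \<open>T\<^sub>R > 0\<close>
  lasts longer than half a turn. Hence the right zone is a focus, \<open>W\<^sub>R\<close> is
  positive everywhere, and \<open>G\<close> has no poles. \<open>W(y)\<close> is a determinant of
  velocity and acceleration, which explains the factor \<open>exp(T t)\<close>. With the flight time
  as parameter, real, double and complex eigenvalues obey the same formulas, and the ends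
  \<open>Y\<close>, \<open>Z\<close> of the arcs satisfy \<open>Y dY / W(Y) = Z dZ / W(Z)\<close>;
  this is the origin of \<open>G\<close>.

  The field is only Lipschitz, so the return map cannot be differentiated through smooth dependence
  on initial values. Instead the determinant of velocity and displacement is followed along the
  orbit; a zone multiplies it by \<open>exp(T t)\<close> exactly, apart from short times near the
  crossings. As nothing is known in advance about the number of crossings in a period, the arcs are
  found from the highest crossing.\<close>

definition primitive :: "(real \<Rightarrow> 'a::euclidean_space) \<Rightarrow> real \<Rightarrow> 'a" where
  "primitive g t = integral {0..t} g - integral {t..0} g"

lemma primitive_0 [simp]: "primitive g 0 = 0"
  by (simp add: primitive_def)

lemma has_vector_derivative_primitive:
  fixes g :: "real \<Rightarrow> 'a::euclidean_space"
  assumes "continuous_on UNIV g"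
  shows "(primitive g has_vector_derivative g t) (at t)"
proof -
  define N where "N = \<bar>t\<bar> + 1"
  have cont: "continuous_on S g" for S
    using assms continuous_on_subset by blast
  \<comment> \<open>For either sign of \<open>s\<close> at least one of the two integrals in
    \<open>primitive\<close> vanishes, its interval being empty or a point. On a bounded window both
    are compared with the integral from \<open>-N\<close>.\<close>
  have eq: "primitive g s = integral {-N..s} g - integral {-N..0} g" if "s \<in> {-N<..<N}" for s
  proof (cases "0 \<le> s")
    case True
    have "integral {-N..0} g + integral {0..s} g = integral {-N..s} g"
      by (rule Henstock_Kurzweil_Integration.integral_combine) (use True in \<open>auto simp: N_def intro!: integrable_continuous_real cont\<close>)
    moreover have "integral {s..0} g = 0"
      using True by (cases "s = 0") auto
    ultimately show ?thesis
      unfolding primitive_def by (simp add: algebra_simps)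
  next
    case False
    have "integral {-N..s} g + integral {s..0} g = integral {-N..0} g"
      by (rule Henstock_Kurzweil_Integration.integral_combine) (use False that in \<open>auto intro!: integrable_continuous_real cont\<close>)
    then show ?thesis
      unfolding primitive_def using False by (simp add: algebra_simps)
  qed
  have t: "t \<in> {-N<..<N}"
    by (auto simp: N_def)
  have "((\<lambda>s. integral {-N..s} g) has_vector_derivative g t) (at t within {-N..N})"
    by (rule integral_has_vector_derivative) (use t cont in auto)
  then have "((\<lambda>s. integral {-N..s} g) has_vector_derivative g t) (at t)"
    using t by (simp add: at_within_Icc_at)
  then have "((\<lambda>s. integral {-N..s} g - integral {-N..0} g) has_vector_derivative g t) (at t)"
    by (auto intro!: derivative_eq_intros)
  then show ?thesis
    by (rule has_vector_derivative_transform_within_open[OF _ open_greaterThanLessThan t]) (simp add: eq)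
qed

lemma has_vector_derivative_affine_arg:
  assumes "(x has_vector_derivative v) (at (m * t + c))"
  shows "((\<lambda>t. x (m * t + c)) has_vector_derivative m *\<^sub>R v) (at t)"
proof -
  have "((\<lambda>t. m * t + c) has_vector_derivative m) (at t)"
    unfolding has_real_derivative_iff_has_vector_derivative[symmetric]
    by (auto intro!: derivative_eq_intros)
  from vector_diff_chain_at[OF this assms] show ?thesis by (simp add: o_def)
qed

text \<open>Integration gains the factor \<open>1 / K\<close> against the weight
  \<open>exp (K * \<bar>s\<bar>)\<close>, which is what makes Picard iteration contract on the whole
  line.\<close>

lemma norm_primitive_le_exp:
  fixes G :: "real \<Rightarrow> 'a::euclidean_space"
  assumes G: "\<And>s. (G has_vector_derivative g s) (at s)" "G 0 = 0"
    and g: "\<And>s. norm (g s) \<le> M * exp (K * \<bar>s\<bar>)" and "K > 0" "M \<ge> 0"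
  shows "norm (G t) \<le> M / K * exp (K * \<bar>t\<bar>)"
proof -
  have pos: "norm (H t) \<le> M / K * exp (K * t)"
    if H: "\<And>s. (H has_vector_derivative h s) (at s)" "H 0 = 0"
      and h: "\<And>s. norm (h s) \<le> M * exp (K * \<bar>s\<bar>)" and "t \<ge> 0"
    for H :: "real \<Rightarrow> 'a" and h t
  proof (cases "t = 0")
    case True
    then show ?thesis using H(2) assms by simp
  next
    case False
    have "norm (H t - H 0) \<le> M / K * exp (K * t) - M / K * exp (K * 0)"
    proof (rule differentiable_bound_general)
      show "0 < t" using that False by simp
      show "continuous_on {0..t} H"
        by (meson H(1) continuous_at_imp_continuous_on has_vector_derivative_continuous)
      show "continuous_on {0..t} (\<lambda>t. M / K * exp (K * t))"
        by (intro continuous_intros)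
      show "(H has_vector_derivative h s) (at s)" for s by (rule H)
      show "((\<lambda>t. M / K * exp (K * t)) has_vector_derivative M * exp (K * s)) (at s)" for s
        unfolding has_real_derivative_iff_has_vector_derivative[symmetric]
        by (auto intro!: derivative_eq_intros simp: \<open>K > 0\<close> less_imp_neq[symmetric])
      show "norm (h s) \<le> M * exp (K * s)" if "0 < s" for s
        using h[of s] that by simp
    qed
    also have "\<dots> \<le> M / K * exp (K * t)"
      using assms by simp
    finally show ?thesis using H(2) by simp
  qed
  show ?thesis
  proof (cases "t \<ge> 0")
    case True
    with pos[OF G g] show ?thesis by simp
  next
    case False
    have "((\<lambda>s. G (- s)) has_vector_derivative - g (- s)) (at s)" for s
      using has_vector_derivative_affine_arg[of G "g (- s)" "-1" s 0] G(1)[of "-s"] by simp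
    from pos[of "\<lambda>s. G (- s)" "\<lambda>s. - g (- s)" "-t", OF this]
    show ?thesis using g[of "- _"] False G(2) by (simp add: g[of "- _", simplified])
  qed
qed

locale lipschitz_field =
  fixes f :: "'a::euclidean_space \<Rightarrow> 'a" and L :: real
  assumes lipschitz: "L-lipschitz_on UNIV f"
begin

lemma L_nonneg: "L \<ge> 0"
  using lipschitz lipschitz_on_nonneg by blast

lemma norm_diff_le: "norm (f x - f y) \<le> L * norm (x - y)"
  using lipschitz_onD[OF lipschitz, of x y] by (simp add: dist_norm)

lemma continuous_field: "continuous_on UNIV f"
  using lipschitz lipschitz_on_continuous_on by blast

text \<open>Picard iteration is a contraction of \<open>u(t) = (x(t) - x0) / exp(K |t|)\<close> in the
  supremum norm once \<open>K > L\<close>.\<close>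

lemma solution_exists: "\<exists>x. solution f x \<and> x 0 = x0"
proof -
  \<comment> \<open>Any \<open>K > 0\<close> with \<open>L / K \<le> 1 / 2\<close> gives the
    contraction factor \<open>1 / 2\<close>; the summand 1 covers \<open>L = 0\<close>.\<close>
  define K where "K = 2 * L + 1"
  have K: "K > 0" "L / K \<le> 1 / 2"
    using L_nonneg by (auto simp: K_def field_simps)
  define g where "g u s = f (x0 + exp (K * \<bar>s\<bar>) *\<^sub>R apply_bcontfun u s)" for u :: "real \<Rightarrow>\<^sub>C 'a" and s
  have contg: "continuous_on UNIV (g u)" for u
    unfolding g_def
    by (intro continuous_intros continuous_on_compose2[OF continuous_field]) auto
  note deriv = has_vector_derivative_primitive[OF contg]
  define \<Phi> where "\<Phi> u t = exp (- (K * \<bar>t\<bar>)) *\<^sub>R primitive (g u) t" for u t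
  have gb: "norm (g u s) \<le> (norm (f x0) + L * norm u) * exp (K * \<bar>s\<bar>)" for u s
  proof -
    have "norm (g u s) \<le> norm (f x0) + norm (g u s - f x0)"
      by (metis add.commute diff_add_cancel norm_triangle_ineq)
    also have "norm (g u s - f x0) \<le> L * (exp (K * \<bar>s\<bar>) * norm (apply_bcontfun u s))"
      unfolding g_def using norm_diff_le[of "x0 + exp (K * \<bar>s\<bar>) *\<^sub>R apply_bcontfun u s" x0] by simp
    also have "\<dots> \<le> L * (exp (K * \<bar>s\<bar>) * norm u)"
      by (intro mult_left_mono norm_bounded L_nonneg) auto
    finally have "norm (g u s) \<le> norm (f x0) * 1 + L * norm u * exp (K * \<bar>s\<bar>)"
      by (simp add: mult_ac)
    also have "\<dots> \<le> norm (f x0) * exp (K * \<bar>s\<bar>) + L * norm u * exp (K * \<bar>s\<bar>)"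
      using K by (intro add_right_mono mult_left_mono) auto
    finally show ?thesis by (simp add: algebra_simps)
  qed
  have "\<Phi> u \<in> bcontfun" for u
  proof -
    have "continuous_on UNIV (primitive (g u))"
      by (meson deriv continuous_at_imp_continuous_on has_vector_derivative_continuous)
    then have "continuous_on UNIV (\<Phi> u)"
      unfolding \<Phi>_def by (intro continuous_intros)
    moreover have "norm (\<Phi> u t) \<le> (norm (f x0) + L * norm u) / K" for t
    proof -
      have "norm (primitive (g u) t) \<le> (norm (f x0) + L * norm u) / K * exp (K * \<bar>t\<bar>)"
        using L_nonneg by (intro norm_primitive_le_exp[OF deriv _ gb]) (auto simp: K)
      then have "norm (\<Phi> u t) \<le> exp (- (K * \<bar>t\<bar>)) * ((norm (f x0) + L * norm u) / K * exp (K * \<bar>t\<bar>))"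
        unfolding \<Phi>_def norm_scaleR by (simp only: abs_exp_cancel, intro mult_left_mono) auto
      also have "\<dots> = (norm (f x0) + L * norm u) / K"
      proof -
        have "exp (- r) * (M * exp r) = M" for r M :: real
          by (simp add: exp_minus)
        then show ?thesis .
      qed
      finally show ?thesis .
    qed
    ultimately show ?thesis
      by (auto simp: bcontfun_def intro!: boundedI)
  qed
  then have app: "apply_bcontfun (Bcontfun (\<Phi> u)) = \<Phi> u" for u
    by (simp add: Bcontfun_inverse)
  have contr: "dist (Bcontfun (\<Phi> u)) (Bcontfun (\<Phi> v)) \<le> 1/2 * dist u v" for u v
  proof (rule dist_bound)
    fix t
    have "norm (primitive (g u) t - primitive (g v) t) \<le> (L * dist u v) / K * exp (K * \<bar>t\<bar>)"
    proof (rule norm_primitive_le_exp)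
      show "((\<lambda>t. primitive (g u) t - primitive (g v) t) has_vector_derivative g u s - g v s) (at s)" for s
        by (intro has_vector_derivative_diff deriv)
      show "norm (g u s - g v s) \<le> L * dist u v * exp (K * \<bar>s\<bar>)" for s
      proof -
        have "norm (g u s - g v s) \<le> L * (exp (K * \<bar>s\<bar>) * dist (apply_bcontfun u s) (apply_bcontfun v s))"
          unfolding g_def using norm_diff_le[of "x0 + exp (K * \<bar>s\<bar>) *\<^sub>R apply_bcontfun u s" "x0 + exp (K * \<bar>s\<bar>) *\<^sub>R apply_bcontfun v s"]
          by (simp add: dist_norm flip: scaleR_diff_right)
        also have "\<dots> \<le> L * (exp (K * \<bar>s\<bar>) * dist u v)"
          by (intro mult_left_mono dist_bounded L_nonneg) auto
        finally show ?thesis by (simp add: mult_ac)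
      qed
    qed (use L_nonneg K in auto)
    then have "dist (\<Phi> u t) (\<Phi> v t) \<le> exp (- (K * \<bar>t\<bar>)) * ((L * dist u v) / K * exp (K * \<bar>t\<bar>))"
      unfolding \<Phi>_def dist_norm scaleR_diff_right[symmetric] norm_scaleR abs_exp_cancel
      by (intro mult_left_mono) auto
    also have "\<dots> = L / K * dist u v"
      by (simp add: exp_minus field_simps)
    also have "\<dots> \<le> 1/2 * dist u v"
      by (intro mult_right_mono K) auto
    finally show "dist (apply_bcontfun (Bcontfun (\<Phi> u)) t) (apply_bcontfun (Bcontfun (\<Phi> v)) t) \<le> 1/2 * dist u v"
      by (simp add: app)
  qed
  obtain u where u: "Bcontfun (\<Phi> u) = u"
    using banach_fix_type[of "1/2" "\<lambda>u. Bcontfun (\<Phi> u)"] contr by auto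
  \<comment> \<open>Removing the weight from the fixed point gives the integral equation.\<close>
  have "exp (K * \<bar>t\<bar>) *\<^sub>R apply_bcontfun u t = primitive (g u) t" for t
    using app[of u] unfolding u by (simp add: \<Phi>_def exp_minus)
  then have "g u t = f (x0 + primitive (g u) t)" for t
    by (simp add: g_def)
  then have "solution f (\<lambda>t. x0 + primitive (g u) t)"
    unfolding solution_def using deriv[of u] by (auto intro!: derivative_eq_intros)
  then show ?thesis by (intro exI[of _ "\<lambda>t. x0 + primitive (g u) t"]) auto
qed

text \<open>Gronwall for the squared distance, which, unlike the distance, is differentiable
  everywhere: \<open>exp (- 2 * L * t)\<close> times it does not increase.\<close>

lemma solution_dist_le_forward:
  assumes x: "solution f x" and y: "solution f y" and "s \<le> t"
  shows "norm (x t - y t) \<le> exp (L * (t - s)) * norm (x s - y s)"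
proof -
  define d where "d t = x t - y t" for t
  define q where "q t = exp (- 2 * L * t) * (d t \<bullet> d t)" for t
  have d: "(d has_vector_derivative f (x t) - f (y t)) (at t)" for t
    unfolding d_def using x y unfolding solution_def by (intro has_vector_derivative_diff) auto
  have dd: "((\<lambda>t. d t \<bullet> d t) has_real_derivative 2 * (d t \<bullet> (f (x t) - f (y t)))) (at t)" for t
  proof -
    have "((\<lambda>t. d t \<bullet> d t) has_derivative (\<lambda>h. d t \<bullet> (h *\<^sub>R (f (x t) - f (y t))) + (h *\<^sub>R (f (x t) - f (y t))) \<bullet> d t)) (at t)"
      using d[of t] unfolding has_vector_derivative_def by (intro has_derivative_inner)
    then show ?thesis
      unfolding has_field_derivative_def by (rule has_derivative_eq_rhs) (auto simp: fun_eq_iff inner_commute algebra_simps)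
  qed
  have "q t \<le> q s"
  proof (rule DERIV_nonpos_imp_nonincreasing[OF \<open>s \<le> t\<close>])
    fix r
    have "(q has_real_derivative exp (- 2 * L * r) * (2 * (d r \<bullet> (f (x r) - f (y r)))) + (- 2 * L) * exp (- 2 * L * r) * (d r \<bullet> d r)) (at r)"
      unfolding q_def by (rule derivative_eq_intros dd refl)+ (auto simp: algebra_simps)
    moreover have "d r \<bullet> (f (x r) - f (y r)) \<le> L * (d r \<bullet> d r)"
    proof -
      have "d r \<bullet> (f (x r) - f (y r)) \<le> norm (d r) * norm (f (x r) - f (y r))"
        by (rule norm_cauchy_schwarz)
      also have "\<dots> \<le> norm (d r) * (L * norm (d r))"
        unfolding d_def by (intro mult_left_mono norm_diff_le) auto
      finally show ?thesis by (simp add: dot_square_norm power2_eq_square mult_ac)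
    qed
    then have "exp (- 2 * L * r) * (2 * (d r \<bullet> (f (x r) - f (y r)))) + (- 2 * L) * exp (- 2 * L * r) * (d r \<bullet> d r) \<le> 0"
    proof -
      assume "d r \<bullet> (f (x r) - f (y r)) \<le> L * (d r \<bullet> d r)"
      then have "exp (- 2 * L * r) * (d r \<bullet> (f (x r) - f (y r))) \<le> exp (- 2 * L * r) * (L * (d r \<bullet> d r))"
        by (intro mult_left_mono) auto
      then show ?thesis by (simp add: algebra_simps)
    qed
    ultimately show "\<exists>y. DERIV q r :> y \<and> y \<le> 0" by blast
  qed
  then have "exp (2 * L * t) * q t \<le> exp (2 * L * t) * q s" by simp
  then have "d t \<bullet> d t \<le> exp (2 * L * t) * exp (- 2 * L * s) * (d s \<bullet> d s)"
    unfolding q_def by (simp add: mult_ac flip: exp_add mult.assoc)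
  also have "exp (2 * L * t) * exp (- 2 * L * s) = (exp (L * (t - s)))\<^sup>2"
    by (simp add: power2_eq_square algebra_simps flip: exp_add)
  finally have "(norm (d t))\<^sup>2 \<le> (exp (L * (t - s)) * norm (d s))\<^sup>2"
    by (simp add: dot_square_norm power_mult_distrib)
  then show ?thesis
    unfolding d_def by (rule power2_le_imp_le) auto
qed

end

section \<open>Time reversal, time shift and uniqueness\<close>

lemma solution_reverse: "solution f x \<Longrightarrow> solution (\<lambda>z. - f z) (\<lambda>t. x (- t))"
  unfolding solution_def
proof
  fix t assume "\<forall>t. (x has_vector_derivative f (x t)) (at t)"
  then show "((\<lambda>t. x (- t)) has_vector_derivative - f (x (- t))) (at t)"
    using has_vector_derivative_affine_arg[of x "f (x (- t))" "-1" t 0] by simp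
qed

lemma solution_shift: "solution f x \<Longrightarrow> solution f (\<lambda>t. x (t + c))"
  unfolding solution_def
proof
  fix t assume "\<forall>t. (x has_vector_derivative f (x t)) (at t)"
  then show "((\<lambda>t. x (t + c)) has_vector_derivative f (x (t + c))) (at t)"
    using has_vector_derivative_affine_arg[of x "f (x (t + c))" 1 t c] by simp
qed

lemma solution_continuous: "solution f x \<Longrightarrow> continuous_on S x"
  unfolding solution_def by (meson continuous_at_imp_continuous_on has_vector_derivative_continuous)

context lipschitz_field
begin

lemma reversed: "lipschitz_field (\<lambda>z. - f z) L"
  by unfold_locales (use lipschitz in \<open>auto simp: lipschitz_on_def dist_norm norm_minus_commute\<close>)

lemma solution_dist_le:
  assumes x: "solution f x" and y: "solution f y"
  shows "norm (x t - y t) \<le> exp (L * \<bar>t - s\<bar>) * norm (x s - y s)"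
proof (cases "s \<le> t")
  case True
  then show ?thesis using solution_dist_le_forward[OF x y] by simp
next
  case False
  then show ?thesis
    using lipschitz_field.solution_dist_le_forward[OF reversed solution_reverse[OF x] solution_reverse[OF y], of "-s" "-t"]
    by simp
qed

lemma solution_unique:
  assumes "solution f x" "solution f y" "x s = y s"
  shows "x = y"
  using solution_dist_le[OF assms(1,2), of _ s] assms(3) by (auto simp: fun_eq_iff)

lemma solution_unique_shift:
  assumes x: "solution f x" and y: "solution f y" and eq: "x s = y s'"
  shows "x (t + s) = y (t + s')"
  using solution_unique[OF solution_shift[OF x, of s] solution_shift[OF y, of s'], of 0] eq
  by (metis add_0)

lemma solution_periodic:
  assumes "solution f x" "x s = x s'"
  shows "x (t + (s' - s)) = x t"
  using solution_unique_shift[OF assms(1,1) assms(2), of "t - s"] by (simp add: algebra_simps)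

lemma solution_constant:
  assumes "solution f x" "f (x s) = 0"
  shows "x t = x s"
proof -
  have "solution f (\<lambda>t. x s)"
    using assms(2) by (auto simp: solution_def)
  from solution_unique[OF assms(1) this, of s] show ?thesis by metis
qed

end

section \<open>Sections transversal to a planar flow\<close>

definition cross2 :: "real^2 \<Rightarrow> real^2 \<Rightarrow> real" where
  "cross2 u v = u $ 1 * v $ 2 - u $ 2 * v $ 1"

lemma abs_cross2_le: "\<bar>cross2 u v\<bar> \<le> 2 * norm u * norm v"
proof -
  have "\<bar>cross2 u v\<bar> \<le> \<bar>u $ 1\<bar> * \<bar>v $ 2\<bar> + \<bar>u $ 2\<bar> * \<bar>v $ 1\<bar>"
    unfolding cross2_def abs_mult[symmetric] by linarith
  also have "\<dots> \<le> norm u * norm v + norm u * norm v"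
    by (intro add_mono mult_mono component_le_norm_cart) auto
  finally show ?thesis by simp
qed

lemma bounded_bilinear_cross2: "bounded_bilinear cross2"
proof
  show "\<exists>K. \<forall>a b. norm (cross2 a b) \<le> norm a * norm b * K"
    using abs_cross2_le by (intro exI[of _ 2]) (simp add: mult_ac)
qed (auto simp: cross2_def algebra_simps)

interpretation cross2: bounded_bilinear cross2
  by (rule bounded_bilinear_cross2)

lemma cross2_self [simp]: "cross2 u u = 0"
  by (simp add: cross2_def)

lemma cross2_decompose:
  assumes "cross2 u v \<noteq> 0"
  shows "z = (cross2 z v / cross2 u v) *\<^sub>R u + (cross2 u z / cross2 u v) *\<^sub>R v"
proof -
  have "cross2 u v *\<^sub>R z = cross2 z v *\<^sub>R u + cross2 u z *\<^sub>R v"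
    by (simp add: vec_eq_iff forall_2 cross2_def algebra_simps)
  then have "(1 / cross2 u v) *\<^sub>R (cross2 u v *\<^sub>R z) = (1 / cross2 u v) *\<^sub>R (cross2 z v *\<^sub>R u + cross2 u z *\<^sub>R v)"
    by simp
  then show ?thesis using assms by (simp add: scaleR_add_right)
qed

text \<open>Translates the transversality condition of \<open>hyperbolic\<close> into a nonzero
  determinant.\<close>

lemma in_span_if_cross2_eq_0:
  assumes "cross2 u v = 0" "u \<noteq> 0"
  shows "v \<in> span {u}"
proof -
  have "\<exists>k. v = k *\<^sub>R u"
  proof (cases "u $ 1 = 0")
    case True
    then have "u $ 2 \<noteq> 0" using assms(2) by (auto simp: vec_eq_iff forall_2)
    then show ?thesis using assms(1) True
      by (intro exI[of _ "v $ 2 / u $ 2"]) (auto simp: vec_eq_iff forall_2 cross2_def)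
  next
    case False
    then show ?thesis using assms(1)
      by (intro exI[of _ "v $ 1 / u $ 1"]) (auto simp: vec_eq_iff forall_2 cross2_def field_simps)
  qed
  then show ?thesis by (auto intro: span_mul span_base)
qed

lemma norm_diff_le_vector_derivative:
  fixes x :: "real \<Rightarrow> 'a::real_normed_vector"
  assumes "\<And>r. r \<in> closed_segment s t \<Longrightarrow> (x has_vector_derivative x' r) (at r)"
    and "\<And>r. r \<in> closed_segment s t \<Longrightarrow> norm (x' r) \<le> B"
  shows "norm (x t - x s) \<le> B * \<bar>t - s\<bar>"
proof -
  have "norm (x t - x s) \<le> B * norm (t - s)"
  proof (rule differentiable_bound[where S = "closed_segment s t" and f' = "\<lambda>r h. h *\<^sub>R x' r"])
    show "onorm (\<lambda>h. h *\<^sub>R x' r) \<le> B" if "r \<in> closed_segment s t" for r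
    proof (rule onorm_le)
      fix h :: real
      show "norm (h *\<^sub>R x' r) \<le> B * norm h"
        using mult_right_mono[OF assms(2)[OF that], of "\<bar>h\<bar>"] by (simp add: mult.commute)
    qed
  qed (use assms(1) in \<open>auto simp: has_vector_derivative_def intro: has_derivative_at_withinI\<close>)
  then show ?thesis by simp
qed

lemma periodic_of_int:
  fixes x :: "real \<Rightarrow> 'a"
  assumes "\<And>t. x (t + T) = x t"
  shows "x (t + of_int k * T) = x t"
proof (induction k rule: int_induct[of _ 0])
  case (step1 i)
  then show ?case using assms[of "t + of_int i * T"] by (simp add: algebra_simps)
next
  case (step2 i)
  then show ?case using assms[of "t + of_int (i - 1) * T"] by (simp add: algebra_simps)
qed simp

lemma periodic_representative:
  fixes x :: "real \<Rightarrow> 'a"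
  assumes "\<And>t. x (t + T) = x t" "T > 0"
  obtains r where "a \<le> r" "r < a + T" "x r = x t"
proof -
  define k where "k = \<lfloor>(t - a) / T\<rfloor>"
  have "of_int k \<le> (t - a) / T" "(t - a) / T < of_int k + 1"
    unfolding k_def by linarith+
  then have "of_int k * T \<le> t - a" "t - a < of_int k * T + T"
    using assms(2) by (simp_all add: field_simps)
  moreover have "x (t + of_int (- k) * T) = x t"
    by (rule periodic_of_int[where x = x, OF assms(1)])
  ultimately show ?thesis by (intro that[of "t - of_int k * T"]) auto
qed

context lipschitz_field
begin

text \<open>Gronwall bounds the difference of \<open>z\<close> and its shift by \<open>h\<close>;
  dividing by \<open>h\<close> and letting \<open>h\<close> tend to 0 gives the velocity. No
  derivative of \<open>f\<close> is involved.\<close>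

lemma speed_le:
  assumes z: "solution f z"
  shows "norm (f (z t)) \<le> exp (L * \<bar>t - s\<bar>) * norm (f (z s))"
proof -
  have lim: "((\<lambda>h. norm ((z (r + h) - z r) /\<^sub>R h)) \<longlongrightarrow> norm (f (z r))) (at 0)" for r
  proof -
    have "(z has_vector_derivative f (z r)) (at r)"
      using z by (simp add: solution_def)
    then have "((\<lambda>h. norm (z (r + h) - z r - h *\<^sub>R f (z r)) / norm h) \<longlongrightarrow> 0) (at 0)"
      by (simp add: has_vector_derivative_def has_derivative_at)
    moreover have "\<forall>\<^sub>F h in at 0. norm (z (r + h) - z r - h *\<^sub>R f (z r)) / norm h
        = norm ((z (r + h) - z r) /\<^sub>R h - f (z r))"
    proof (rule eventually_at_filter[THEN iffD2], intro always_eventually allI impI)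
      fix h :: real assume "h \<noteq> 0"
      then have "(z (r + h) - z r) /\<^sub>R h - f (z r) = inverse h *\<^sub>R (z (r + h) - z r - h *\<^sub>R f (z r))"
        by (simp add: algebra_simps)
      then show "norm (z (r + h) - z r - h *\<^sub>R f (z r)) / norm h
          = norm ((z (r + h) - z r) /\<^sub>R h - f (z r))"
        by (simp add: divide_inverse_commute)
    qed
    ultimately have "((\<lambda>h. norm ((z (r + h) - z r) /\<^sub>R h - f (z r))) \<longlongrightarrow> 0) (at 0)"
      by (rule Lim_transform_eventually)
    then have "((\<lambda>h. (z (r + h) - z r) /\<^sub>R h) \<longlongrightarrow> f (z r)) (at 0)"
      by (subst Lim_null) (rule tendsto_norm_zero_cancel)
    then show ?thesis by (rule tendsto_norm)
  qed
  show ?thesis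
  proof (rule tendsto_le[OF _ tendsto_mult[OF tendsto_const lim] lim])
    show "\<forall>\<^sub>F h in at 0. norm ((z (t + h) - z t) /\<^sub>R h) \<le> exp (L * \<bar>t - s\<bar>) * norm ((z (s + h) - z s) /\<^sub>R h)"
    proof (rule always_eventually, rule allI)
      fix h
      have "norm (z (t + h) - z t) \<le> exp (L * \<bar>t - s\<bar>) * norm (z (s + h) - z s)"
        using solution_dist_le[OF solution_shift[OF z, of h] z, of t s] by simp
      then have "inverse \<bar>h\<bar> * norm (z (t + h) - z t) \<le> inverse \<bar>h\<bar> * (exp (L * \<bar>t - s\<bar>) * norm (z (s + h) - z s))"
        by (intro mult_left_mono) auto
      then show "norm ((z (t + h) - z t) /\<^sub>R h) \<le> exp (L * \<bar>t - s\<bar>) * norm ((z (s + h) - z s) /\<^sub>R h)"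
        by (simp add: mult_ac)
    qed
  qed auto
qed

text \<open>For times up to 1 and starts within distance 1 of \<open>p\<close> the speed has a bound
  that depends on \<open>f\<close>, \<open>L\<close> and \<open>p\<close> only; it is later called
  \<open>drift\<close>.\<close>

lemma displacement_le:
  assumes z: "solution f z" and "\<bar>t - s\<bar> \<le> 1" "norm (z s - p) \<le> 1"
  shows "norm (z t - z s) \<le> exp L * (norm (f p) + L) * \<bar>t - s\<bar>"
proof (rule norm_diff_le_vector_derivative[where x' = "\<lambda>r. f (z r)"])
  fix r assume "r \<in> closed_segment s t"
  then have r: "\<bar>r - s\<bar> \<le> 1"
    using assms(2) by (auto simp: closed_segment_eq_real_ivl split: if_splits)
  show "(z has_vector_derivative f (z r)) (at r)"
    using z by (simp add: solution_def)
  have "norm (f (z r)) \<le> exp (L * \<bar>r - s\<bar>) * norm (f (z s))"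
    by (rule speed_le[OF z])
  also have "\<dots> \<le> exp (L * 1) * (norm (f p) + L)"
  proof (rule mult_mono)
    have "norm (f (z s)) \<le> norm (f p) + norm (f (z s) - f p)"
      by (metis add.commute diff_add_cancel norm_triangle_ineq)
    also have "norm (f (z s) - f p) \<le> L * 1"
      using norm_diff_le[of "z s" p] mult_left_mono[OF assms(3) L_nonneg] by linarith
    finally show "norm (f (z s)) \<le> norm (f p) + L" by simp
  qed (use r L_nonneg in \<open>auto intro: mult_left_le\<close>)
  finally show "norm (f (z r)) \<le> exp L * (norm (f p) + L)" by simp
qed

end

section \<open>Coordinates along the flow and along a section\<close>

locale planar_section = lipschitz_field f L for f :: "real^2 \<Rightarrow> real^2" and L +
  fixes p v :: "real^2"
  assumes transversal: "cross2 (f p) v \<noteq> 0"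
begin

text \<open>The affine coordinates of \<open>z = p + phase z *\<^sub>R f p + coord z *\<^sub>R v\<close>; the section
  is \<open>phase z = 0\<close>.\<close>

definition phase :: "real^2 \<Rightarrow> real" where
  "phase z = cross2 (z - p) v / cross2 (f p) v"

definition coord :: "real^2 \<Rightarrow> real" where
  "coord z = cross2 (f p) (z - p) / cross2 (f p) v"

text \<open>One constant that bounds both coordinate functionals by the distance from
  \<open>p\<close>; the summand 1 keeps it at least 1.\<close>

definition cbound :: real where
  "cbound = 2 * (norm (f p) + norm v) / \<bar>cross2 (f p) v\<bar> + 1"

lemma decompose: "z = p + phase z *\<^sub>R f p + coord z *\<^sub>R v"
  using cross2_decompose[OF transversal, of "z - p"] by (simp add: phase_def coord_def algebra_simps)

lemma coord_section [simp]: "coord (p + s *\<^sub>R v) = s"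
  using transversal by (simp add: coord_def cross2.scaleR_right)

lemma phase_section [simp]: "phase (p + s *\<^sub>R v) = 0"
  by (simp add: phase_def cross2.scaleR_left)

lemma on_section: "phase z = 0 \<Longrightarrow> z = p + coord z *\<^sub>R v"
  using decompose[of z] by simp

lemma cbound_ge_1: "cbound \<ge> 1"
  by (simp add: cbound_def)

lemma cross2_ratio_le:
  "\<bar>cross2 u v / cross2 (f p) v\<bar> \<le> cbound * norm u"
  "\<bar>cross2 (f p) u / cross2 (f p) v\<bar> \<le> cbound * norm u"
proof -
  have k: "\<bar>cross2 (f p) v\<bar> > 0" using transversal by simp
  have "\<bar>cross2 u v\<bar> \<le> 2 * norm u * norm v"
    by (rule abs_cross2_le)
  also have "\<dots> \<le> 2 * norm u * (norm (f p) + norm v)"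
    by (intro mult_left_mono) auto
  finally have "\<bar>cross2 u v\<bar> / \<bar>cross2 (f p) v\<bar> \<le> 2 * norm u * (norm (f p) + norm v) / \<bar>cross2 (f p) v\<bar>"
    using k by (intro divide_right_mono) auto
  also have "\<dots> \<le> cbound * norm u"
    by (simp add: cbound_def algebra_simps add_divide_distrib)
  finally show "\<bar>cross2 u v / cross2 (f p) v\<bar> \<le> cbound * norm u" by simp
  have "\<bar>cross2 (f p) u\<bar> \<le> 2 * norm (f p) * norm u"
    by (rule abs_cross2_le)
  also have "\<dots> \<le> 2 * (norm (f p) + norm v) * norm u"
    by (intro mult_left_mono mult_right_mono) auto
  finally have "\<bar>cross2 (f p) u\<bar> / \<bar>cross2 (f p) v\<bar> \<le> 2 * (norm (f p) + norm v) * norm u / \<bar>cross2 (f p) v\<bar>"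
    using k by (intro divide_right_mono) auto
  also have "\<dots> \<le> cbound * norm u"
    by (simp add: cbound_def algebra_simps add_divide_distrib)
  finally show "\<bar>cross2 (f p) u / cross2 (f p) v\<bar> \<le> cbound * norm u" by simp
qed

lemma abs_phase_le: "\<bar>phase z\<bar> \<le> cbound * norm (z - p)"
  and abs_coord_le: "\<bar>coord z\<bar> \<le> cbound * norm (z - p)"
  unfolding phase_def coord_def by (rule cross2_ratio_le)+

lemma phase_has_derivative:
  assumes "solution f z"
  shows "((\<lambda>t. phase (z t)) has_real_derivative 1 + cross2 (f (z t) - f p) v / cross2 (f p) v) (at t)"
proof -
  have "(z has_vector_derivative f (z t)) (at t)"
    using assms by (simp add: solution_def)
  then have "((\<lambda>t. cross2 (z t - p) v) has_vector_derivative cross2 (f (z t)) v) (at t)"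
    by (auto simp: cross2.zero_left cross2.zero_right intro!: derivative_eq_intros cross2.has_vector_derivative[THEN has_vector_derivative_eq_rhs])
  then have "((\<lambda>t. cross2 (z t - p) v) has_real_derivative cross2 (f (z t)) v) (at t)"
    by (simp add: has_real_derivative_iff_has_vector_derivative)
  then have "((\<lambda>t. phase (z t)) has_real_derivative cross2 (f (z t)) v / cross2 (f p) v) (at t)"
    unfolding phase_def by (rule DERIV_cdivide)
  then show ?thesis
    using transversal by (simp add: cross2.diff_left field_simps)
qed

lemma coord_has_derivative:
  assumes "solution f z"
  shows "((\<lambda>t. coord (z t)) has_real_derivative cross2 (f p) (f (z t) - f p) / cross2 (f p) v) (at t)"
proof -
  have "(z has_vector_derivative f (z t)) (at t)"
    using assms by (simp add: solution_def)
  then have "((\<lambda>t. cross2 (f p) (z t - p)) has_vector_derivative cross2 (f p) (f (z t))) (at t)"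
    by (auto simp: cross2.zero_left cross2.zero_right intro!: derivative_eq_intros cross2.has_vector_derivative[THEN has_vector_derivative_eq_rhs])
  then have "((\<lambda>t. cross2 (f p) (z t - p)) has_real_derivative cross2 (f p) (f (z t))) (at t)"
    by (simp add: has_real_derivative_iff_has_vector_derivative)
  then have "((\<lambda>t. coord (z t)) has_real_derivative cross2 (f p) (f (z t)) / cross2 (f p) v) (at t)"
    unfolding coord_def by (rule DERIV_cdivide)
  then show ?thesis
    by (simp add: cross2.diff_right)
qed

definition drift :: real where
  "drift = exp L * (norm (f p) + L)"

lemma drift_nonneg: "drift \<ge> 0"
  using L_nonneg by (simp add: drift_def)

lemma dist_base_le:
  assumes "solution f z" "\<bar>t - s\<bar> \<le> 1" "norm (z s - p) \<le> 1"
  shows "norm (z t - p) \<le> norm (z s - p) + drift * \<bar>t - s\<bar>"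
  using displacement_le[OF assms] norm_triangle_ineq[of "z t - z s" "z s - p"]
  unfolding drift_def by simp

text \<open>Within this time and distance the field differs from \<open>f p\<close> so little that
  the rate of \<open>phase\<close>, which is 1 at \<open>p\<close>, stays above
  \<open>1 / 2\<close>.\<close>

definition window :: real where
  "window = 1 / (2 * (1 + cbound * L * (1 + drift)))"

lemma window_pos: "window > 0" and window_le_1: "window \<le> 1"
  and window_small: "cbound * L * (1 + drift) * window \<le> 1 / 2"
proof -
  have "0 \<le> cbound * L * (1 + drift)"
    using cbound_ge_1 L_nonneg drift_nonneg by simp
  then show "window > 0" "window \<le> 1" "cbound * L * (1 + drift) * window \<le> 1 / 2"
    by (auto simp: window_def field_simps)
qed

text \<open>Besides locating a crossing, this shows that an orbit near \<open>p\<close> meets the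
  line of the section at most once during a window. Both the first-return property and the
  uniqueness of the hit rest on it.\<close>

lemma phase_growth:
  assumes z: "solution f z" and near: "norm (z t0 - p) \<le> window"
    and "\<bar>s - t0\<bar> \<le> window" "\<bar>t - t0\<bar> \<le> window" "s \<le> t"
  shows "phase (z t) - phase (z s) \<ge> (t - s) / 2"
proof -
  have "phase (z s) - s / 2 \<le> phase (z t) - t / 2"
  proof (rule DERIV_nonneg_imp_nondecreasing[OF \<open>s \<le> t\<close>])
    fix r assume "s \<le> r" "r \<le> t"
    then have r: "\<bar>r - t0\<bar> \<le> window" using assms by auto
    have "norm (z r - p) \<le> norm (z t0 - p) + drift * \<bar>r - t0\<bar>"
      using r near window_le_1 by (intro dist_base_le z) auto
    also have "\<dots> \<le> window + drift * window"
      using near r drift_nonneg by (intro add_mono mult_left_mono) auto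
    finally have d: "norm (z r - p) \<le> (1 + drift) * window" by (simp add: algebra_simps)
    have "\<bar>cross2 (f (z r) - f p) v / cross2 (f p) v\<bar> \<le> cbound * norm (f (z r) - f p)"
      by (rule cross2_ratio_le)
    also have "\<dots> \<le> cbound * (L * ((1 + drift) * window))"
      using cbound_ge_1 d L_nonneg norm_diff_le[of "z r" p]
      by (intro mult_left_mono) (auto intro: order_trans mult_left_mono)
    also have "\<dots> \<le> 1 / 2"
      using window_small by (simp add: mult_ac)
    finally have "cross2 (f (z r) - f p) v / cross2 (f p) v \<ge> - 1 / 2" by linarith
    moreover have "((\<lambda>t. phase (z t) - t / 2) has_real_derivative 1 + cross2 (f (z r) - f p) v / cross2 (f p) v - 1 / 2) (at r)"
      by (intro DERIV_diff phase_has_derivative[OF z] DERIV_cdivide DERIV_ident)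
    ultimately show "\<exists>y. ((\<lambda>t. phase (z t) - t / 2) has_real_derivative y) (at r) \<and> 0 \<le> y"
      by (intro exI conjI) auto
  qed
  then show ?thesis by (simp add: field_simps)
qed

text \<open>At distance \<delta> from \<open>p\<close> the phase is at most
  \<open>cbound * \<delta>\<close> in modulus and grows at rate at least \<open>1 / 2\<close>, so it
  vanishes within time \<open>2 * cbound * \<delta>\<close>. Since \<open>f p\<close> has no
  component along \<open>v\<close>, the rate of \<open>coord\<close> is only of order \<delta>, and
  its total change is of order \<open>\<delta>\<^sup>2\<close>.\<close>

lemma hits_section:
  obtains C \<eta> where "C > 0" "\<eta> > 0"
    "\<And>z t0. solution f z \<Longrightarrow> norm (z t0 - p) < \<eta> \<Longrightarrow>
       \<exists>t. \<bar>t - t0\<bar> \<le> C * norm (z t0 - p) \<and> phase (z t) = 0 \<and>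
           \<bar>coord (z t) - coord (z t0)\<bar> \<le> C * (norm (z t0 - p))\<^sup>2"
proof -
  define C1 where "C1 = 2 * cbound"
  define C where "C = C1 + cbound * L * (1 + drift * C1) * C1"
  define \<eta> where "\<eta> = window / C1"
  have C1: "C1 \<ge> 2" using cbound_ge_1 by (simp add: C1_def)
  have Cnn: "cbound * L * (1 + drift * C1) * C1 \<ge> 0"
    using cbound_ge_1 L_nonneg drift_nonneg C1 by (intro mult_nonneg_nonneg add_nonneg_nonneg) auto
  have \<eta>: "\<eta> > 0" "\<eta> \<le> window"
    using C1 window_pos by (auto simp: \<eta>_def field_simps)
  show thesis
  proof (rule that[of C \<eta>])
    fix z t0 assume z: "solution f z" and near: "norm (z t0 - p) < \<eta>"
    define \<delta> where "\<delta> = norm (z t0 - p)"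
    have \<delta>: "\<delta> \<ge> 0" "\<delta> \<le> window" "C1 * \<delta> \<le> window"
      using near \<eta>(2) C1 by (simp_all add: \<delta>_def) (simp add: \<eta>_def field_simps)
    have C1\<delta>: "0 \<le> C1 * \<delta>" using C1 \<delta> by simp
    have "phase (z (t0 - C1 * \<delta>)) \<le> 0" "0 \<le> phase (z (t0 + C1 * \<delta>))"
      using phase_growth[OF z, of t0 "t0 - C1 * \<delta>" t0] phase_growth[OF z, of t0 t0 "t0 + C1 * \<delta>"]
        abs_phase_le[of "z t0"] \<delta> C1\<delta> window_pos unfolding C1_def \<delta>_def[symmetric] by auto
    then obtain t where t: "t0 - C1 * \<delta> \<le> t" "t \<le> t0 + C1 * \<delta>" "phase (z t) = 0"
      using IVT[of "\<lambda>t. phase (z t)" "t0 - C1 * \<delta>" 0 "t0 + C1 * \<delta>"]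
        DERIV_isCont[OF phase_has_derivative[OF z]] C1\<delta> by auto
    have "norm (coord (z t) - coord (z t0)) \<le> (cbound * L * (1 + drift * C1) * \<delta>) * \<bar>t - t0\<bar>"
    proof (rule norm_diff_le_vector_derivative)
      fix r assume "r \<in> closed_segment t0 t"
      then have r: "\<bar>r - t0\<bar> \<le> C1 * \<delta>"
        using t by (auto simp: closed_segment_eq_real_ivl split: if_splits)
      show "((\<lambda>t. coord (z t)) has_vector_derivative cross2 (f p) (f (z r) - f p) / cross2 (f p) v) (at r)"
        using coord_has_derivative[OF z] by (simp add: has_real_derivative_iff_has_vector_derivative)
      have "norm (z r - p) \<le> \<delta> + drift * \<bar>r - t0\<bar>"
        unfolding \<delta>_def using r \<delta> window_le_1 by (intro dist_base_le z) (auto simp: \<delta>_def)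
      also have "\<dots> \<le> \<delta> + drift * (C1 * \<delta>)"
        using r drift_nonneg by (intro add_left_mono mult_left_mono) auto
      finally have d: "norm (z r - p) \<le> (1 + drift * C1) * \<delta>" by (simp add: algebra_simps)
      have "\<bar>cross2 (f p) (f (z r) - f p) / cross2 (f p) v\<bar> \<le> cbound * norm (f (z r) - f p)"
        by (rule cross2_ratio_le)
      also have "\<dots> \<le> cbound * (L * ((1 + drift * C1) * \<delta>))"
        using cbound_ge_1 d L_nonneg norm_diff_le[of "z r" p]
        by (intro mult_left_mono) (auto intro: order_trans mult_left_mono)
      finally show "norm (cross2 (f p) (f (z r) - f p) / cross2 (f p) v) \<le> cbound * L * (1 + drift * C1) * \<delta>"
        by (simp add: mult_ac)
    qed
    also have "\<dots> \<le> (cbound * L * (1 + drift * C1) * \<delta>) * (C1 * \<delta>)"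
      using t cbound_ge_1 L_nonneg drift_nonneg C1 \<delta> by (intro mult_left_mono mult_nonneg_nonneg add_nonneg_nonneg) auto
    also have "\<dots> = (cbound * L * (1 + drift * C1) * C1) * \<delta>\<^sup>2"
      by (simp add: power2_eq_square)
    also have "\<dots> \<le> C * \<delta>\<^sup>2"
      using C1 by (intro mult_right_mono) (auto simp: C_def)
    finally have "\<bar>coord (z t) - coord (z t0)\<bar> \<le> C * \<delta>\<^sup>2" by simp
    moreover have "C1 * \<delta> \<le> C * \<delta>"
      using Cnn \<delta> by (intro mult_right_mono) (auto simp: C_def)
    ultimately show "\<exists>t. \<bar>t - t0\<bar> \<le> C * norm (z t0 - p) \<and> phase (z t) = 0 \<and>
           \<bar>coord (z t) - coord (z t0)\<bar> \<le> C * (norm (z t0 - p))\<^sup>2"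
      using t by (intro exI[of _ t]) (auto simp: \<delta>_def)
  qed (use \<eta> Cnn C1 in \<open>auto simp: C_def\<close>)
qed

end

section \<open>The first-return map of a periodic orbit\<close>

lemma mem_section_segment_iff:
  assumes "e \<ge> 0"
  shows "z \<in> section_segment p v e \<longleftrightarrow> (\<exists>r. \<bar>r\<bar> \<le> e \<and> z = p + r *\<^sub>R v)"
proof
  assume "z \<in> section_segment p v e"
  then obtain u where u: "0 \<le> u" "u \<le> 1" "z = (1 - u) *\<^sub>R (p - e *\<^sub>R v) + u *\<^sub>R (p + e *\<^sub>R v)"
    by (auto simp: section_segment_def in_segment)
  have "z = p + ((2 * u - 1) * e) *\<^sub>R v"
    unfolding u(3) by (simp add: vec_eq_iff algebra_simps)
  moreover have "\<bar>(2 * u - 1) * e\<bar> \<le> 1 * e"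
    unfolding abs_mult using u assms by (intro mult_mono) auto
  ultimately show "\<exists>r. \<bar>r\<bar> \<le> e \<and> z = p + r *\<^sub>R v" by auto
next
  assume "\<exists>r. \<bar>r\<bar> \<le> e \<and> z = p + r *\<^sub>R v"
  then obtain r where r: "\<bar>r\<bar> \<le> e" "z = p + r *\<^sub>R v" by blast
  show "z \<in> section_segment p v e"
  proof (cases "e = 0")
    case True
    then show ?thesis using r by (auto simp: section_segment_def)
  next
    case False
    define u where "u = (r / e + 1) / 2"
    have u: "0 \<le> u" "u \<le> 1" "2 * u * e = r + e"
      using r(1) assms False by (auto simp: u_def field_simps)
    have "z = (1 - u) *\<^sub>R (p - e *\<^sub>R v) + u *\<^sub>R (p + e *\<^sub>R v)"
    proof -
      have "(1 - u) *\<^sub>R (p - e *\<^sub>R v) + u *\<^sub>R (p + e *\<^sub>R v) = p + (2 * u * e - e) *\<^sub>R v"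
        by (simp add: vec_eq_iff algebra_simps)
      then show ?thesis using u(3) r(2) by simp
    qed
    then show ?thesis
      using u by (auto simp: section_segment_def in_segment)
  qed
qed

text \<open>Up to the factor \<open>cross2 (f p) v\<close>, the quantity \<open>cross2 (f p) (z - p)\<close> is the
  section coordinate of the projection of \<open>z\<close> along the flow, so \<open>m\<close> is the derivative at
  \<open>p\<close> of the return map to any section.\<close>

definition linear_return :: "(real^2 \<Rightarrow> real^2) \<Rightarrow> real^2 \<Rightarrow> real \<Rightarrow> real \<Rightarrow> bool" where
  "linear_return f p T m \<longleftrightarrow> (\<forall>\<epsilon>>0. \<exists>\<rho>>0. \<forall>z. solution f z \<and> norm (z 0 - p) < \<rho> \<longrightarrow>
     \<bar>cross2 (f p) (z T - p) - m * cross2 (f p) (z 0 - p)\<bar> \<le> \<epsilon> * norm (z 0 - p))"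

locale periodic_section = planar_section +
  fixes x :: "real \<Rightarrow> real^2" and T :: real
  assumes sol: "solution f x" and base [simp]: "x 0 = p"
    and T_pos: "T > 0" and periodic: "\<And>t. x (t + T) = x t"
    and minimal: "\<And>t. 0 < t \<Longrightarrow> t < T \<Longrightarrow> x t \<noteq> p"
begin

lemma x_T [simp]: "x T = p"
  using periodic[of 0] by simp

text \<open>The horizon \<open>2 * T\<close> leaves room for return times that exceed
  \<open>T\<close>.\<close>

lemma dist_orbit_le:
  assumes "solution f z" "0 \<le> t" "t \<le> 2 * T"
  shows "norm (z t - x t) \<le> exp (L * (2 * T)) * norm (z 0 - p)"
proof -
  have "norm (z t - x t) \<le> exp (L * \<bar>t - 0\<bar>) * norm (z 0 - x 0)"
    by (rule solution_dist_le[OF assms(1) sol])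
  also have "\<dots> \<le> exp (L * (2 * T)) * norm (z 0 - x 0)"
    using assms L_nonneg by (intro mult_right_mono) (auto intro: mult_left_mono)
  finally show ?thesis by simp
qed

text \<open>At time \<open>T\<close> the orbit is near the section but not on it. By
  \<open>hits_section\<close> the remaining way costs a time of order \<open>s\<close> and changes
  the coordinate only to second order, so the linear part \<open>m * s\<close> survives.\<close>

lemma return_estimate:
  assumes m: "linear_return f p T m"
  obtains C where "C > 0"
    "\<And>\<epsilon>. \<epsilon> > 0 \<Longrightarrow> \<exists>\<rho>>0. \<forall>z s. solution f z \<and> z 0 = p + s *\<^sub>R v \<and> \<bar>s\<bar> < \<rho> \<longrightarrow>
       (\<exists>\<tau>. \<bar>\<tau> - T\<bar> \<le> C * \<bar>s\<bar> \<and> phase (z \<tau>) = 0 \<and> \<bar>coord (z \<tau>) - m * s\<bar> \<le> \<epsilon> * \<bar>s\<bar>)"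
proof -
  obtain C \<eta> where C: "C > 0" and \<eta>: "\<eta> > 0" and hits:
    "\<And>z t0. solution f z \<Longrightarrow> norm (z t0 - p) < \<eta> \<Longrightarrow>
       \<exists>t. \<bar>t - t0\<bar> \<le> C * norm (z t0 - p) \<and> phase (z t) = 0 \<and>
           \<bar>coord (z t) - coord (z t0)\<bar> \<le> C * (norm (z t0 - p))\<^sup>2"
    using hits_section by blast
  define A where "A = exp (L * (2 * T)) * norm v + 1"
  have A: "A \<ge> 1" by (simp add: A_def)
  define \<kappa> where "\<kappa> = cross2 (f p) v"
  have \<kappa>: "\<bar>\<kappa>\<bar> > 0" using transversal by (simp add: \<kappa>_def)
  show thesis
  proof (rule that[of "C * A"])
    show "C * A > 0" using C A by simp
    fix \<epsilon> :: real assume \<epsilon>: "\<epsilon> > 0"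
    define \<epsilon>' where "\<epsilon>' = \<epsilon> * \<bar>\<kappa>\<bar> / (2 * (norm v + 1))"
    have nv: "norm v + 1 > 0" using norm_ge_zero[of v] by linarith
    have \<epsilon>': "\<epsilon>' > 0" using \<epsilon> \<kappa> nv by (simp add: \<epsilon>'_def)
    then obtain \<rho> where \<rho>: "\<rho> > 0" and lin: "\<And>z. solution f z \<Longrightarrow> norm (z 0 - p) < \<rho> \<Longrightarrow>
        \<bar>cross2 (f p) (z T - p) - m * cross2 (f p) (z 0 - p)\<bar> \<le> \<epsilon>' * norm (z 0 - p)"
      using m unfolding linear_return_def by blast
    \<comment> \<open>The three bounds bring \<open>z 0\<close> into the range of the linear
      estimate, \<open>z T\<close> into the range of \<open>hits\<close>, and the quadratic
      correction below \<open>\<epsilon> / 2 * \<bar>s\<bar>\<close>.\<close>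
    define \<rho>' where "\<rho>' = Min {\<rho> / (norm v + 1), \<eta> / A, \<epsilon> / (2 * C * A\<^sup>2)}"
    have \<rho>': "\<rho>' > 0" "\<rho>' \<le> \<rho> / (norm v + 1)" "\<rho>' \<le> \<eta> / A" "\<rho>' \<le> \<epsilon> / (2 * C * A\<^sup>2)"
      using \<rho> \<eta> \<epsilon> C A nv by (auto simp: \<rho>'_def)
    show "\<exists>\<rho>>0. \<forall>z s. solution f z \<and> z 0 = p + s *\<^sub>R v \<and> \<bar>s\<bar> < \<rho> \<longrightarrow>
       (\<exists>\<tau>. \<bar>\<tau> - T\<bar> \<le> C * A * \<bar>s\<bar> \<and> phase (z \<tau>) = 0 \<and> \<bar>coord (z \<tau>) - m * s\<bar> \<le> \<epsilon> * \<bar>s\<bar>)"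
    proof (rule exI[of _ \<rho>'], intro conjI allI impI \<rho>')
      fix z s assume "solution f z \<and> z 0 = p + s *\<^sub>R v \<and> \<bar>s\<bar> < \<rho>'"
      then have z: "solution f z" "z 0 = p + s *\<^sub>R v" and s: "\<bar>s\<bar> < \<rho>'" by auto
      have d0: "norm (z 0 - p) = \<bar>s\<bar> * norm v" using z by simp
      have "norm (z T - x T) \<le> exp (L * (2 * T)) * norm (z 0 - p)"
        using T_pos by (intro dist_orbit_le z) auto
      then have dT: "norm (z T - p) \<le> A * \<bar>s\<bar>"
        by (simp add: d0 A_def algebra_simps)
      have "A * \<bar>s\<bar> < \<eta>"
      proof -
        have "\<bar>s\<bar> < \<eta> / A" using s \<rho>'(3) by linarith
        then show ?thesis using A by (simp add: pos_less_divide_eq mult.commute)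
      qed
      then obtain \<tau> where \<tau>: "\<bar>\<tau> - T\<bar> \<le> C * norm (z T - p)" "phase (z \<tau>) = 0"
        "\<bar>coord (z \<tau>) - coord (z T)\<bar> \<le> C * (norm (z T - p))\<^sup>2"
        using hits[OF z(1), of T] dT by force
      have "\<bar>s\<bar> * (norm v + 1) < \<rho>"
      proof -
        have "\<bar>s\<bar> < \<rho> / (norm v + 1)" using s \<rho>'(2) by linarith
        then show ?thesis using nv by (simp only: pos_less_divide_eq)
      qed
      then have "norm (z 0 - p) < \<rho>"
        using abs_ge_zero[of s] unfolding d0 distrib_left by linarith
      from lin[OF z(1) this]
      have "\<bar>\<kappa> * coord (z T) - m * (\<kappa> * s)\<bar> \<le> \<epsilon>' * (\<bar>s\<bar> * norm v)"
        unfolding d0 unfolding z(2) using transversal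
        by (simp add: coord_def \<kappa>_def cross2.scaleR_right mult_ac)
      also have "\<dots> \<le> \<epsilon>' * (\<bar>s\<bar> * (norm v + 1))"
        using \<epsilon>' by (intro mult_left_mono) auto
      also have "\<dots> = \<bar>\<kappa>\<bar> * (\<epsilon> / 2 * \<bar>s\<bar>)"
        using nv by (simp add: \<epsilon>'_def field_simps)
      finally have "\<bar>\<kappa> * (coord (z T) - m * s)\<bar> \<le> \<bar>\<kappa>\<bar> * (\<epsilon> / 2 * \<bar>s\<bar>)"
        by (simp add: algebra_simps)
      then have 1: "\<bar>coord (z T) - m * s\<bar> \<le> \<epsilon> / 2 * \<bar>s\<bar>"
        using \<kappa> by (simp add: abs_mult)
      have "C * (norm (z T - p))\<^sup>2 \<le> C * (A * \<bar>s\<bar>)\<^sup>2"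
        using dT C by (intro mult_left_mono power_mono) auto
      also have "\<dots> = (C * A\<^sup>2 * \<bar>s\<bar>) * \<bar>s\<bar>"
        by (simp add: power2_eq_square)
      also have "\<dots> \<le> (\<epsilon> / 2) * \<bar>s\<bar>"
      proof (rule mult_right_mono)
        have "C * A\<^sup>2 > 0" using C A by simp
        then show "C * A\<^sup>2 * \<bar>s\<bar> \<le> \<epsilon> / 2"
        proof -
          assume "C * A\<^sup>2 > 0"
          moreover have "\<bar>s\<bar> \<le> \<epsilon> / (2 * C * A\<^sup>2)" using s \<rho>'(4) by linarith
          ultimately show ?thesis by (simp add: pos_le_divide_eq mult_ac)
        qed
      qed auto
      finally have "\<bar>coord (z \<tau>) - coord (z T)\<bar> \<le> \<epsilon> / 2 * \<bar>s\<bar>" using \<tau>(3) by linarith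
      moreover have "C * norm (z T - p) \<le> C * A * \<bar>s\<bar>"
        using dT C by simp
      ultimately show "\<exists>\<tau>. \<bar>\<tau> - T\<bar> \<le> C * A * \<bar>s\<bar> \<and> phase (z \<tau>) = 0 \<and> \<bar>coord (z \<tau>) - m * s\<bar> \<le> \<epsilon> * \<bar>s\<bar>"
        using \<tau>(1,2) 1 by (intro exI[of _ \<tau>] conjI) linarith+
    qed
  qed
qed

text \<open>Compactness turns the minimality of the period into a positive distance. If the two
  windows cover the whole period, no time is left and any \<open>d\<close> serves.\<close>

lemma orbit_leaves_base:
  obtains d where "d > 0" "\<And>t. window \<le> t \<Longrightarrow> t \<le> T - window \<Longrightarrow> norm (x t - p) \<ge> d"
proof (cases "window \<le> T - window")
  case True
  have "continuous_on {window..T - window} (\<lambda>t. norm (x t - p))"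
    by (intro continuous_intros solution_continuous[OF sol])
  then obtain t0 where t0: "t0 \<in> {window..T - window}" "\<And>t. t \<in> {window..T - window} \<Longrightarrow> norm (x t0 - p) \<le> norm (x t - p)"
    using continuous_attains_inf[of "{window..T - window}" "\<lambda>t. norm (x t - p)"] True by auto
  moreover have "x t0 \<noteq> p" using minimal[of t0] t0(1) window_pos by auto
  ultimately show thesis by (intro that[of "norm (x t0 - p)"]) auto
next
  case False
  then show thesis by (intro that[of 1]) auto
qed

text \<open>Shortly after the start and shortly before \<open>\<tau>\<close> the strictly growing
  phase excludes a second zero. In between the orbit follows \<open>x\<close>, which stays at
  distance \<open>d\<close> from \<open>p\<close>, out of reach of the segment.\<close>

lemma first_return_near:
  obtains \<epsilon> \<rho> where "\<epsilon> > 0" "\<rho> > 0"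
    "\<And>z s \<tau> t. solution f z \<Longrightarrow> z 0 = p + s *\<^sub>R v \<Longrightarrow> \<bar>s\<bar> < \<rho> \<Longrightarrow> \<bar>\<tau> - T\<bar> \<le> window \<Longrightarrow> \<tau> > 0 \<Longrightarrow>
       phase (z \<tau>) = 0 \<Longrightarrow> t \<in> {0<..<\<tau>} \<Longrightarrow> z t \<notin> section_segment p v \<epsilon>"
proof -
  obtain d where d: "d > 0" "\<And>t. window \<le> t \<Longrightarrow> t \<le> T - window \<Longrightarrow> norm (x t - p) \<ge> d"
    using orbit_leaves_base by blast
  define A where "A = exp (L * (2 * T)) * norm v + norm v + 1"
  have A: "A \<ge> 1" by (simp add: A_def)
  \<comment> \<open>The same number is the half-length of the segment and the bound on the starting
    parameter; \<open>A\<close> dominates both the Gronwall factor times \<open>norm v\<close> and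
    \<open>norm v\<close> itself.\<close>
  define \<rho> where "\<rho> = min window (d / 2) / A"
  have \<rho>: "\<rho> > 0" using A d window_pos by (simp add: \<rho>_def)
  show thesis
  proof (rule that[OF \<rho> \<rho>])
    fix z s \<tau> t assume z: "solution f z" "z 0 = p + s *\<^sub>R v" and s: "\<bar>s\<bar> < \<rho>"
      and \<tau>: "\<bar>\<tau> - T\<bar> \<le> window" "\<tau> > 0" "phase (z \<tau>) = 0" and "t \<in> {0<..<\<tau>}"
    then have t: "0 < t" "t < \<tau>" by auto
    have sA: "\<bar>s\<bar> * A < min window (d / 2)" and \<rho>A: "\<rho> * A \<le> d / 2"
      using s A by (auto simp: \<rho>_def field_simps)
    have close: "norm (z r - x r) < min window (d / 2)" if "0 \<le> r" "r \<le> 2 * T" for r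
    proof -
      have "norm (z r - x r) \<le> exp (L * (2 * T)) * norm (z 0 - p)"
        by (rule dist_orbit_le[OF z(1) that])
      also have "\<dots> \<le> \<bar>s\<bar> * A"
        using z(2) by (simp add: A_def algebra_simps)
      finally show ?thesis using sA by simp
    qed
    have base0: "norm (z 0 - p) \<le> window"
      using close[of 0] T_pos by simp
    have baseT: "norm (z T - p) \<le> window"
      using close[of T] T_pos by simp
    show "z t \<notin> section_segment p v \<rho>"
    proof
      assume "z t \<in> section_segment p v \<rho>"
      then obtain r where r: "\<bar>r\<bar> \<le> \<rho>" "z t = p + r *\<^sub>R v"
        using mem_section_segment_iff \<rho> by force
      consider "t \<le> window" | "t \<ge> T - window" | "window \<le> t" "t \<le> T - window" by linarith
      then show False
      proof cases
        case 1
        then have "phase (z t) - phase (z 0) \<ge> (t - 0) / 2"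
          using phase_growth[OF z(1) base0, of 0 t] t window_pos by simp
        then show ?thesis using r t z(2) by simp
      next
        case 2
        then have "phase (z \<tau>) - phase (z t) \<ge> (\<tau> - t) / 2"
          using phase_growth[OF z(1) baseT, of t \<tau>] t \<tau> window_pos by simp
        then show ?thesis using r t \<tau> by simp
      next
        case 3
        have "norm (x t - p) \<le> norm (z t - x t) + norm (z t - p)"
          by (metis norm_minus_commute norm_triangle_sub add.commute norm_triangle_ineq4 diff_diff_eq2 diff_add_cancel)
        moreover have "norm (z t - p) \<le> \<rho> * norm v"
          using r by (simp add: mult_right_mono)
        moreover have "\<rho> * norm v \<le> \<rho> * A"
          using \<rho> by (intro mult_left_mono) (auto simp: A_def)
        moreover have "norm (z t - x t) < d / 2"
          using close[of t] 3 t window_pos T_pos by simp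
        ultimately show ?thesis using d(2)[OF 3] \<rho>A by linarith
      qed
    qed
  qed
qed

lemma hyperbolic_at_base:
  assumes m: "linear_return f p T m"
  shows "\<exists>\<epsilon>>0. range x \<inter> section_segment p v \<epsilon> = {p} \<and>
    (\<exists>P. (\<forall>\<^sub>F s in nhds 0. first_return f p v \<epsilon> s (P s)) \<and> (P has_real_derivative m) (at 0))"
proof -
  obtain \<epsilon> \<rho> where \<epsilon>: "\<epsilon> > 0" and \<rho>: "\<rho> > 0" and avoid:
    "\<And>z s \<tau> t. solution f z \<Longrightarrow> z 0 = p + s *\<^sub>R v \<Longrightarrow> \<bar>s\<bar> < \<rho> \<Longrightarrow> \<bar>\<tau> - T\<bar> \<le> window \<Longrightarrow> \<tau> > 0 \<Longrightarrow>
       phase (z \<tau>) = 0 \<Longrightarrow> t \<in> {0<..<\<tau>} \<Longrightarrow> z t \<notin> section_segment p v \<epsilon>"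
    using first_return_near by blast
  obtain C where C: "C > 0" and ret:
    "\<And>\<epsilon>. \<epsilon> > 0 \<Longrightarrow> \<exists>\<rho>>0. \<forall>z s. solution f z \<and> z 0 = p + s *\<^sub>R v \<and> \<bar>s\<bar> < \<rho> \<longrightarrow>
       (\<exists>\<tau>. \<bar>\<tau> - T\<bar> \<le> C * \<bar>s\<bar> \<and> phase (z \<tau>) = 0 \<and> \<bar>coord (z \<tau>) - m * s\<bar> \<le> \<epsilon> * \<bar>s\<bar>)"
    using return_estimate[OF m] by blast
  have inter: "range x \<inter> section_segment p v \<epsilon> = {p}"
  proof -
    have "x t = p" if seg: "x t \<in> section_segment p v \<epsilon>" for t
    proof -
      obtain r where r: "0 \<le> r" "r < 0 + T" "x r = x t"
        using periodic_representative[where x = x, OF periodic T_pos, of 0 t] by blast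
      \<comment> \<open>The orbit itself is the case \<open>s = 0\<close>, \<open>\<tau> = T\<close>
        of \<open>avoid\<close>.\<close>
      have "r \<notin> {0<..<T}"
        using avoid[of x 0 T r] sol \<rho> T_pos window_pos seg r(3) phase_section[of 0] by auto
      then show ?thesis using r by auto
    qed
    moreover have "p \<in> section_segment p v \<epsilon>"
      using mem_section_segment_iff[of \<epsilon> p p v] \<epsilon> by (intro iffD2[OF mem_section_segment_iff] exI[of _ 0]) auto
    moreover have "p \<in> range x" using base by (metis rangeI)
    ultimately show ?thesis by auto
  qed
  have "\<exists>z. \<forall>s. solution f (z s) \<and> z s 0 = p + s *\<^sub>R v"
    using solution_exists by (intro choice) auto
  then obtain z where z: "\<And>s. solution f (z s)" "\<And>s. z s 0 = p + s *\<^sub>R v" by blast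
  \<comment> \<open>The bound \<open>T / 2\<close> keeps the hitting time positive, and the bound
    \<open>window\<close> makes the hit unique for small \<open>s\<close>, so that the choice in
    \<open>P\<close> is immaterial there.\<close>
  define hit where "hit s r \<longleftrightarrow> (\<exists>\<tau>. \<bar>\<tau> - T\<bar> \<le> min window (T / 2) \<and> phase (z s \<tau>) = 0 \<and> coord (z s \<tau>) = r)" for s r
  define P where "P s = (SOME r. hit s r)" for s
  define B where "B = exp (L * (2 * T)) * norm v + 1"
  have B: "B \<ge> 1" by (simp add: B_def)
  have hit_unique: "r = r'" if h1: "hit s r" and h2: "hit s r'" and "\<bar>s\<bar> < window / B" for s r r'
  proof -
    obtain \<tau> \<tau>' where \<tau>: "\<bar>\<tau> - T\<bar> \<le> window" "phase (z s \<tau>) = 0" "coord (z s \<tau>) = r"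
      using h1 unfolding hit_def min.bounded_iff by blast
    obtain \<tau>' where \<tau>': "\<bar>\<tau>' - T\<bar> \<le> window" "phase (z s \<tau>') = 0" "coord (z s \<tau>') = r'"
      using h2 unfolding hit_def min.bounded_iff by blast
    have "norm (z s T - x T) \<le> exp (L * (2 * T)) * norm (z s 0 - p)"
      using T_pos by (intro dist_orbit_le z) auto
    also have "\<dots> \<le> \<bar>s\<bar> * B"
      using z(2) by (simp add: B_def algebra_simps)
    also have "\<dots> \<le> window"
      using \<open>\<bar>s\<bar> < window / B\<close> B by (simp add: field_simps)
    finally have near: "norm (z s T - p) \<le> window" by simp
    have "\<tau> = \<tau>'"
      using phase_growth[OF z(1) near, of \<tau> \<tau>'] phase_growth[OF z(1) near, of \<tau>' \<tau>] \<tau> \<tau>'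
      by (cases "\<tau> \<le> \<tau>'") auto
    then show ?thesis using \<tau> \<tau>' by simp
  qed
  have P: "\<exists>\<rho>>0. \<forall>s. \<bar>s\<bar> < \<rho> \<longrightarrow> hit s (P s) \<and> \<bar>P s - m * s\<bar> \<le> e * \<bar>s\<bar>" if "e > 0" for e
  proof -
    obtain \<rho>1 where \<rho>1: "\<rho>1 > 0" and r1: "\<And>z s. solution f z \<Longrightarrow> z 0 = p + s *\<^sub>R v \<Longrightarrow> \<bar>s\<bar> < \<rho>1 \<Longrightarrow>
       (\<exists>\<tau>. \<bar>\<tau> - T\<bar> \<le> C * \<bar>s\<bar> \<and> phase (z \<tau>) = 0 \<and> \<bar>coord (z \<tau>) - m * s\<bar> \<le> e * \<bar>s\<bar>)"
      using ret[OF \<open>e > 0\<close>] by blast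
    define \<rho>2 where "\<rho>2 = Min {\<rho>1, min window (T / 2) / C, window / B}"
    have \<rho>2: "\<rho>2 > 0" "\<rho>2 \<le> \<rho>1" "\<rho>2 \<le> min window (T / 2) / C" "\<rho>2 \<le> window / B"
      using \<rho>1 window_pos T_pos C B by (auto simp: \<rho>2_def)
    have "hit s (P s) \<and> \<bar>P s - m * s\<bar> \<le> e * \<bar>s\<bar>" if s: "\<bar>s\<bar> < \<rho>2" for s
    proof -
      obtain \<tau> where \<tau>: "\<bar>\<tau> - T\<bar> \<le> C * \<bar>s\<bar>" "phase (z s \<tau>) = 0" "\<bar>coord (z s \<tau>) - m * s\<bar> \<le> e * \<bar>s\<bar>"
        using r1[OF z(1,2), of s] s \<rho>2 by auto
      have "\<bar>s\<bar> < min window (T / 2) / C" using s \<rho>2(3) by linarith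
      then have "C * \<bar>s\<bar> \<le> min window (T / 2)"
        using C by (simp only: pos_less_divide_eq) (simp add: mult.commute)
      then have h: "hit s (coord (z s \<tau>))" using \<tau> unfolding hit_def by force
      then have "hit s (P s)" unfolding P_def by (rule someI)
      moreover have "P s = coord (z s \<tau>)"
        by (rule hit_unique[OF \<open>hit s (P s)\<close> h]) (use s \<rho>2 in auto)
      ultimately show ?thesis using \<tau> by simp
    qed
    with \<rho>2(1) show ?thesis by blast
  qed
  have P0: "P 0 = 0"
  proof -
    obtain \<rho> where "\<rho> > 0" "\<forall>s. \<bar>s\<bar> < \<rho> \<longrightarrow> hit s (P s) \<and> \<bar>P s - m * s\<bar> \<le> 1 * \<bar>s\<bar>"
      using P[of 1] by auto
    from this(2)[rule_format, of 0] this(1) show ?thesis by simp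
  qed
  have "(P has_real_derivative m) (at 0)"
    unfolding DERIV_def LIM_eq
  proof (intro allI impI)
    fix e :: real assume "e > 0"
    then obtain \<rho>1 where \<rho>1: "\<rho>1 > 0" "\<And>s. \<bar>s\<bar> < \<rho>1 \<Longrightarrow> \<bar>P s - m * s\<bar> \<le> (e / 2) * \<bar>s\<bar>"
      using P[of "e / 2"] by auto
    show "\<exists>s>0. \<forall>h. h \<noteq> 0 \<and> norm (h - 0) < s \<longrightarrow> norm ((P (0 + h) - P 0) / h - m) < e"
    proof (intro exI[of _ \<rho>1] conjI allI impI \<rho>1)
      fix h :: real assume h: "h \<noteq> 0 \<and> norm (h - 0) < \<rho>1"
      have "norm ((P (0 + h) - P 0) / h - m) = \<bar>P h - m * h\<bar> / \<bar>h\<bar>"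
        using h by (simp add: P0 field_simps flip: abs_divide)
      also have "\<dots> \<le> e / 2"
        using \<rho>1(2)[of h] h by (simp add: field_simps)
      finally show "norm ((P (0 + h) - P 0) / h - m) < e" using \<open>e > 0\<close> by simp
    qed
  qed
  moreover have "\<forall>\<^sub>F s in nhds 0. first_return f p v \<epsilon> s (P s)"
  proof -
    obtain \<rho>1 where \<rho>1: "\<rho>1 > 0" "\<And>s. \<bar>s\<bar> < \<rho>1 \<Longrightarrow> hit s (P s)" "\<And>s. \<bar>s\<bar> < \<rho>1 \<Longrightarrow> \<bar>P s - m * s\<bar> \<le> 1 * \<bar>s\<bar>"
      using P[of 1] by auto
    define \<rho>2 where "\<rho>2 = Min {\<rho>1, \<rho>, \<epsilon> / (1 + \<bar>m\<bar>)}"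
    have \<rho>2: "\<rho>2 > 0" "\<rho>2 \<le> \<rho>1" "\<rho>2 \<le> \<rho>" "\<rho>2 \<le> \<epsilon> / (1 + \<bar>m\<bar>)"
      using \<rho>1 \<rho> \<epsilon> by (auto simp: \<rho>2_def)
    have "first_return f p v \<epsilon> s (P s)" if s: "\<bar>s\<bar> < \<rho>2" for s
    proof -
      have s1: "\<bar>s\<bar> < \<rho>1" "\<bar>s\<bar> < \<rho>" using s \<rho>2 by auto
      obtain \<tau> where \<tau>: "\<bar>\<tau> - T\<bar> \<le> window" "\<bar>\<tau> - T\<bar> \<le> T / 2" "phase (z s \<tau>) = 0" "coord (z s \<tau>) = P s"
        using \<rho>1(2)[OF s1(1)] by (auto simp: hit_def)
      have pos: "\<tau> > 0" using \<tau>(2) T_pos by linarith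
      have "\<bar>P s\<bar> \<le> \<bar>m * s\<bar> + 1 * \<bar>s\<bar>" using \<rho>1(3)[OF s1(1)] by linarith
      also have "\<dots> = \<bar>s\<bar> * (1 + \<bar>m\<bar>)" by (simp add: abs_mult algebra_simps)
      also have "\<dots> \<le> \<epsilon>"
      proof -
        have "\<bar>s\<bar> < \<epsilon> / (1 + \<bar>m\<bar>)" using s \<rho>2(4) by linarith
        then show ?thesis by (simp add: pos_less_divide_eq)
      qed
      finally have "\<bar>P s\<bar> \<le> \<epsilon>" .
      moreover have "z s \<tau> = p + P s *\<^sub>R v"
        using on_section[OF \<tau>(3)] \<tau>(4) by simp
      ultimately show ?thesis
        unfolding first_return_def
        using z pos avoid[OF z(1,2) s1(2) \<tau>(1) pos \<tau>(3)] by (intro conjI exI[of _ "z s"] exI[of _ \<tau>]) auto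
    qed
    then show ?thesis
      unfolding eventually_nhds_metric using \<rho>2(1) by (intro exI[of _ \<rho>2]) (auto simp: dist_real_def)
  qed
  ultimately show ?thesis using \<epsilon> inter by blast
qed

section \<open>Attraction by iterating the return map\<close>

lemma infdist_orbit_le: "infdist z (range x) \<le> norm (z - x t)"
  by (metis dist_norm infdist_le rangeI)

text \<open>The number \<open>q\<close> lies midway between \<open>\<bar>m\<bar>\<close> and 1; the
  gap absorbs the error of the linear estimate, so each return shrinks the parameter at least by the
  factor \<open>q\<close>. Between returns the distance from the orbit is controlled by the
  parameter through Gronwall.\<close>

lemma attracting_orbit:
  assumes m: "linear_return f p T m" and "\<bar>m\<bar> < 1"
  shows "attracting f (range x)"
proof -
  define q where "q = (1 + \<bar>m\<bar>) / 2"
  have q: "0 < q" "q < 1" "q - \<bar>m\<bar> > 0" using assms(2) by (auto simp: q_def)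
  obtain C where C: "C > 0" and ret:
    "\<And>\<epsilon>. \<epsilon> > 0 \<Longrightarrow> \<exists>\<rho>>0. \<forall>z s. solution f z \<and> z 0 = p + s *\<^sub>R v \<and> \<bar>s\<bar> < \<rho> \<longrightarrow>
       (\<exists>\<tau>. \<bar>\<tau> - T\<bar> \<le> C * \<bar>s\<bar> \<and> phase (z \<tau>) = 0 \<and> \<bar>coord (z \<tau>) - m * s\<bar> \<le> \<epsilon> * \<bar>s\<bar>)"
    using return_estimate[OF m] by blast
  obtain \<rho>1 where \<rho>1: "\<rho>1 > 0" "\<And>z s. solution f z \<Longrightarrow> z 0 = p + s *\<^sub>R v \<Longrightarrow> \<bar>s\<bar> < \<rho>1 \<Longrightarrow>
       (\<exists>\<tau>. \<bar>\<tau> - T\<bar> \<le> C * \<bar>s\<bar> \<and> phase (z \<tau>) = 0 \<and> \<bar>coord (z \<tau>) - m * s\<bar> \<le> (q - \<bar>m\<bar>) * \<bar>s\<bar>)"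
    using ret[OF q(3)] by blast
  define \<rho> where "\<rho> = min \<rho>1 (T / 2 / C)"
  have \<rho>: "\<rho> > 0" "\<rho> \<le> \<rho>1" "\<rho> \<le> T / 2 / C" using \<rho>1 T_pos C by (auto simp: \<rho>_def)
  define K where "K = exp (L * (2 * T)) * norm v"
  have K: "K \<ge> 0" by (simp add: K_def)
  have step: "\<exists>t' s'. t + T / 2 \<le> t' \<and> z t' = p + s' *\<^sub>R v \<and> \<bar>s'\<bar> \<le> q * \<bar>s\<bar> \<and>
      (\<forall>r\<in>{t..t'}. infdist (z r) (range x) \<le> K * \<bar>s\<bar>)"
    if z: "solution f z" and zt: "z t = p + s *\<^sub>R v" and s: "\<bar>s\<bar> < \<rho>" for z t s
  proof -
    let ?y = "\<lambda>r. z (r + t)"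
    have y: "solution f ?y" "?y 0 = p + s *\<^sub>R v" using solution_shift[OF z] zt by auto
    obtain \<tau> where \<tau>: "\<bar>\<tau> - T\<bar> \<le> C * \<bar>s\<bar>" "phase (?y \<tau>) = 0" "\<bar>coord (?y \<tau>) - m * s\<bar> \<le> (q - \<bar>m\<bar>) * \<bar>s\<bar>"
      using \<rho>1(2)[OF y] s \<rho> by auto
    have "C * \<bar>s\<bar> \<le> T / 2"
    proof -
      have "\<bar>s\<bar> \<le> T / 2 / C" using s \<rho>(3) by linarith
      then show ?thesis using C by (simp only: pos_le_divide_eq) (simp add: mult.commute)
    qed
    then have \<tau>T: "T / 2 \<le> \<tau>" "\<tau> \<le> 2 * T" using \<tau>(1) by linarith+
    have "\<bar>coord (?y \<tau>)\<bar> \<le> \<bar>m * s\<bar> + (q - \<bar>m\<bar>) * \<bar>s\<bar>" using \<tau>(3) by linarith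
    also have "\<dots> = q * \<bar>s\<bar>" by (simp add: abs_mult algebra_simps)
    finally have "\<bar>coord (?y \<tau>)\<bar> \<le> q * \<bar>s\<bar>" .
    moreover have "infdist (z r) (range x) \<le> K * \<bar>s\<bar>" if "r \<in> {t..\<tau> + t}" for r
    proof -
      have "infdist (z r) (range x) \<le> norm (?y (r - t) - x (r - t))"
        using infdist_orbit_le[of "z r" "r - t"] by simp
      also have "\<dots> \<le> exp (L * (2 * T)) * norm (?y 0 - p)"
        using that \<tau>T by (intro dist_orbit_le y) auto
      also have "\<dots> = K * \<bar>s\<bar>" using y(2) by (simp add: K_def)
      finally show ?thesis .
    qed
    ultimately show ?thesis
      using on_section[OF \<tau>(2)] \<tau>T
      by (intro exI[of _ "\<tau> + t"] exI[of _ "coord (?y \<tau>)"]) auto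
  qed
  \<comment> \<open>Every return takes at least \<open>T / 2\<close>, so \<open>n\<close> returns
    cover the time \<open>n * (T / 2)\<close>.\<close>
  have stay: "infdist (z r) (range x) \<le> K * \<bar>s\<bar>"
    if z: "solution f z" and "z t = p + s *\<^sub>R v" "\<bar>s\<bar> < \<rho>" "t \<le> r" "r \<le> t + real n * (T / 2)" for z t s r n
    using that(2-)
  proof (induction n arbitrary: t s)
    case 0
    then have "r = t" by simp
    then show ?case using step[OF z 0(1,2)] T_pos by force
  next
    case (Suc n)
    obtain t' s' where t': "t + T / 2 \<le> t'" "z t' = p + s' *\<^sub>R v" "\<bar>s'\<bar> \<le> q * \<bar>s\<bar>"
      "\<And>r. r \<in> {t..t'} \<Longrightarrow> infdist (z r) (range x) \<le> K * \<bar>s\<bar>"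
      using step[OF z Suc.prems(1,2)] by blast
    have s': "\<bar>s'\<bar> \<le> \<bar>s\<bar>" using t'(3) q mult_right_mono[of q 1 "\<bar>s\<bar>"] by simp
    show ?case
    proof (cases "r \<le> t'")
      case True
      then show ?thesis using t'(4) Suc.prems by auto
    next
      case False
      have "infdist (z r) (range x) \<le> K * \<bar>s'\<bar>"
        by (rule Suc.IH[OF t'(2)]) (use s' Suc.prems False t' in \<open>auto simp: algebra_simps add_divide_distrib\<close>)
      also have "\<dots> \<le> K * \<bar>s\<bar>" using s' K by (rule mult_left_mono)
      finally show ?thesis .
    qed
  qed
  have stay': "infdist (z r) (range x) \<le> K * \<bar>s\<bar>"
    if z: "solution f z" and "z t = p + s *\<^sub>R v" "\<bar>s\<bar> < \<rho>" "t \<le> r" for z t s r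
  proof -
    obtain n where "(r - t) / (T / 2) \<le> real n" using real_arch_simple by blast
    then have "r \<le> t + real n * (T / 2)" using T_pos by (simp add: field_simps)
    then show ?thesis using stay that by blast
  qed
  have iter: "\<exists>t' s'. z t' = p + s' *\<^sub>R v \<and> \<bar>s'\<bar> \<le> q ^ n * \<bar>s\<bar>"
    if z: "solution f z" and "z t = p + s *\<^sub>R v" "\<bar>s\<bar> < \<rho>" for z t s n
  proof (induction n)
    case 0
    then show ?case using that by (intro exI[of _ t] exI[of _ s]) auto
  next
    case (Suc n)
    then obtain t' s' where t': "z t' = p + s' *\<^sub>R v" "\<bar>s'\<bar> \<le> q ^ n * \<bar>s\<bar>" by blast
    have "q ^ n * \<bar>s\<bar> \<le> 1 * \<bar>s\<bar>" using q by (intro mult_right_mono power_le_one) auto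
    then have "\<bar>s'\<bar> < \<rho>" using t' that by simp
    from step[OF z t'(1) this] obtain t'' s'' where "z t'' = p + s'' *\<^sub>R v" "\<bar>s''\<bar> \<le> q * \<bar>s'\<bar>" by blast
    moreover have "q * \<bar>s'\<bar> \<le> q * (q ^ n * \<bar>s\<bar>)" using t' q by (intro mult_left_mono) auto
    ultimately show ?case by (intro exI[of _ t''] exI[of _ s'']) auto
  qed
  have conv: "((\<lambda>t. infdist (z t) (range x)) \<longlongrightarrow> 0) at_top"
    if z: "solution f z" and zt: "z t = p + s *\<^sub>R v" "\<bar>s\<bar> < \<rho>" for z t s
  proof (rule tendstoI)
    fix e :: real assume "e > 0"
    have "(\<lambda>n. K * (q ^ n * \<bar>s\<bar>)) \<longlonglongrightarrow> K * (0 * \<bar>s\<bar>)"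
      using q by (intro tendsto_intros LIMSEQ_power_zero) auto
    then have "\<forall>\<^sub>F n in sequentially. K * (q ^ n * \<bar>s\<bar>) < e"
      using \<open>e > 0\<close> order_tendstoD(2) by fastforce
    then obtain n where n: "K * (q ^ n * \<bar>s\<bar>) < e"
      by (auto simp: eventually_sequentially)
    obtain t' s' where t': "z t' = p + s' *\<^sub>R v" "\<bar>s'\<bar> \<le> q ^ n * \<bar>s\<bar>" using iter[OF z zt] by blast
    have "q ^ n * \<bar>s\<bar> \<le> 1 * \<bar>s\<bar>" using q by (intro mult_right_mono power_le_one) auto
    then have s': "\<bar>s'\<bar> < \<rho>" using t' zt by simp
    have "infdist (z r) (range x) < e" if "r \<ge> t'" for r
      using stay'[OF z t'(1) s' that] mult_left_mono[OF t'(2) K] n by linarith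
    then show "\<forall>\<^sub>F t in at_top. dist (infdist (z t) (range x)) 0 < e"
      unfolding eventually_at_top_linorder by (auto simp: infdist_nonneg)
  qed
  obtain C' \<eta> where C': "C' > 0" and \<eta>: "\<eta> > 0" and hits:
    "\<And>z t0. solution f z \<Longrightarrow> norm (z t0 - p) < \<eta> \<Longrightarrow>
       \<exists>t. \<bar>t - t0\<bar> \<le> C' * norm (z t0 - p) \<and> phase (z t) = 0 \<and>
           \<bar>coord (z t) - coord (z t0)\<bar> \<le> C' * (norm (z t0 - p))\<^sup>2"
    using hits_section by blast
  define \<gamma> where "\<gamma> = Min {\<eta>, 1, \<rho> / (cbound + C')}"
  have \<gamma>: "\<gamma> > 0" "\<gamma> \<le> \<eta>" "\<gamma> \<le> 1" "\<gamma> \<le> \<rho> / (cbound + C')"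
    using \<eta> \<rho> C' cbound_ge_1 by (auto simp: \<gamma>_def)
  \<comment> \<open>Dividing by \<open>exp (L * T)\<close> pays for the growth of the distance until
    the reference orbit next passes \<open>p\<close>.\<close>
  define \<beta> where "\<beta> = \<gamma> / exp (L * T)"
  define U where "U = (\<Union>t. ball (x t) \<beta>)"
  have "((\<lambda>t. infdist (z t) (range x)) \<longlongrightarrow> 0) at_top" if z: "solution f z" and zU: "z 0 \<in> U" for z
  proof -
    obtain t0 where t0: "norm (z 0 - x t0) < \<beta>"
      using zU by (auto simp: U_def dist_norm norm_minus_commute)
    obtain r where r: "0 \<le> r" "r < 0 + T" "x r = x t0"
      using periodic_representative[where x = x, OF periodic T_pos, of 0 t0] by blast
    have "norm (z (T - r) - x (T - r + r)) \<le> exp (L * \<bar>T - r - 0\<bar>) * norm (z 0 - x (0 + r))"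
      by (rule solution_dist_le[OF z solution_shift[OF sol]])
    also have "\<dots> \<le> exp (L * T) * norm (z 0 - x r)"
      using r L_nonneg by (intro mult_mono) (auto intro: mult_left_mono)
    also have "\<dots> < exp (L * T) * \<beta>" using t0 r by simp
    finally have d: "norm (z (T - r) - p) < \<gamma>" by (simp add: \<beta>_def)
    then obtain t where t: "phase (z t) = 0" "\<bar>coord (z t) - coord (z (T - r))\<bar> \<le> C' * (norm (z (T - r) - p))\<^sup>2"
      using hits[OF z, of "T - r"] \<gamma> by auto
    let ?d = "norm (z (T - r) - p)"
    have "?d\<^sup>2 \<le> ?d * 1" unfolding power2_eq_square using d \<gamma> by (intro mult_left_mono) auto
    then have "C' * ?d\<^sup>2 \<le> C' * ?d" using C' by simp
    then have "\<bar>coord (z t)\<bar> \<le> (cbound + C') * ?d"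
      using t(2) abs_coord_le[of "z (T - r)"] by (simp add: algebra_simps)
    also have "\<dots> < (cbound + C') * \<gamma>" using d C' cbound_ge_1 by simp
    also have "\<dots> \<le> \<rho>" using \<gamma>(4) C' cbound_ge_1 by (simp add: field_simps)
    finally show ?thesis using conv[OF z on_section[OF t(1)]] by simp
  qed
  moreover have "open U" unfolding U_def by auto
  moreover have "range x \<subseteq> U" using \<gamma> by (auto simp: U_def \<beta>_def intro!: exI)
  ultimately show ?thesis unfolding attracting_def by blast
qed

end

section \<open>Transport of the transversal displacement through the zones\<close>

text \<open>The infinitesimal form of \<open>det (exp (t A)) = exp (t * trace A)\<close>, which is
  Liouville's formula in the plane.\<close>

lemma cross2_trace:
  fixes A :: "real^2^2"
  shows "cross2 (A *v u) v + cross2 u (A *v v) = trace A * cross2 u v"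
  by (simp add: cross2_def matrix_vector_mult_def sum_2 trace_def algebra_simps)

text \<open>The analogue of \<open>linear_return\<close> between two different points of the orbit,
  so that arcs in different zones can be composed.\<close>

definition transport :: "(real^2 \<Rightarrow> real^2) \<Rightarrow> (real \<Rightarrow> real^2) \<Rightarrow> real \<Rightarrow> real \<Rightarrow> real \<Rightarrow> bool" where
  "transport f x a b m \<longleftrightarrow> (\<forall>\<epsilon>>0. \<exists>\<rho>>0. \<forall>z. solution f z \<and> norm (z a - x a) < \<rho> \<longrightarrow>
     \<bar>cross2 (f (x b)) (z b - x b) - m * cross2 (f (x a)) (z a - x a)\<bar> \<le> \<epsilon> * norm (z a - x a))"

lemma transport_shift:
  assumes "transport f x a b m" "x (a + c) = x a" "x (b + c) = x b"
  shows "transport f x (a + c) (b + c) m"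
  unfolding transport_def
proof (intro allI impI)
  fix \<epsilon> :: real assume "\<epsilon> > 0"
  then obtain \<rho> where "\<rho> > 0" and \<rho>: "\<And>z. solution f z \<Longrightarrow> norm (z a - x a) < \<rho> \<Longrightarrow>
     \<bar>cross2 (f (x b)) (z b - x b) - m * cross2 (f (x a)) (z a - x a)\<bar> \<le> \<epsilon> * norm (z a - x a)"
    using assms(1) unfolding transport_def by blast
  then show "\<exists>\<rho>>0. \<forall>z. solution f z \<and> norm (z (a + c) - x (a + c)) < \<rho> \<longrightarrow>
     \<bar>cross2 (f (x (b + c))) (z (b + c) - x (b + c)) - m * cross2 (f (x (a + c))) (z (a + c) - x (a + c))\<bar>
       \<le> \<epsilon> * norm (z (a + c) - x (a + c))"
    using \<rho>[OF solution_shift[of f _ c]] assms(2,3) by (intro exI[of _ \<rho>]) auto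
qed

lemma linear_return_if_transport:
  assumes "transport f x c (c + T) m" "x (c + T) = x c"
  shows "linear_return f (x c) T m"
  unfolding linear_return_def
proof (intro allI impI)
  fix \<epsilon> :: real assume "\<epsilon> > 0"
  then obtain \<rho> where "\<rho> > 0" and \<rho>: "\<And>z. solution f z \<Longrightarrow> norm (z c - x c) < \<rho> \<Longrightarrow>
     \<bar>cross2 (f (x (c + T))) (z (c + T) - x (c + T)) - m * cross2 (f (x c)) (z c - x c)\<bar> \<le> \<epsilon> * norm (z c - x c)"
    using assms(1) unfolding transport_def by blast
  then show "\<exists>\<rho>>0. \<forall>z. solution f z \<and> norm (z 0 - x c) < \<rho> \<longrightarrow>
     \<bar>cross2 (f (x c)) (z T - x c) - m * cross2 (f (x c)) (z 0 - x c)\<bar> \<le> \<epsilon> * norm (z 0 - x c)"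
    using \<rho>[OF solution_shift[of f _ "- c"]] assms(2) by (intro exI[of _ \<rho>]) auto
qed

locale planar_lipschitz = lipschitz_field f L for f :: "real^2 \<Rightarrow> real^2" and L
begin

lemma transport_compose:
  assumes x: "solution f x" and 1: "transport f x a b m" and 2: "transport f x b c n"
  shows "transport f x a c (n * m)"
  unfolding transport_def
proof (intro allI impI)
  fix \<epsilon> :: real assume \<epsilon>: "\<epsilon> > 0"
  define E where "E = exp (L * \<bar>b - a\<bar>)"
  have E: "E > 0" by (simp add: E_def)
  \<comment> \<open>The second stage multiplies the error of the first by
    \<open>\<bar>n\<bar>\<close>, and the displacement it starts from has grown by at most
    \<open>E\<close>; each stage may use half of \<open>\<epsilon>\<close>.\<close>
  define \<epsilon>1 where "\<epsilon>1 = \<epsilon> / (2 * (\<bar>n\<bar> + 1))"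
  define \<epsilon>2 where "\<epsilon>2 = \<epsilon> / (2 * E)"
  have pos: "\<epsilon>1 > 0" "\<epsilon>2 > 0" using \<epsilon> E by (auto simp: \<epsilon>1_def \<epsilon>2_def)
  obtain \<rho>1 where \<rho>1: "\<rho>1 > 0" "\<And>z. solution f z \<Longrightarrow> norm (z a - x a) < \<rho>1 \<Longrightarrow>
     \<bar>cross2 (f (x b)) (z b - x b) - m * cross2 (f (x a)) (z a - x a)\<bar> \<le> \<epsilon>1 * norm (z a - x a)"
    using 1 pos unfolding transport_def by blast
  obtain \<rho>2 where \<rho>2: "\<rho>2 > 0" "\<And>z. solution f z \<Longrightarrow> norm (z b - x b) < \<rho>2 \<Longrightarrow>
     \<bar>cross2 (f (x c)) (z c - x c) - n * cross2 (f (x b)) (z b - x b)\<bar> \<le> \<epsilon>2 * norm (z b - x b)"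
    using 2 pos unfolding transport_def by blast
  show "\<exists>\<rho>>0. \<forall>z. solution f z \<and> norm (z a - x a) < \<rho> \<longrightarrow>
     \<bar>cross2 (f (x c)) (z c - x c) - n * m * cross2 (f (x a)) (z a - x a)\<bar> \<le> \<epsilon> * norm (z a - x a)"
  proof (rule exI[of _ "min \<rho>1 (\<rho>2 / E)"], intro conjI allI impI)
    show "0 < min \<rho>1 (\<rho>2 / E)" using \<rho>1 \<rho>2 E by auto
    fix z assume *: "solution f z \<and> norm (z a - x a) < min \<rho>1 (\<rho>2 / E)"
    then have z: "solution f z" by auto
    have d: "norm (z b - x b) \<le> E * norm (z a - x a)"
      unfolding E_def by (rule solution_dist_le[OF z x])
    have "norm (z a - x a) < \<rho>2 / E" using * by simp
    then have "E * norm (z a - x a) < \<rho>2" using E by (simp add: pos_less_divide_eq mult.commute)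
    with d have "norm (z b - x b) < \<rho>2" by linarith
    note two = \<rho>2(2)[OF z this]
    have one: "\<bar>cross2 (f (x b)) (z b - x b) - m * cross2 (f (x a)) (z a - x a)\<bar> \<le> \<epsilon>1 * norm (z a - x a)"
      using \<rho>1(2)[OF z] * by auto
    have "\<bar>n * cross2 (f (x b)) (z b - x b) - n * m * cross2 (f (x a)) (z a - x a)\<bar>
        = \<bar>n\<bar> * \<bar>cross2 (f (x b)) (z b - x b) - m * cross2 (f (x a)) (z a - x a)\<bar>"
      unfolding abs_mult[symmetric] by (simp add: algebra_simps)
    also have "\<dots> \<le> (\<bar>n\<bar> + 1) * (\<epsilon>1 * norm (z a - x a))"
      using one by (intro mult_mono) auto
    also have "\<dots> = \<epsilon> / 2 * norm (z a - x a)"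
      unfolding \<epsilon>1_def by (simp add: field_simps)
    finally have A: "\<bar>n * cross2 (f (x b)) (z b - x b) - n * m * cross2 (f (x a)) (z a - x a)\<bar> \<le> \<epsilon> / 2 * norm (z a - x a)" .
    have "\<epsilon>2 * norm (z b - x b) \<le> \<epsilon>2 * (E * norm (z a - x a))"
      using d pos by (intro mult_left_mono) auto
    also have "\<dots> = \<epsilon> / 2 * norm (z a - x a)"
      using E by (simp add: \<epsilon>2_def)
    finally show "\<bar>cross2 (f (x c)) (z c - x c) - n * m * cross2 (f (x a)) (z a - x a)\<bar> \<le> \<epsilon> * norm (z a - x a)"
      using two A by linarith
  qed
qed

lemma transport_refl: "transport f x a a 1"
  unfolding transport_def by (auto intro!: exI[of _ 1])

text \<open>As long as both solutions are in the zone \<open>Z\<close>, the displacement satisfies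
  \<open>w' = trace A * w\<close> exactly. They are in different zones only near the end points,
  which contributes an arbitrarily small multiple of the displacement.\<close>

lemma transport_zone:
  fixes A :: "real^2^2"
  assumes x: "solution f x" and Z: "\<And>w. w \<in> Z \<Longrightarrow> f w = A *v w + b"
    and "a \<le> c" and xZ: "\<And>t. a \<le> t \<Longrightarrow> t \<le> c \<Longrightarrow> x t \<in> Z"
    and xint: "\<And>t. a < t \<Longrightarrow> t < c \<Longrightarrow> x t \<in> interior Z"
  shows "transport f x a c (exp (trace A * (c - a)))"
proof (cases "a = c")
  case True
  then show ?thesis using transport_refl by simp
next
  case False
  with \<open>a \<le> c\<close> have ac: "a < c" by simp
  define k where "k = trace A"
  obtain KA where KA: "KA > 0" "\<And>u. norm (A *v u) \<le> norm u * KA"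
    using bounded_linear.pos_bounded[OF matrix_vector_mul_bounded_linear[of A]] by blast
  define E where "E = exp (L * (c - a))"
  have E: "E > 0" by (simp add: E_def)
  have contf: "continuous_on {a..c} (\<lambda>t. f (x t))"
    by (intro continuous_on_compose2[OF continuous_field] solution_continuous[OF x]) auto
  then have "bounded ((\<lambda>t. f (x t)) ` {a..c})"
    by (intro compact_imp_bounded compact_continuous_image) auto
  then obtain M0 where "\<forall>w\<in>(\<lambda>t. f (x t)) ` {a..c}. norm w \<le> M0"
    unfolding bounded_iff by blast
  then have M0: "norm (f (x t)) \<le> M0" if "a \<le> t" "t \<le> c" for t
    using that by simp
  define M where "M = \<bar>M0\<bar> + 1"
  have M: "M > 0" "norm (f (x t)) \<le> M" if "a \<le> t" "t \<le> c" for t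
    using M0[OF that] by (auto simp: M_def)
  have M: "M > 0" "\<And>t. a \<le> t \<Longrightarrow> t \<le> c \<Longrightarrow> norm (f (x t)) \<le> M"
    using M(1)[of a] M(2) ac by auto
  define Q where "Q = exp (\<bar>k\<bar> * (\<bar>a\<bar> + \<bar>c\<bar>))"
  have Q: "exp (- k * t) \<le> Q" if "a \<le> t" "t \<le> c" for t
  proof -
    have "- k * t \<le> \<bar>k\<bar> * \<bar>t\<bar>" using abs_mult[of k t] by linarith
    also have "\<dots> \<le> \<bar>k\<bar> * (\<bar>a\<bar> + \<bar>c\<bar>)" using that by (intro mult_left_mono) auto
    finally show ?thesis by (simp add: Q_def)
  qed
  have Qpos: "Q > 0" by (simp add: Q_def)
  define B where "B = Q * ((2 * M * KA + 2 * M * L + \<bar>k\<bar> * (2 * M)) * E) + 1"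
  have B: "B > 0" unfolding B_def using Qpos M KA L_nonneg E
    by (intro add_nonneg_pos mult_nonneg_nonneg add_nonneg_nonneg) auto
  show ?thesis
    unfolding transport_def k_def[symmetric]
  proof (intro allI impI)
    fix \<epsilon> :: real assume \<epsilon>: "\<epsilon> > 0"
    \<comment> \<open>\<open>\<eta>\<close> is the length of the two end pieces. The first bound
      leaves a middle piece, the second keeps the error \<open>2 * B * D * \<eta>\<close> of both
      ends, after multiplication by \<open>exp (k * c)\<close>, below
      \<open>\<epsilon> * D\<close>.\<close>
    define \<eta> where "\<eta> = min ((c - a) / 3) (\<epsilon> / (2 * B * exp (k * c)))"
    have \<eta>: "\<eta> > 0" "\<eta> \<le> (c - a) / 3" "\<eta> \<le> \<epsilon> / (2 * B * exp (k * c))"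
      unfolding \<eta>_def using \<epsilon> B ac by (simp, blast intro: min.cobounded1, blast intro: min.cobounded2)
    have "compact (x ` {a + \<eta>..c - \<eta>})"
      by (intro compact_continuous_image solution_continuous[OF x]) auto
    moreover have "x ` {a + \<eta>..c - \<eta>} \<subseteq> interior Z"
      using xint \<eta> by auto
    \<comment> \<open>The middle piece has a positive distance from the boundary of the zone, so a
      nearby solution is in the zone during that time as well.\<close>
    ultimately obtain d where d: "d > 0" "(\<Union>w\<in>x ` {a + \<eta>..c - \<eta>}. ball w d) \<subseteq> interior Z"
      using compact_subset_open_imp_ball_epsilon_subset[OF _ open_interior] by blast
    show "\<exists>\<rho>>0. \<forall>z. solution f z \<and> norm (z a - x a) < \<rho> \<longrightarrow>
       \<bar>cross2 (f (x c)) (z c - x c) - exp (k * (c - a)) * cross2 (f (x a)) (z a - x a)\<bar> \<le> \<epsilon> * norm (z a - x a)"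
    proof (rule exI[of _ "d / E"], intro conjI allI impI)
      show "0 < d / E" using d E by simp
      fix z assume *: "solution f z \<and> norm (z a - x a) < d / E"
      then have z: "solution f z" by auto
      define D where "D = norm (z a - x a)"
      have D: "D \<ge> 0" "E * D < d"
        using * E by (auto simp: D_def field_simps)
      have dist: "norm (z t - x t) \<le> E * D" if "a \<le> t" "t \<le> c" for t
      proof -
        have "norm (z t - x t) \<le> exp (L * \<bar>t - a\<bar>) * D"
          unfolding D_def by (rule solution_dist_le[OF z x])
        also have "\<dots> \<le> E * D"
          unfolding E_def using that L_nonneg D by (intro mult_right_mono) (auto intro: mult_left_mono)
        finally show ?thesis .
      qed
      define W where "W t = cross2 (A *v x t + b) (z t - x t)" for t
      define W' where "W' t = cross2 (A *v x t + b) (f (z t) - f (x t)) + cross2 (A *v f (x t)) (z t - x t)" for t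
      define q where "q t = exp (- k * t) * W t" for t
      define q' where "q' t = exp (- k * t) * (W' t - k * W t)" for t
      have xd: "(x has_vector_derivative f (x t)) (at t)" for t using x by (simp add: solution_def)
      have zd: "(z has_vector_derivative f (z t)) (at t)" for t using z by (simp add: solution_def)
      have "((\<lambda>t. A *v x t + b) has_vector_derivative A *v f (x t) + 0) (at t)" for t
        by (intro has_vector_derivative_add has_vector_derivative_const
            bounded_linear.has_vector_derivative[OF matrix_vector_mul_bounded_linear xd])
      moreover have "((\<lambda>t. z t - x t) has_vector_derivative f (z t) - f (x t)) (at t)" for t
        by (intro has_vector_derivative_diff zd xd)
      ultimately have Wd: "(W has_real_derivative W' t) (at t)" for t
        unfolding W_def W'_def has_real_derivative_iff_has_vector_derivative
        using cross2.has_vector_derivative[of "\<lambda>t. A *v x t + b" _ t UNIV "\<lambda>t. z t - x t"] by simp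
      have qd: "(q has_real_derivative q' t) (at t)" for t
        unfolding q_def q'_def by (rule derivative_eq_intros Wd refl)+ (simp add: algebra_simps)
      have qB: "norm (q' t) \<le> B * D" if t: "a \<le> t" "t \<le> c" for t
      proof -
        have fx: "f (x t) = A *v x t + b" using Z[OF xZ[OF t]] .
        have Mt: "norm (A *v x t + b) \<le> M" "norm (f (x t)) \<le> M" using M(2)[OF t] fx by auto
        have dt: "norm (z t - x t) \<le> E * D" by (rule dist[OF t])
        have "\<bar>cross2 (A *v x t + b) (f (z t) - f (x t))\<bar> \<le> 2 * norm (A *v x t + b) * norm (f (z t) - f (x t))"
          by (rule abs_cross2_le)
        also have "\<dots> \<le> 2 * M * (L * (E * D))"
          using Mt norm_diff_le[of "z t" "x t"] mult_left_mono[OF dt L_nonneg] M by (intro mult_mono) auto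
        finally have 1: "\<bar>cross2 (A *v x t + b) (f (z t) - f (x t))\<bar> \<le> 2 * M * (L * (E * D))" .
        have "\<bar>cross2 (A *v f (x t)) (z t - x t)\<bar> \<le> 2 * norm (A *v f (x t)) * norm (z t - x t)"
          by (rule abs_cross2_le)
        also have "\<dots> \<le> 2 * (M * KA) * (E * D)"
        proof (intro mult_mono)
          show "norm (A *v f (x t)) \<le> M * KA"
            using KA(1) by (intro order_trans[OF KA(2)[of "f (x t)"]] mult_right_mono Mt) auto
        qed (use KA(1) dt M E D in auto)
        finally have 2: "\<bar>cross2 (A *v f (x t)) (z t - x t)\<bar> \<le> 2 * (M * KA) * (E * D)" .
        have "\<bar>W t\<bar> \<le> 2 * norm (A *v x t + b) * norm (z t - x t)"
          unfolding W_def by (rule abs_cross2_le)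
        also have "\<dots> \<le> 2 * M * (E * D)"
          using Mt dt M by (intro mult_mono) auto
        finally have "\<bar>k\<bar> * \<bar>W t\<bar> \<le> \<bar>k\<bar> * (2 * M * (E * D))" by (rule mult_left_mono) auto
        then have 3: "\<bar>k * W t\<bar> \<le> \<bar>k\<bar> * (2 * M * (E * D))" by (simp add: abs_mult)
        have "\<bar>W' t - k * W t\<bar> \<le> 2 * M * (L * (E * D)) + 2 * (M * KA) * (E * D) + \<bar>k\<bar> * (2 * M * (E * D))"
          unfolding W'_def using 1 2 3 by linarith
        also have "\<dots> = (2 * M * KA + 2 * M * L + \<bar>k\<bar> * (2 * M)) * E * D"
          by (simp add: algebra_simps)
        finally have "\<bar>W' t - k * W t\<bar> \<le> (2 * M * KA + 2 * M * L + \<bar>k\<bar> * (2 * M)) * E * D" .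
        then have "norm (q' t) \<le> Q * ((2 * M * KA + 2 * M * L + \<bar>k\<bar> * (2 * M)) * E * D)"
          unfolding q'_def using Q[OF t] Qpos by (simp add: abs_mult mult_mono)
        also have "\<dots> \<le> B * D" using D by (simp add: B_def algebra_simps)
        finally show ?thesis .
      qed
      \<comment> \<open>With both points in the zone, velocity and displacement solve the same
        linear equation, and \<open>cross2_trace\<close> applies.\<close>
      have q0: "q' t = 0" if t: "a + \<eta> \<le> t" "t \<le> c - \<eta>" for t
      proof -
        have t': "a \<le> t" "t \<le> c" using t \<eta> by auto
        have "dist (x t) (z t) < d" using dist[OF t'] D by (simp add: dist_norm norm_minus_commute)
        then have "z t \<in> Z" using d(2) t interior_subset[of Z] by fastforce
        then have "f (z t) - f (x t) = A *v (z t - x t)" "f (x t) = A *v x t + b"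
          using Z xZ[OF t'] by (auto simp: matrix_vector_mult_diff_distrib)
        then show ?thesis
          unfolding q'_def W'_def W_def k_def using cross2_trace[of A "A *v x t + b" "z t - x t"] by simp
      qed
      have qv: "(q has_vector_derivative q' t) (at t)" for t
        using qd by (simp add: has_real_derivative_iff_has_vector_derivative)
      have "3 * \<eta> \<le> c - a"
        using \<eta>(2) by simp
      then have e: "\<eta> \<le> c - a" "a + \<eta> \<le> c - \<eta>"
        using \<eta>(1) by auto
      have "norm (q (a + \<eta>) - q a) \<le> B * D * \<bar>a + \<eta> - a\<bar>"
        by (rule norm_diff_le_vector_derivative[OF qv qB])
          (use \<eta>(1) e in \<open>auto simp: closed_segment_eq_real_ivl\<close>)
      moreover have "norm (q (c - \<eta>) - q (a + \<eta>)) \<le> 0 * \<bar>c - \<eta> - (a + \<eta>)\<bar>"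
        by (rule norm_diff_le_vector_derivative[OF qv])
          (use q0 e in \<open>auto simp: closed_segment_eq_real_ivl\<close>)
      moreover have "norm (q c - q (c - \<eta>)) \<le> B * D * \<bar>c - (c - \<eta>)\<bar>"
        by (rule norm_diff_le_vector_derivative[OF qv qB])
          (use \<eta>(1) e in \<open>auto simp: closed_segment_eq_real_ivl\<close>)
      ultimately have "\<bar>q c - q a\<bar> \<le> 2 * (B * D * \<eta>)"
        using \<eta>(1) by auto
      then have "exp (k * c) * \<bar>q c - q a\<bar> \<le> exp (k * c) * (2 * (B * D * \<eta>))"
        by (intro mult_left_mono) auto
      also have "\<dots> = (2 * B * exp (k * c) * \<eta>) * D" by (simp add: mult_ac)
      also have "\<dots> \<le> \<epsilon> * D"
      proof (rule mult_right_mono[OF _ D(1)])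
        have "0 < 2 * B * exp (k * c)" using B by simp
        then show "2 * B * exp (k * c) * \<eta> \<le> \<epsilon>"
          using \<eta>(3) by (simp only: pos_le_divide_eq) (simp add: mult_ac)
      qed
      also have "exp (k * c) * \<bar>q c - q a\<bar> = \<bar>W c - exp (k * (c - a)) * W a\<bar>"
      proof -
        have "exp (k * c) * (q c - q a) = W c - exp (k * (c - a)) * W a"
          unfolding q_def by (simp add: algebra_simps exp_diff exp_minus divide_inverse)
        then show ?thesis by (metis abs_exp_cancel abs_mult)
      qed
      finally have "\<bar>W c - exp (k * (c - a)) * W a\<bar> \<le> \<epsilon> * D" .
      moreover have "W c = cross2 (f (x c)) (z c - x c)" "W a = cross2 (f (x a)) (z a - x a)"
        unfolding W_def using Z xZ ac by auto
      ultimately show "\<bar>cross2 (f (x c)) (z c - x c) - exp (k * (c - a)) * cross2 (f (x a)) (z a - x a)\<bar> \<le> \<epsilon> * norm (z a - x a)"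
        by (simp add: D_def)
    qed
  qed
qed

end

section \<open>Two-zone periodic orbits\<close>

locale pwl =
  fixes A\<^sub>L A\<^sub>R :: "real^2^2" and b :: "real^2"
  assumes col12: "A\<^sub>L $ 1 $ 2 = A\<^sub>R $ 1 $ 2" and col22: "A\<^sub>L $ 2 $ 2 = A\<^sub>R $ 2 $ 2"
begin

abbreviation f where "f \<equiv> pwl_field A\<^sub>L A\<^sub>R b"

definition jump :: "real^2" where "jump = (\<chi> i. A\<^sub>R $ i $ 1 - A\<^sub>L $ i $ 1)"

definition lip_const :: real where "lip_const = onorm ((*v) A\<^sub>L) + norm jump"

lemma field_left: "z $ 1 \<le> 0 \<Longrightarrow> f z = A\<^sub>L *v z + b"
  by (simp add: pwl_field_def)

lemma field_right: "z $ 1 \<ge> 0 \<Longrightarrow> f z = A\<^sub>R *v z + b"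
  by (rule pwl_field_right[OF col12 col22])

text \<open>The matrices differ in the first column only, so the switching is a single
  \<open>max\<close> term, from which the global Lipschitz bound is read off.\<close>

lemma field_eq: "f z = A\<^sub>L *v z + b + max 0 (z $ 1) *\<^sub>R jump"
proof -
  have "A\<^sub>R *v z = A\<^sub>L *v z + (z $ 1) *\<^sub>R jump"
    using col12 col22 by (simp add: vec_eq_iff forall_2 matrix_vector_mult_def sum_2 jump_def algebra_simps)
  then show ?thesis by (cases "z $ 1 \<le> 0") (auto simp: pwl_field_def)
qed

sublocale planar_lipschitz f lip_const
proof
  show "lip_const-lipschitz_on UNIV f"
  proof (rule lipschitz_onI)
    fix z w :: "real^2"
    have "f z - f w = A\<^sub>L *v (z - w) + (max 0 (z $ 1) - max 0 (w $ 1)) *\<^sub>R jump"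
      by (simp add: field_eq matrix_vector_mult_diff_distrib algebra_simps)
    then have "norm (f z - f w) \<le> norm (A\<^sub>L *v (z - w)) + \<bar>max 0 (z $ 1) - max 0 (w $ 1)\<bar> * norm jump"
      by (metis norm_triangle_ineq norm_scaleR)
    also have "\<dots> \<le> onorm ((*v) A\<^sub>L) * norm (z - w) + norm (z - w) * norm jump"
    proof (intro add_mono mult_right_mono onorm matrix_vector_mul_bounded_linear)
      have "\<bar>max 0 (z $ 1) - max 0 (w $ 1)\<bar> \<le> \<bar>(z - w) $ 1\<bar>" by (auto simp: max_def)
      also have "\<dots> \<le> norm (z - w)" by (rule component_le_norm_cart)
      finally show "\<bar>max 0 (z $ 1) - max 0 (w $ 1)\<bar> \<le> norm (z - w)" .
    qed auto
    finally show "dist (f z) (f w) \<le> lip_const * dist z w"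
      by (simp add: dist_norm lip_const_def algebra_simps)
  qed (simp add: lip_const_def onorm_pos_le matrix_vector_mul_bounded_linear)
qed

lemma open_half_planes: "open {z::real^2. z $ 1 < 0}" "open {z::real^2. z $ 1 > 0}"
  by (intro open_Collect_less continuous_intros)+

lemma transport_left:
  assumes "solution f x" "a \<le> c" "\<And>t. a \<le> t \<Longrightarrow> t \<le> c \<Longrightarrow> x t $ 1 \<le> 0" "\<And>t. a < t \<Longrightarrow> t < c \<Longrightarrow> x t $ 1 < 0"
  shows "transport f x a c (exp (trace A\<^sub>L * (c - a)))"
proof (rule transport_zone[where Z = "{z. z $ 1 \<le> 0}", OF assms(1)])
  have "{z::real^2. z $ 1 < 0} \<subseteq> interior {z. z $ 1 \<le> 0}"
    by (rule interior_maximal) (use open_half_planes in auto)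
  then show "x t \<in> interior {z. z $ 1 \<le> 0}" if "a < t" "t < c" for t
    using assms(4)[OF that] by blast
qed (use assms field_left in auto)

lemma transport_right:
  assumes "solution f x" "a \<le> c" "\<And>t. a \<le> t \<Longrightarrow> t \<le> c \<Longrightarrow> x t $ 1 \<ge> 0" "\<And>t. a < t \<Longrightarrow> t < c \<Longrightarrow> x t $ 1 > 0"
  shows "transport f x a c (exp (trace A\<^sub>R * (c - a)))"
proof (rule transport_zone[where Z = "{z. z $ 1 \<ge> 0}", OF assms(1)])
  have "{z::real^2. z $ 1 > 0} \<subseteq> interior {z. z $ 1 \<ge> 0}"
    by (rule interior_maximal) (use open_half_planes in auto)
  then show "x t \<in> interior {z. z $ 1 \<ge> 0}" if "a < t" "t < c" for t
    using assms(4)[OF that] by blast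
qed (use assms field_right in auto)

end

section \<open>The return exponent of an orbit with one arc in each zone\<close>

locale two_zone_orbit = pwl +
  fixes x :: "real \<Rightarrow> real^2" and t0 t1 t2 :: real
  assumes sol: "solution f x" and order: "t0 < t1" "t1 < t2" and closes: "x t2 = x t0"
    and left: "\<And>t. t0 < t \<Longrightarrow> t < t1 \<Longrightarrow> x t $ 1 < 0"
    and right: "\<And>t. t1 < t \<Longrightarrow> t < t2 \<Longrightarrow> x t $ 1 > 0"
begin

lemma continuous_fst: "continuous_on S (\<lambda>t. x t $ 1)"
  by (intro continuous_intros solution_continuous[OF sol])

lemma left_closed: "x t $ 1 \<le> 0" if "t0 \<le> t" "t \<le> t1"
proof -
  have "t \<in> closure {t0<..<t1}" using that order by simp
  then show ?thesis
    using continuous_le_on_closure[of "{t0<..<t1}" "\<lambda>t. x t $ 1" t 0] left continuous_fst by fastforce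
qed

lemma right_closed: "x t $ 1 \<ge> 0" if "t1 \<le> t" "t \<le> t2"
proof -
  have "t \<in> closure {t1<..<t2}" using that order by simp
  then show ?thesis
    using continuous_ge_on_closure[of "{t1<..<t2}" "\<lambda>t. x t $ 1" t 0] right continuous_fst by fastforce
qed

text \<open>At \<open>t1\<close> the two closed half planes meet. The equality of the states at
  \<open>t0\<close> and \<open>t2\<close> does the same there.\<close>

lemma crossings: "x t0 $ 1 = 0" "x t1 $ 1 = 0" "x t2 $ 1 = 0"
  using left_closed[of t0] left_closed[of t1] right_closed[of t1] right_closed[of t2] order closes by auto

definition period :: real where "period = t2 - t0"

definition exponent :: real where "exponent = trace A\<^sub>L * (t1 - t0) + trace A\<^sub>R * (t2 - t1)"

lemma period_pos: "period > 0"
  using order by (simp add: period_def)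

lemma periodic: "x (t + period) = x t"
  unfolding period_def by (rule solution_periodic[OF sol]) (use closes in simp)

text \<open>A shorter period would move the crossing at \<open>t0\<close> to a crossing strictly
  between \<open>t0\<close> and \<open>t2\<close>, which can only be \<open>t1\<close>; then it
  would move the left arc into the right zone.\<close>

lemma minimal:
  assumes "0 < s" "s < period"
  shows "x (c + s) \<noteq> x c"
proof
  assume "x (c + s) = x c"
  then have per: "x (t + s) = x t" for t
    using solution_periodic[OF sol, of c "c + s" t] by simp
  have s: "t0 + s = t1"
    using per[of t0] crossings left[of "t0 + s"] right[of "t0 + s"] assms
    by (cases "t0 + s" t1 rule: linorder_cases) (auto simp: period_def)
  define e where "e = min (t1 - t0) (t2 - t1) / 2"
  have "0 < e" "t0 + e < t1" "t1 + e < t2"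
    using order by (auto simp: e_def min_def field_simps)
  then have "x (t0 + e) $ 1 < 0" "x (t1 + e) $ 1 > 0"
    by (auto intro!: left right)
  then show False using per[of "t0 + e"] s by (simp add: algebra_simps)
qed

text \<open>The base point may lie inside an arc. That arc is cut there, and its initial piece is
  traversed one period later, so the total exponent is the same for every base point.\<close>

lemma linear_return_orbit: "linear_return f (x c) period (exp exponent)"
proof -
  obtain r where r: "t0 \<le> r" "r < t0 + period" "x r = x c"
    using periodic_representative[where x = x, OF periodic period_pos, of t0 c] by blast
  have "transport f x r (r + period) (exp exponent)"
  proof (cases "r \<le> t1")
    case True
    have "transport f x r t1 (exp (trace A\<^sub>L * (t1 - r)))"
      by (rule transport_left[OF sol]) (use True r left left_closed in auto)
    moreover have "transport f x t1 t2 (exp (trace A\<^sub>R * (t2 - t1)))"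
      by (rule transport_right[OF sol]) (use order right right_closed in auto)
    moreover have "transport f x (t0 + period) (r + period) (exp (trace A\<^sub>L * (r - t0)))"
      by (rule transport_shift[OF transport_left[OF sol]]) (use True r left left_closed periodic in auto)
    ultimately have "transport f x r (r + period)
        (exp (trace A\<^sub>L * (r - t0)) * (exp (trace A\<^sub>R * (t2 - t1)) * exp (trace A\<^sub>L * (t1 - r))))"
      using transport_compose[OF sol] by (simp add: period_def) blast
    then show ?thesis
      by (simp add: exponent_def algebra_simps flip: exp_add)
  next
    case False
    have "transport f x r t2 (exp (trace A\<^sub>R * (t2 - r)))"
      by (rule transport_right[OF sol]) (use False r right right_closed period_def in auto)
    moreover have "transport f x (t0 + period) (t1 + period) (exp (trace A\<^sub>L * (t1 - t0)))"
      by (rule transport_shift[OF transport_left[OF sol]]) (use order left left_closed periodic in auto)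
    moreover have "transport f x (t1 + period) (r + period) (exp (trace A\<^sub>R * (r - t1)))"
      by (rule transport_shift[OF transport_right[OF sol]]) (use False r right right_closed periodic period_def in auto)
    ultimately have "transport f x r (r + period)
        (exp (trace A\<^sub>R * (r - t1)) * (exp (trace A\<^sub>L * (t1 - t0)) * exp (trace A\<^sub>R * (t2 - r))))"
      using transport_compose[OF sol] by (simp add: period_def) blast
    then show ?thesis
      by (simp add: exponent_def algebra_simps flip: exp_add)
  qed
  then show ?thesis
    using linear_return_if_transport[of f x r period] periodic r(3) by metis
qed

lemma field_nonzero: "f (x c) \<noteq> 0"
proof
  assume "f (x c) = 0"
  then have "x (c + period / 2) = x c" using solution_constant[OF sol] by metis
  then show False using minimal[of "period / 2" c] period_pos by simp
qed

lemma periodic_sectionI: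
  assumes "cross2 (f (x c)) v \<noteq> 0"
  shows "periodic_section f lip_const (x c) v (\<lambda>t. x (t + c)) period"
proof unfold_locales
  show "x (t + c) \<noteq> x c" if "0 < t" "t < period" for t
    using minimal[OF that, of c] by (simp add: add.commute)
  show "x (t + period + c) = x (t + c)" for t
    using periodic[of "t + c"] by (simp add: algebra_simps)
qed (use assms sol period_pos solution_shift in auto)

lemma range_shift: "range (\<lambda>t. x (t + c)) = range x"
proof -
  have "x t \<in> range (\<lambda>t. x (t + c))" for t by (rule image_eqI[of _ _ "t - c"]) auto
  then show ?thesis by auto
qed

lemma hyperbolic_orbit:
  assumes "exponent \<noteq> 0"
  shows "hyperbolic f (range x)"
  unfolding hyperbolic_def
proof (intro ballI allI impI)
  fix p v assume "p \<in> range x" and v: "v \<notin> span {f p}"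
  then obtain c where c: "p = x c" by auto
  have "cross2 (f (x c)) v \<noteq> 0"
    using in_span_if_cross2_eq_0[of "f p" v] v field_nonzero c by metis
  then interpret periodic_section f lip_const "x c" v "\<lambda>t. x (t + c)" period
    by (rule periodic_sectionI)
  show "\<exists>\<epsilon>>0. range x \<inter> section_segment p v \<epsilon> = {p} \<and>
      (\<exists>P D. (\<forall>\<^sub>F s in nhds 0. first_return f p v \<epsilon> s (P s)) \<and> (P has_real_derivative D) (at 0) \<and> D \<noteq> 1)"
    using hyperbolic_at_base[OF linear_return_orbit] assms unfolding range_shift c
    by (metis exp_eq_one_iff)
qed

lemma attracting_if_exponent_neg:
  assumes "exponent < 0"
  shows "attracting f (range x)"
proof -
  define u where "u = f (x 0)"
  \<comment> \<open>The velocity turned by a right angle is transversal to it.\<close>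
  define v :: "real^2" where "v = (\<chi> i. if i = 1 then - u $ 2 else u $ 1)"
  have "cross2 u v = (u $ 1)\<^sup>2 + (u $ 2)\<^sup>2"
    by (simp add: cross2_def v_def power2_eq_square)
  moreover have "(u $ 1)\<^sup>2 + (u $ 2)\<^sup>2 \<noteq> 0"
    using field_nonzero[of 0] by (simp add: u_def vec_eq_iff forall_2 sum_power2_eq_zero_iff)
  ultimately have "cross2 (f (x 0)) v \<noteq> 0" by (simp add: u_def)
  then interpret periodic_section f lip_const "x 0" v "\<lambda>t. x (t + 0)" period
    by (rule periodic_sectionI)
  show ?thesis
    using attracting_orbit[OF linear_return_orbit] assms by simp
qed

end

section \<open>Half-return curves of an affine zone\<close>

text \<open>\<open>sn\<close> and \<open>cs\<close> solve \<open>sn' = cs\<close>, \<open>cs' = \<Delta> sn\<close>, and \<open>kerS T D\<close> is the solution of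
  \<open>S'' = T S' - D S\<close> with \<open>S(0) = 0\<close>, \<open>S'(0) = 1\<close>.\<close>

definition sn :: "real \<Rightarrow> real \<Rightarrow> real" where
  "sn \<Delta> t = (if \<Delta> > 0 then sinh (sqrt \<Delta> * t) / sqrt \<Delta> else if \<Delta> = 0 then t else sin (sqrt (- \<Delta>) * t) / sqrt (- \<Delta>))"

definition cs :: "real \<Rightarrow> real \<Rightarrow> real" where
  "cs \<Delta> t = (if \<Delta> > 0 then cosh (sqrt \<Delta> * t) else if \<Delta> = 0 then 1 else cos (sqrt (- \<Delta>) * t))"

lemma sn_0 [simp]: "sn \<Delta> 0 = 0" and cs_0 [simp]: "cs \<Delta> 0 = 1"
  by (auto simp: sn_def cs_def)

lemma sn_minus [simp]: "sn \<Delta> (- t) = - sn \<Delta> t"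
  by (auto simp: sn_def)

lemma sn_deriv: "(sn \<Delta> has_real_derivative cs \<Delta> t) (at t)"
proof -
  have trig: "((\<lambda>t. sinh (w * t) / w) has_real_derivative cosh (w * t)) (at t)"
    "((\<lambda>t. sin (w * t) / w) has_real_derivative cos (w * t)) (at t)" if "w \<noteq> 0" for w :: real
    using that by (auto intro!: derivative_eq_intros)
  consider "\<Delta> > 0" | "\<Delta> = 0" | "\<Delta> < 0" by linarith
  then show ?thesis
  proof cases
    case 1
    then have "sn \<Delta> = (\<lambda>t. sinh (sqrt \<Delta> * t) / sqrt \<Delta>)" by (auto simp: sn_def fun_eq_iff)
    then show ?thesis using 1 trig(1)[of "sqrt \<Delta>"] by (simp add: cs_def)
  next
    case 2
    then have "sn \<Delta> = (\<lambda>t. t)" by (auto simp: sn_def fun_eq_iff)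
    then show ?thesis using 2 by (auto simp: cs_def)
  next
    case 3
    then have "sn \<Delta> = (\<lambda>t. sin (sqrt (- \<Delta>) * t) / sqrt (- \<Delta>))" by (auto simp: sn_def fun_eq_iff)
    then show ?thesis using 3 trig(2)[of "sqrt (- \<Delta>)"] by (simp add: cs_def)
  qed
qed

lemma cs_deriv: "(cs \<Delta> has_real_derivative \<Delta> * sn \<Delta> t) (at t)"
proof -
  consider "\<Delta> > 0" | "\<Delta> = 0" | "\<Delta> < 0" by linarith
  then show ?thesis
  proof cases
    case 1
    then have "cs \<Delta> = (\<lambda>t. cosh (sqrt \<Delta> * t))" by (auto simp: cs_def fun_eq_iff)
    moreover have "sinh (sqrt \<Delta> * t) * sqrt \<Delta> = \<Delta> * (sinh (sqrt \<Delta> * t) / sqrt \<Delta>)"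
      using 1 by (simp add: field_simps)
    ultimately show ?thesis using 1 by (auto simp: sn_def intro!: derivative_eq_intros)
  next
    case 2
    then have "cs \<Delta> = (\<lambda>t. 1)" by (auto simp: cs_def fun_eq_iff)
    then show ?thesis using 2 by (auto simp: sn_def intro!: derivative_eq_intros)
  next
    case 3
    then have "cs \<Delta> = (\<lambda>t. cos (sqrt (- \<Delta>) * t))" by (auto simp: cs_def fun_eq_iff)
    moreover have "- (sin (sqrt (- \<Delta>) * t) * sqrt (- \<Delta>)) = \<Delta> * (sin (sqrt (- \<Delta>) * t) / sqrt (- \<Delta>))"
    proof -
      have "sqrt (- \<Delta>) * sqrt (- \<Delta>) = - \<Delta>" using 3 by (simp add: real_sqrt_mult_self)
      then have "\<Delta> / sqrt (- \<Delta>) = - sqrt (- \<Delta>)" using 3 by (simp add: field_simps)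
      moreover have "\<Delta> * (sin (sqrt (- \<Delta>) * t) / sqrt (- \<Delta>)) = (\<Delta> / sqrt (- \<Delta>)) * sin (sqrt (- \<Delta>) * t)"
        by simp
      ultimately show ?thesis by simp
    qed
    ultimately show ?thesis using 3 by (auto simp: sn_def intro!: derivative_eq_intros)
  qed
qed

text \<open>A quarter of the discriminant of the characteristic polynomial. The eigenvalues are
  \<open>T / 2 \<plusminus> sqrt (disc T D)\<close>; a negative value means a focus with angular
  frequency \<open>sqrt (- disc T D)\<close>.\<close>

definition disc :: "real \<Rightarrow> real \<Rightarrow> real" where "disc T D = T\<^sup>2 / 4 - D"

definition kerS :: "real \<Rightarrow> real \<Rightarrow> real \<Rightarrow> real" where
  "kerS T D t = exp (T * t / 2) * sn (disc T D) t"

definition kerS' :: "real \<Rightarrow> real \<Rightarrow> real \<Rightarrow> real" where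
  "kerS' T D t = exp (T * t / 2) * (cs (disc T D) t + T / 2 * sn (disc T D) t)"

text \<open>The response to a constant force: \<open>C'' = T C' - D C + 1\<close> with
  \<open>C(0) = C'(0) = 0\<close>. A primitive, unlike a closed formula, needs no special case for
  \<open>D = 0\<close>.\<close>

definition kerC :: "real \<Rightarrow> real \<Rightarrow> real \<Rightarrow> real" where
  "kerC T D = primitive (kerS T D)"

lemma kerS_0 [simp]: "kerS T D 0 = 0" and kerS'_0 [simp]: "kerS' T D 0 = 1"
  and kerC_0 [simp]: "kerC T D 0 = 0"
  by (auto simp: kerS_def kerS'_def kerC_def)

lemma kerS_minus: "kerS T D (- t) = - exp (- (T * t)) * kerS T D t"
proof -
  have "exp (- (T * t) / 2) = exp (- (T * t)) * exp (T * t / 2)"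
    by (simp flip: exp_add)
  then show ?thesis by (simp add: kerS_def)
qed

lemma exp_half_deriv: "((\<lambda>t. exp (T * t / 2)) has_real_derivative exp (T * t / 2) * (T / 2)) (at t)"
  by (auto intro!: derivative_eq_intros)

lemma kerS_deriv: "(kerS T D has_real_derivative kerS' T D t) (at t)"
proof -
  have "((\<lambda>t. exp (T * t / 2) * sn (disc T D) t) has_real_derivative
      exp (T * t / 2) * (T / 2) * sn (disc T D) t + cs (disc T D) t * exp (T * t / 2)) (at t)"
    by (rule DERIV_mult exp_half_deriv sn_deriv)+
  then show ?thesis unfolding kerS_def[abs_def] kerS'_def by (simp add: algebra_simps)
qed

lemma kerS'_deriv: "(kerS' T D has_real_derivative T * kerS' T D t - D * kerS T D t) (at t)"
proof -
  have "((\<lambda>t. exp (T * t / 2) * (cs (disc T D) t + T / 2 * sn (disc T D) t)) has_real_derivative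
      exp (T * t / 2) * (T / 2) * (cs (disc T D) t + T / 2 * sn (disc T D) t)
      + (disc T D * sn (disc T D) t + T / 2 * cs (disc T D) t) * exp (T * t / 2)) (at t)"
    by (rule DERIV_mult exp_half_deriv DERIV_add DERIV_cmult sn_deriv cs_deriv)+
  moreover have "exp (T * t / 2) * (T / 2) * (cs (disc T D) t + T / 2 * sn (disc T D) t)
      + (disc T D * sn (disc T D) t + T / 2 * cs (disc T D) t) * exp (T * t / 2)
      = T * kerS' T D t - D * kerS T D t"
    unfolding kerS_def kerS'_def disc_def by (simp add: algebra_simps power2_eq_square)
  ultimately show ?thesis unfolding kerS'_def[abs_def] by simp
qed

lemma kerS_continuous: "continuous_on X (kerS T D)"
  by (meson DERIV_isCont kerS_deriv continuous_at_imp_continuous_on)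

lemma kerC_deriv: "(kerC T D has_real_derivative kerS T D t) (at t)"
  unfolding kerC_def has_real_derivative_iff_has_vector_derivative
  by (rule has_vector_derivative_primitive[OF kerS_continuous])

text \<open>The equation \<open>S'' = T S' - D S\<close>, integrated once.\<close>

lemma kerS'_eq: "kerS' T D t = 1 + T * kerS T D t - D * kerC T D t"
proof -
  have "((\<lambda>t. kerS' T D t - T * kerS T D t + D * kerC T D t) has_real_derivative
      (T * kerS' T D t - D * kerS T D t) - T * kerS' T D t + D * kerS T D t) (at t)" for t
    by (rule derivative_eq_intros kerS_deriv kerS'_deriv kerC_deriv refl)+ simp
  then have "\<forall>t. ((\<lambda>t. kerS' T D t - T * kerS T D t + D * kerC T D t) has_real_derivative 0) (at t)"
    by simp
  from DERIV_isconst_all[OF this, of t 0] show ?thesis by simp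
qed

lemma minus_arg_deriv:
  assumes "\<And>t. (g has_real_derivative g' t) (at t)"
  shows "((\<lambda>t. g (- t)) has_real_derivative - g' (- t)) (at (t::real))"
proof -
  have "((\<lambda>t. g (- t)) has_real_derivative g' (- t) * (- 1)) (at t)"
    by (rule DERIV_chain2[OF assms]) (auto intro!: derivative_eq_intros)
  then show ?thesis by simp
qed

section \<open>The ends of an arc and the determinant \<open>wq\<close>\<close>

definition kerK :: "real \<Rightarrow> real \<Rightarrow> real \<Rightarrow> real" where
  "kerK T D t = kerC T D t + exp (T * t) * kerC T D (- t)"

text \<open>The difference \<open>M\<close> of the two sides satisfies \<open>M' = T M\<close> and
  \<open>M(0) = 0\<close>. The right-hand side is \<open>S\<^sup>2 W(C / S)\<close>, while the
  definition of \<open>kerK\<close> is a sum whose positivity is visible once \<open>C\<close> is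
  positive at \<open>t\<close> and \<open>- t\<close>; so the identity yields the sign of
  \<open>W\<close>.\<close>

lemma kerK_eq: "kerK T D t = (kerS T D t)\<^sup>2 - T * kerC T D t * kerS T D t + D * (kerC T D t)\<^sup>2"
proof -
  define M where "M t = (kerS T D t)\<^sup>2 - T * kerC T D t * kerS T D t + D * (kerC T D t)\<^sup>2 - kerK T D t" for t
  have "((\<lambda>t. exp (- (T * t)) * M t) has_real_derivative 0) (at t)" for t
  proof -
    let ?S = "kerS T D t" and ?C = "kerC T D t" and ?S' = "kerS' T D t"
    let ?E = "exp (T * t)"
    have "(M has_real_derivative 2 * ?S * ?S' - (T * ?S * ?S + T * ?C * ?S') + D * (2 * ?C * ?S)
        - (?S + (?E * T * kerC T D (- t) + (- kerS T D (- t)) * ?E))) (at t)"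
      unfolding M_def[abs_def] kerK_def
      by (rule derivative_eq_intros kerS_deriv kerC_deriv minus_arg_deriv[OF kerC_deriv] refl)+ simp
    moreover have "2 * ?S * ?S' - (T * ?S * ?S + T * ?C * ?S') + D * (2 * ?C * ?S)
        - (?S + (?E * T * kerC T D (- t) + (- kerS T D (- t)) * ?E)) = T * M t"
    proof -
      have "?E * exp (- (T * t)) = 1" by (simp flip: exp_add)
      then have "kerS T D (- t) * ?E = - ?S"
        by (simp add: kerS_minus mult_ac)
      then show ?thesis
        unfolding M_def kerK_def kerS'_eq by (simp add: algebra_simps power2_eq_square)
    qed
    ultimately have "(M has_real_derivative T * M t) (at t)" by simp
    then have "((\<lambda>t. exp (- (T * t)) * M t) has_real_derivative exp (- (T * t)) * - T * M t + T * M t * exp (- (T * t))) (at t)"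
      by (auto intro!: derivative_eq_intros)
    then show ?thesis by (simp add: algebra_simps)
  qed
  then have "exp (- (T * t)) * M t = exp (- (T * 0)) * M 0"
    using DERIV_isconst_all[of "\<lambda>t. exp (- (T * t)) * M t" t 0] by simp
  then have "M t = 0" by (simp add: M_def kerK_def)
  then show ?thesis by (simp add: M_def)
qed

text \<open>An arc of \<open>x' = T x - y\<close>, \<open>y' = D x - a\<close> that starts and ends on \<open>x = 0\<close> and takes the
  time \<open>t\<close> starts at \<open>y = a * ystart T D t\<close> and ends at \<open>y = a * yend T D t\<close>, unless
  \<open>kerS T D t = 0\<close>.\<close>

definition ystart :: "real \<Rightarrow> real \<Rightarrow> real \<Rightarrow> real" where
  "ystart T D t = kerC T D t / kerS T D t"

definition yend :: "real \<Rightarrow> real \<Rightarrow> real \<Rightarrow> real" where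
  "yend T D t = - exp (T * t) * kerC T D (- t) / kerS T D t"

text \<open>For \<open>a = 1\<close> the velocity at \<open>(0, y)\<close> is
  \<open>w = (- y, - 1)\<close>, and \<open>wq T D y\<close> is the determinant of \<open>w\<close>
  and \<open>A w\<close>, where \<open>A\<close> has the rows \<open>(T, - 1)\<close> and
  \<open>(D, 0)\<close>. Both vectors solve the linear equation along the arc, which accounts for
  the factor in \<open>wq_yend\<close>.\<close>

definition wq :: "real \<Rightarrow> real \<Rightarrow> real \<Rightarrow> real" where
  "wq T D y = D * y\<^sup>2 - T * y + 1"

lemma wq_ystart: "kerS T D t \<noteq> 0 \<Longrightarrow> wq T D (ystart T D t) = kerK T D t / (kerS T D t)\<^sup>2"
  unfolding wq_def ystart_def kerK_eq by (simp add: field_simps power2_eq_square)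

lemma kerK_minus: "kerK T D (- t) = exp (- (T * t)) * kerK T D t"
  by (simp add: kerK_def algebra_simps flip: exp_add)

text \<open>Running an arc backwards exchanges its ends, so every fact about \<open>yend\<close>
  follows from one about \<open>ystart\<close>.\<close>

lemma yend_eq: "yend T D t = ystart T D (- t)"
proof -
  have "exp (T * t) * exp (- (T * t)) = 1" by (simp flip: exp_add)
  then show ?thesis by (simp add: yend_def ystart_def kerS_minus exp_minus divide_inverse)
qed

lemma wq_yend:
  assumes "kerS T D t \<noteq> 0"
  shows "wq T D (yend T D t) = exp (T * t) * wq T D (ystart T D t)"
proof -
  have "kerS T D (- t) \<noteq> 0" using assms by (simp add: kerS_minus)
  then have "wq T D (yend T D t) = kerK T D (- t) / (kerS T D (- t))\<^sup>2"
    unfolding yend_eq by (rule wq_ystart)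
  also have "\<dots> = exp (T * t) * (kerK T D t / (kerS T D t)\<^sup>2)"
    using assms by (simp add: kerK_minus kerS_minus exp_minus power2_eq_square field_simps)
  finally show ?thesis using wq_ystart[OF assms] by simp
qed

text \<open>The numerator \<open>S\<^sup>2 - C S'\<close> of the quotient rule equals
  \<open>kerK - C\<close>, which is \<open>exp (T * t) * C(- t)\<close>. Together with
  \<open>yend_deriv\<close> and \<open>wq_yend\<close> this gives
  \<open>Y dY / W(Y) = Z dZ / W(Z)\<close> where the quotients are defined.\<close>

lemma ystart_deriv:
  assumes "kerS T D t \<noteq> 0"
  shows "(ystart T D has_real_derivative - yend T D t / kerS T D t) (at t)"
proof -
  have "(ystart T D has_real_derivative
      (kerS T D t * kerS T D t - kerC T D t * kerS' T D t) / (kerS T D t * kerS T D t)) (at t)"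
    unfolding ystart_def[abs_def] by (rule DERIV_divide kerC_deriv kerS_deriv assms)+
  also have "kerS T D t * kerS T D t - kerC T D t * kerS' T D t = kerK T D t - kerC T D t"
    unfolding kerK_eq kerS'_eq by (simp add: algebra_simps power2_eq_square)
  also have "\<dots> = exp (T * t) * kerC T D (- t)" by (simp add: kerK_def)
  finally show ?thesis by (simp add: yend_def)
qed

lemma yend_deriv:
  assumes "kerS T D t \<noteq> 0"
  shows "(yend T D has_real_derivative - exp (T * t) * ystart T D t / kerS T D t) (at t)"
proof -
  have S: "kerS T D (- t) \<noteq> 0" using assms by (simp add: kerS_minus)
  have "((\<lambda>t. ystart T D (- t)) has_real_derivative (- yend T D (- t) / kerS T D (- t)) * (- 1)) (at t)"
    by (rule DERIV_chain2[where f = "ystart T D" and g = uminus, OF ystart_deriv[OF S]]) (auto intro!: derivative_eq_intros)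
  moreover have "yend T D (- t) = ystart T D t" by (simp add: yend_eq)
  moreover have "(- ystart T D t / kerS T D (- t)) * (- 1) = - exp (T * t) * ystart T D t / kerS T D t"
    using assms by (simp add: kerS_minus exp_minus field_simps)
  ultimately show ?thesis by (simp add: yend_eq[abs_def])
qed

text \<open>The times before the first zero of \<open>kerS\<close> after 0.\<close>

definition early :: "real \<Rightarrow> real \<Rightarrow> real set" where
  "early T D = {t. t > 0 \<and> (disc T D < 0 \<longrightarrow> sqrt (- disc T D) * t < pi)}"

lemma early_downward: "t \<in> early T D \<Longrightarrow> 0 < s \<Longrightarrow> s \<le> t \<Longrightarrow> s \<in> early T D"
  by (auto simp: early_def intro: le_less_trans[OF mult_left_mono])

lemma kerS_pos_early:
  assumes "t \<in> early T D"
  shows "kerS T D t > 0"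
proof -
  consider "disc T D > 0" | "disc T D = 0" | "disc T D < 0" by linarith
  then have "sn (disc T D) t > 0"
  proof cases
    case 3
    then have "sin (sqrt (- disc T D) * t) > 0" using assms by (intro sin_gt_zero) (auto simp: early_def)
    then show ?thesis using 3 by (auto simp: sn_def)
  qed (use assms in \<open>auto simp: sn_def early_def\<close>)
  then show ?thesis by (simp add: kerS_def)
qed

text \<open>The hypothesis concerns only the times before \<open>t\<close>, because the lemma is
  also applied when \<open>t\<close> is the first zero of \<open>kerS\<close>.\<close>

lemma kerC_pos:
  assumes "t > 0" "\<And>s. 0 < s \<Longrightarrow> s < t \<Longrightarrow> s \<in> early T D"
  shows "kerC T D t > 0" "kerC T D (- t) > 0"
proof -
  have "kerC T D 0 < kerC T D t"
  proof (rule DERIV_pos_imp_increasing_open[OF assms(1)])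
    show "\<exists>y. (kerC T D has_real_derivative y) (at s) \<and> 0 < y" if "0 < s" "s < t" for s
      using kerC_deriv kerS_pos_early[OF assms(2)[OF that]] by blast
  qed (meson DERIV_isCont kerC_deriv continuous_at_imp_continuous_on)
  then show "kerC T D t > 0" by simp
  have "kerC T D (- 0) < kerC T D (- t)"
  proof (rule DERIV_pos_imp_increasing_open[OF assms(1), of "\<lambda>t. kerC T D (- t)"])
    show "\<exists>y. ((\<lambda>t. kerC T D (- t)) has_real_derivative y) (at s) \<and> 0 < y" if "0 < s" "s < t" for s
      using minus_arg_deriv[of "kerC T D", OF kerC_deriv] kerS_pos_early[OF assms(2)[OF that]]
      by (intro exI[of _ "- kerS T D (- s)"]) (auto simp: kerS_minus)
    show "continuous_on {0..t} (\<lambda>t. kerC T D (- t))"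
      by (rule continuous_at_imp_continuous_on, rule ballI, rule DERIV_isCont, rule minus_arg_deriv, rule kerC_deriv)
  qed
  then show "kerC T D (- t) > 0" by simp
qed

lemma early_signs:
  assumes "t \<in> early T D"
  shows "kerS T D t > 0" "kerC T D t > 0" "kerC T D (- t) > 0" "ystart T D t > 0" "yend T D t < 0"
    "wq T D (ystart T D t) > 0" "wq T D (yend T D t) > 0"
proof -
  have t: "t > 0" using assms by (simp add: early_def)
  have e: "s \<in> early T D" if "0 < s" "s < t" for s using early_downward[OF assms] that by simp
  show S: "kerS T D t > 0" by (rule kerS_pos_early[OF assms])
  show C: "kerC T D t > 0" "kerC T D (- t) > 0" using kerC_pos[OF t e] by auto
  show "ystart T D t > 0" "yend T D t < 0"
    using S C by (auto simp: ystart_def yend_def divide_neg_pos mult_pos_pos)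
  show W: "wq T D (ystart T D t) > 0"
    unfolding wq_ystart[OF less_imp_neq[OF S, symmetric]] kerK_def
    using S C by (intro divide_pos_pos add_pos_pos mult_pos_pos zero_less_power) auto
  show "wq T D (yend T D t) > 0"
    unfolding wq_yend[OF less_imp_neq[OF S, symmetric]] using W by simp
qed

lemma early_convex:
  assumes "s \<in> early T D" "t \<in> early T D" "s \<le> r" "r \<le> t"
  shows "r \<in> early T D"
  using early_downward[OF assms(2), of r] assms(1,3,4) by (auto simp: early_def)

lemma ystart_strict_mono_early:
  assumes "s \<in> early T D" "t \<in> early T D" "s < t"
  shows "ystart T D s < ystart T D t"
proof (rule DERIV_pos_imp_increasing[OF assms(3)])
  fix r assume "s \<le> r" "r \<le> t"
  then have r: "r \<in> early T D" using early_convex assms by blast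
  have "(ystart T D has_real_derivative - yend T D r / kerS T D r) (at r)"
    using early_signs[OF r] by (intro ystart_deriv) auto
  moreover have "- yend T D r / kerS T D r > 0" using early_signs[OF r] by (simp add: divide_neg_pos)
  ultimately show "\<exists>y. (ystart T D has_real_derivative y) (at r) \<and> 0 < y" by blast
qed

lemma yend_strict_antimono_early:
  assumes "s \<in> early T D" "t \<in> early T D" "s < t"
  shows "yend T D t < yend T D s"
proof (rule DERIV_neg_imp_decreasing[OF assms(3)])
  fix r assume "s \<le> r" "r \<le> t"
  then have r: "r \<in> early T D" using early_convex assms by blast
  have "(yend T D has_real_derivative - exp (T * r) * ystart T D r / kerS T D r) (at r)"
    using early_signs[OF r] by (intro yend_deriv) auto
  moreover have "- exp (T * r) * ystart T D r / kerS T D r < 0"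
    using early_signs[OF r] by (simp add: divide_neg_pos)
  ultimately show "\<exists>y. (yend T D has_real_derivative y) (at r) \<and> y < 0" by blast
qed

text \<open>The times between the first two zeros of \<open>kerS\<close> after 0, for a focus.\<close>

definition late :: "real \<Rightarrow> real \<Rightarrow> real set" where
  "late T D = {t. disc T D < 0 \<and> pi < sqrt (- disc T D) * t \<and> sqrt (- disc T D) * t < 2 * pi}"

lemma late_convex:
  assumes "s \<in> late T D" "t \<in> late T D" "s \<le> r" "r \<le> t"
  shows "r \<in> late T D"
proof -
  have "sqrt (- disc T D) * s \<le> sqrt (- disc T D) * r" "sqrt (- disc T D) * r \<le> sqrt (- disc T D) * t"
    using assms by (auto simp: late_def intro!: mult_left_mono)
  with assms(1,2) show ?thesis
    unfolding late_def mem_Collect_eq by (intro conjI) linarith+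
qed

lemma kerS_neg_late:
  assumes "t \<in> late T D"
  shows "kerS T D t < 0"
proof -
  have "sin (sqrt (- disc T D) * t) < 0"
    using assms by (intro sin_lt_zero) (auto simp: late_def)
  then have "sn (disc T D) t < 0"
    using assms by (auto simp: sn_def late_def divide_neg_pos)
  then show ?thesis by (simp add: kerS_def mult_pos_neg)
qed

text \<open>As a polynomial in \<open>y\<close>, \<open>wq T D\<close> has the discriminant
  \<open>4 * disc T D\<close>, which is negative for a focus.\<close>

lemma wq_pos_late:
  assumes "t \<in> late T D"
  shows "wq T D y > 0"
proof -
  have D: "T\<^sup>2 / 4 < D" using assms by (simp add: late_def disc_def)
  have "wq T D y = (T / 2 * y - 1)\<^sup>2 + (D - T\<^sup>2 / 4) * y\<^sup>2"
    by (simp add: wq_def power2_eq_square algebra_simps)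
  moreover have "(T / 2 * y - 1)\<^sup>2 + (D - T\<^sup>2 / 4) * y\<^sup>2 > 0"
    using D by (cases "y = 0") (auto intro!: add_nonneg_pos)
  ultimately show ?thesis by simp
qed

text \<open>On \<open>late\<close> times \<open>kerS\<close> is negative, so \<open>C(t)\<close> and
  \<open>C(- t)\<close> both decrease. Their positivity at a later time, which is what the signs of
  the ends express, passes to earlier times.\<close>

lemma signs_late_downward:
  assumes "s \<in> late T D" "t \<in> late T D" "ystart T D t < 0" "yend T D t > 0" "s \<le> r" "r \<le> t"
  shows "ystart T D r < 0" "yend T D r > 0"
proof -
  have l: "q \<in> late T D" if "s \<le> q" "q \<le> t" for q using late_convex assms(1,2) that by blast
  have Ct: "kerC T D t > 0" "kerC T D (- t) > 0"
    using assms(3,4) kerS_neg_late[OF assms(2)]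
    by (auto simp: ystart_def yend_def divide_less_0_iff zero_less_divide_iff mult_less_0_iff zero_less_mult_iff)
  have "kerC T D t \<le> kerC T D r"
  proof (rule DERIV_nonpos_imp_nonincreasing[OF assms(6)])
    show "\<exists>y. (kerC T D has_real_derivative y) (at q) \<and> y \<le> 0" if "r \<le> q" "q \<le> t" for q
      using kerC_deriv kerS_neg_late[OF l, of q] that assms(5) by fastforce
  qed
  moreover have "kerC T D (- t) \<le> kerC T D (- r)"
  proof (rule DERIV_nonpos_imp_nonincreasing[OF assms(6), of "\<lambda>t. kerC T D (- t)"])
    show "\<exists>y. ((\<lambda>t. kerC T D (- t)) has_real_derivative y) (at q) \<and> y \<le> 0" if "r \<le> q" "q \<le> t" for q
      using minus_arg_deriv[of "kerC T D", OF kerC_deriv] kerS_neg_late[OF l, of q] that assms(5)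
      by (intro exI[of _ "- kerS T D (- q)"]) (auto simp: kerS_minus mult_nonneg_nonpos)
  qed
  ultimately have "kerC T D r > 0" "kerC T D (- r) > 0" "kerS T D r < 0"
    using Ct kerS_neg_late[OF l] assms(5,6) by auto
  then show "ystart T D r < 0" "yend T D r > 0"
    by (auto simp: ystart_def yend_def divide_pos_neg divide_neg_neg mult_pos_pos)
qed

text \<open>Where the signs are right, \<open>ystart\<close> increases and \<open>yend\<close>
  decreases with the flight time. By \<open>signs_late_downward\<close> they are right between the
  two times, whichever is later; so the order of the starting values determines that of the
  times.\<close>

lemma half_return_antimono_late:
  assumes s: "s \<in> late T D" "ystart T D s < 0" "yend T D s > 0"
    and t: "t \<in> late T D" "ystart T D t < 0" "yend T D t > 0"
    and less: "ystart T D s < ystart T D t"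
  shows "yend T D t < yend T D s"
proof -
  have deriv: "\<exists>y. (ystart T D has_real_derivative y) (at r) \<and> 0 < y"
      "\<exists>y. (yend T D has_real_derivative y) (at r) \<and> y < 0"
    if "p \<in> late T D" "q \<in> late T D" "ystart T D q < 0" "yend T D q > 0" "p \<le> r" "r \<le> q" for p q r
  proof -
    have S: "kerS T D r < 0" using kerS_neg_late late_convex that by blast
    note Y = signs_late_downward[OF that]
    have "- yend T D r / kerS T D r > 0" "- exp (T * r) * ystart T D r / kerS T D r < 0"
      using S Y by (auto simp: divide_neg_neg divide_pos_neg mult_pos_neg)
    then show "\<exists>y. (ystart T D has_real_derivative y) (at r) \<and> 0 < y"
      "\<exists>y. (yend T D has_real_derivative y) (at r) \<and> y < 0"
      using ystart_deriv[OF less_imp_neq[OF S]] yend_deriv[OF less_imp_neq[OF S]] by auto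
  qed
  have "s < t"
  proof (rule ccontr)
    assume "\<not> s < t"
    then have "ystart T D t \<le> ystart T D s"
    proof (cases "s = t")
      case False
      with \<open>\<not> s < t\<close> have "t < s" by simp
      then have "ystart T D t < ystart T D s"
        by (rule DERIV_pos_imp_increasing) (use deriv(1)[OF t(1) s] in auto)
      then show ?thesis by simp
    qed simp
    then show False using less by simp
  qed
  then show ?thesis
    by (rule DERIV_neg_imp_decreasing) (use deriv(2)[OF s(1) t] in auto)
qed

section \<open>Comparison of the two half-return curves\<close>

text \<open>The polynomial \<open>W\<^sub>L(u) W\<^sub>R(v) - W\<^sub>L(v) W\<^sub>R(u)\<close> is
  antisymmetric, hence divisible by \<open>u - v\<close>. The quotient is symmetric and affine in
  each variable.\<close>

definition mixF :: "real \<Rightarrow> real \<Rightarrow> real \<Rightarrow> real \<Rightarrow> real \<Rightarrow> real \<Rightarrow> real" where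
  "mixF T\<^sub>L D\<^sub>L T\<^sub>R D\<^sub>R u v = (T\<^sub>L * D\<^sub>R - D\<^sub>L * T\<^sub>R) * u * v + (D\<^sub>L - D\<^sub>R) * (u + v) + (T\<^sub>R - T\<^sub>L)"

lemma wq_cross_diff:
  "wq T\<^sub>L D\<^sub>L u * wq T\<^sub>R D\<^sub>R v - wq T\<^sub>L D\<^sub>L v * wq T\<^sub>R D\<^sub>R u = (u - v) * mixF T\<^sub>L D\<^sub>L T\<^sub>R D\<^sub>R u v"
  by (simp add: wq_def mixF_def algebra_simps power2_eq_square)

text \<open>The partial derivatives of \<open>mixF\<close> are \<open>P * v + Q\<close> and
  \<open>P * u + Q\<close>. By the derivatives of the two ends and \<open>wq_yend\<close>, the left
  side is \<open>W\<^sub>L(u) S\<close> times the derivative of \<open>mixF\<close> along the left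
  curve. At zeros of \<open>mixF\<close> the right side is positive if the two quadratics are
  positive and \<open>T\<^sub>L < 0 < T\<^sub>R\<close>.\<close>

lemma mixF_gradient:
  assumes "P = T\<^sub>L * D\<^sub>R - D\<^sub>L * T\<^sub>R" "Q = D\<^sub>L - D\<^sub>R"
  shows "- v * (P * v + Q) * wq T\<^sub>L D\<^sub>L u - u * (P * u + Q) * wq T\<^sub>L D\<^sub>L v
    = wq T\<^sub>L D\<^sub>L u * (T\<^sub>R * wq T\<^sub>L D\<^sub>L v - T\<^sub>L * wq T\<^sub>R D\<^sub>R v)
      + mixF T\<^sub>L D\<^sub>L T\<^sub>R D\<^sub>R u v * (T\<^sub>L * u - D\<^sub>L * u * v - 1)"
  unfolding assms by (simp add: wq_def mixF_def algebra_simps power2_eq_square)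

text \<open>At the first point with \<open>\<phi> \<le> 0\<close> the function vanishes with
  positive derivative, so it is already negative shortly before.\<close>

lemma positive_if_increasing_at_zeros:
  fixes \<phi> :: "real \<Rightarrow> real"
  assumes "a \<le> b" "\<phi> a > 0"
    and deriv: "\<And>t. a \<le> t \<Longrightarrow> t \<le> b \<Longrightarrow> (\<phi> has_real_derivative \<phi>' t) (at t)"
    and zero: "\<And>t. a < t \<Longrightarrow> t \<le> b \<Longrightarrow> \<phi> t = 0 \<Longrightarrow> \<phi>' t > 0"
  shows "\<phi> b > 0"
proof (rule ccontr)
  assume "\<not> \<phi> b > 0"
  define A where "A = {t \<in> {a..b}. \<phi> t \<le> 0}"
  have cont: "continuous_on {a..b} \<phi>"
    using deriv by (intro continuous_at_imp_continuous_on ballI) (auto intro: DERIV_isCont)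
  have "compact A"
    unfolding A_def using continuous_on_closed_Collect_le[OF cont continuous_on_const]
    by (auto simp: compact_eq_bounded_closed intro: bounded_subset[OF bounded_closed_interval])
  moreover have "A \<noteq> {}" using \<open>\<not> \<phi> b > 0\<close> assms(1) by (auto simp: A_def)
  ultimately obtain s where s: "s \<in> A" "\<And>t. t \<in> A \<Longrightarrow> s \<le> t"
    using compact_attains_inf[of A] by auto
  have "a < s" using s(1) assms(2) by (cases "s = a") (auto simp: A_def)
  obtain r where r: "a \<le> r" "r \<le> s" "\<phi> r = 0"
    using IVT2'[of \<phi> s 0 a] s(1) assms(2) \<open>a < s\<close> continuous_on_subset[OF cont, of "{a..s}"]
    by (auto simp: A_def)
  then have "r \<in> A" using s(1) by (auto simp: A_def)
  then have "\<phi> s = 0" using s(2)[of r] r by auto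
  then have "\<phi>' s > 0" using zero \<open>a < s\<close> s(1) by (auto simp: A_def)
  then obtain d where d: "d > 0" "\<And>h. 0 < h \<Longrightarrow> h < d \<Longrightarrow> \<phi> (s - h) < \<phi> s"
    using DERIV_pos_inc_left[OF deriv[of s]] s(1) by (auto simp: A_def)
  define h where "h = min d (s - a) / 2"
  have h: "0 < h" "h < d" "h < s - a" using d(1) \<open>a < s\<close> by (auto simp: h_def min_def)
  then have "s - h \<in> A"
    using d(2)[of h] \<open>\<phi> s = 0\<close> s(1) by (auto simp: A_def)
  from s(2)[OF this] h(1) show False by simp
qed

text \<open>Since \<open>kerS\<close> behaves like \<open>t\<close> near 0, a numerator of higher
  order wins. This identifies the limit of the half-return curve as the origin, where its formulas
  are quotients with denominator 0.\<close>

lemma ratio_kerS_tendsto_0: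
  assumes "(g has_real_derivative 0) (at 0)" "g 0 = 0"
  shows "((\<lambda>t. g t / kerS T D t) \<longlongrightarrow> 0) (at 0)"
proof -
  have "((\<lambda>h. g h / h) \<longlongrightarrow> 0) (at 0)"
    using assms unfolding DERIV_def by simp
  moreover have "((\<lambda>h. kerS T D h / h) \<longlongrightarrow> 1) (at 0)"
    using kerS_deriv[of T D 0] unfolding DERIV_def by simp
  ultimately have "((\<lambda>h. (g h / h) / (kerS T D h / h)) \<longlongrightarrow> 0 / 1) (at 0)"
    by (rule tendsto_divide) simp
  then have lim: "((\<lambda>h. (g h / h) / (kerS T D h / h)) \<longlongrightarrow> 0) (at 0)" by simp
  show ?thesis
    by (rule Lim_transform_eventually[OF lim])
      (auto simp: eventually_at_filter intro!: always_eventually)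
qed

lemma ystart_tendsto_0: "((\<lambda>t. ystart T D t) \<longlongrightarrow> 0) (at 0)"
  unfolding ystart_def using kerC_deriv[of T D 0] by (intro ratio_kerS_tendsto_0) auto

lemma yend_tendsto_0: "((\<lambda>t. yend T D t) \<longlongrightarrow> 0) (at 0)"
proof -
  have "((\<lambda>t. kerC T D (- t)) has_real_derivative 0) (at 0)"
    using minus_arg_deriv[of "kerC T D" "kerS T D" 0, OF kerC_deriv] by simp
  then have "((\<lambda>t. kerC T D (- t) / kerS T D t) \<longlongrightarrow> 0) (at 0)"
    by (intro ratio_kerS_tendsto_0) auto
  then have "((\<lambda>t. - exp (T * t) * (kerC T D (- t) / kerS T D t)) \<longlongrightarrow> - exp (T * 0) * 0) (at 0)"
    by (intro tendsto_intros)
  then show ?thesis unfolding yend_def by simp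
qed

locale expanding_right_focus =
  fixes T\<^sub>L D\<^sub>L T\<^sub>R D\<^sub>R :: real
  assumes traces: "T\<^sub>L < 0" "0 < T\<^sub>R" and focus: "\<And>y. wq T\<^sub>R D\<^sub>R y > 0"
begin

abbreviation "Y \<equiv> ystart T\<^sub>L D\<^sub>L"
abbreviation "Z \<equiv> yend T\<^sub>L D\<^sub>L"
abbreviation "F \<equiv> mixF T\<^sub>L D\<^sub>L T\<^sub>R D\<^sub>R"

lemma mixF_pos:
  assumes t: "t \<in> early T\<^sub>L D\<^sub>L"
  shows "F (Y t) (Z t) > 0"
proof -
  define P where "P = T\<^sub>L * D\<^sub>R - D\<^sub>L * T\<^sub>R"
  define Q where "Q = D\<^sub>L - D\<^sub>R"
  have tpos: "t > 0" using t by (simp add: early_def)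
  \<comment> \<open>The comparison starts near the origin of the curve, where \<open>F\<close> tends
    to \<open>T\<^sub>R - T\<^sub>L > 0\<close>.\<close>
  have "((\<lambda>s. F (Y s) (Z s)) \<longlongrightarrow> P * 0 * 0 + Q * (0 + 0) + (T\<^sub>R - T\<^sub>L)) (at 0)"
    unfolding mixF_def P_def Q_def by (intro tendsto_intros ystart_tendsto_0 yend_tendsto_0)
  then have "\<forall>\<^sub>F s in at 0. F (Y s) (Z s) > 0"
    using traces by (elim order_tendstoD(1)) auto
  then obtain d where d: "d > 0" "\<And>s. s \<noteq> 0 \<Longrightarrow> \<bar>s\<bar> < d \<Longrightarrow> F (Y s) (Z s) > 0"
    unfolding eventually_at by (auto simp: dist_real_def)
  define a where "a = min (d / 2) t"
  have a: "0 < a" "a \<le> t" "a < d" using d tpos by (auto simp: a_def)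
  show ?thesis
  proof (rule positive_if_increasing_at_zeros[where \<phi> = "\<lambda>t. F (Y t) (Z t)", OF a(2)])
    show "F (Y a) (Z a) > 0" using d(2)[of a] a by simp
    let ?F' = "\<lambda>s. P * (Y s * (- exp (T\<^sub>L * s) * Y s / kerS T\<^sub>L D\<^sub>L s) + (- Z s / kerS T\<^sub>L D\<^sub>L s) * Z s)
        + Q * (- Z s / kerS T\<^sub>L D\<^sub>L s + (- exp (T\<^sub>L * s) * Y s / kerS T\<^sub>L D\<^sub>L s))"
    show "((\<lambda>t. F (Y t) (Z t)) has_real_derivative ?F' s) (at s)" if "a \<le> s" "s \<le> t" for s
    proof -
      have "s \<in> early T\<^sub>L D\<^sub>L" using early_downward[OF t] that a by auto
      then have S: "kerS T\<^sub>L D\<^sub>L s \<noteq> 0" using early_signs by fastforce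
      show ?thesis
        unfolding mixF_def P_def[symmetric] Q_def[symmetric]
        by (rule derivative_eq_intros ystart_deriv[OF S] yend_deriv[OF S] refl)+ (simp add: algebra_simps)
    qed
    fix s assume s: "a < s" "s \<le> t" "F (Y s) (Z s) = 0"
    then have e: "s \<in> early T\<^sub>L D\<^sub>L" using early_downward[OF t] a by auto
    note sg = early_signs[OF e]
    define S W E where "S = kerS T\<^sub>L D\<^sub>L s" and "W = wq T\<^sub>L D\<^sub>L (Y s)" and "E = exp (T\<^sub>L * s)"
    have S: "S > 0" and W: "W > 0" using sg by (auto simp: S_def W_def)
    have EW: "wq T\<^sub>L D\<^sub>L (Z s) = E * W"
      unfolding E_def W_def using wq_yend sg(1) by simp
    have "W * S * ?F' s = - Z s * (P * Z s + Q) * W - Y s * (P * Y s + Q) * (E * W)"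
      unfolding S_def[symmetric] E_def[symmetric] using S by (simp add: field_simps)
    also have "\<dots> = W * (T\<^sub>R * wq T\<^sub>L D\<^sub>L (Z s) - T\<^sub>L * wq T\<^sub>R D\<^sub>R (Z s))"
      unfolding EW[symmetric] using mixF_gradient[OF P_def Q_def, of "Z s" "Y s"] s(3) by (simp add: W_def)
    finally have "S * ?F' s = T\<^sub>R * wq T\<^sub>L D\<^sub>L (Z s) - T\<^sub>L * wq T\<^sub>R D\<^sub>R (Z s)"
      using W by (simp only: mult.assoc mult_cancel_left) auto
    also have "\<dots> > 0"
      using mult_pos_pos[OF traces(2) sg(7)] mult_neg_pos[OF traces(1) focus[of "Z s"]] by linarith
    finally show "0 < ?F' s" using S by (simp only: zero_less_mult_pos)
  qed
qed

text \<open>Along the half-return curve of the right zone, \<open>y dy / W\<^sub>R(y)\<close> takes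
  the same value at both ends of the arc, so the difference of \<open>G\<close> at the ends is
  constant there.\<close>

definition G :: "real \<Rightarrow> real" where
  "G = primitive (\<lambda>y. y / wq T\<^sub>R D\<^sub>R y)"

lemma G_deriv: "(G has_real_derivative y / wq T\<^sub>R D\<^sub>R y) (at y)"
  unfolding G_def has_real_derivative_iff_has_vector_derivative
proof (rule has_vector_derivative_primitive)
  show "continuous_on UNIV (\<lambda>y. y / wq T\<^sub>R D\<^sub>R y)"
    using focus unfolding wq_def by (intro continuous_intros) (auto simp: less_imp_neq[symmetric])
qed

text \<open>The derivative has the sign of \<open>WZ - E * WY\<close>. Multiplied by
  \<open>WL\<close>, this becomes the left side of \<open>wq_cross_diff\<close>, since
  \<open>E * WL\<close> is the left quadratic at the other end.\<close>

lemma G_diff_strict_mono_left: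
  assumes "s \<in> early T\<^sub>L D\<^sub>L" "t \<in> early T\<^sub>L D\<^sub>L" "s < t"
  shows "G (Y s) - G (Z s) < G (Y t) - G (Z t)"
proof (rule DERIV_pos_imp_increasing[OF assms(3), of "\<lambda>t. G (Y t) - G (Z t)"])
  fix r assume "s \<le> r" "r \<le> t"
  then have e: "r \<in> early T\<^sub>L D\<^sub>L" using early_convex assms by blast
  note sg = early_signs[OF e]
  define S WL E where "S = kerS T\<^sub>L D\<^sub>L r" and "WL = wq T\<^sub>L D\<^sub>L (Y r)" and "E = exp (T\<^sub>L * r)"
  define WY WZ where "WY = wq T\<^sub>R D\<^sub>R (Y r)" and "WZ = wq T\<^sub>R D\<^sub>R (Z r)"
  have pos: "S > 0" "WL > 0" "WY > 0" "WZ > 0" using sg focus by (auto simp: S_def WL_def WY_def WZ_def)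
  have S0: "kerS T\<^sub>L D\<^sub>L r \<noteq> 0" using sg(1) by simp
  have EW: "wq T\<^sub>L D\<^sub>L (Z r) = E * WL"
    unfolding E_def WL_def using wq_yend sg(1) by simp
  have D: "((\<lambda>t. G (Y t) - G (Z t)) has_real_derivative
      Y r / WY * (- Z r / S) - Z r / WZ * (- E * Y r / S)) (at r)"
    unfolding WY_def WZ_def S_def E_def
    by (intro DERIV_diff DERIV_chain2[OF G_deriv] ystart_deriv yend_deriv S0)
  have "WL * WZ - E * WL * WY = (Y r - Z r) * F (Y r) (Z r)"
    using wq_cross_diff[of T\<^sub>L D\<^sub>L "Y r" T\<^sub>R D\<^sub>R "Z r"] unfolding EW WL_def WY_def WZ_def .
  also have "\<dots> > 0"
    using mixF_pos[OF e] sg by (intro mult_pos_pos) auto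
  finally have "0 < WL * (WZ - E * WY)" by (simp add: algebra_simps)
  then have less: "E * WY < WZ" using pos(2) by (simp add: zero_less_mult_iff)
  have "Y r / WY * (- Z r / S) - Z r / WZ * (- E * Y r / S) = Y r * (- Z r) * (WZ - E * WY) / (WY * WZ * S)"
    using pos by (simp add: field_simps)
  also have "\<dots> > 0"
    using less pos sg by (intro divide_pos_pos mult_pos_pos) auto
  finally show "\<exists>y. ((\<lambda>t. G (Y t) - G (Z t)) has_real_derivative y) (at r) \<and> 0 < y"
    using D by blast
qed

lemma G_diff_const_right:
  assumes "s \<in> late T\<^sub>R D\<^sub>R" "t \<in> late T\<^sub>R D\<^sub>R" "s < t"
  shows "G (yend T\<^sub>R D\<^sub>R s) - G (ystart T\<^sub>R D\<^sub>R s) = G (yend T\<^sub>R D\<^sub>R t) - G (ystart T\<^sub>R D\<^sub>R t)"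
proof -
  have D: "((\<lambda>t. G (yend T\<^sub>R D\<^sub>R t) - G (ystart T\<^sub>R D\<^sub>R t)) has_real_derivative 0) (at r)"
    if "s \<le> r" "r \<le> t" for r
  proof -
    have "r \<in> late T\<^sub>R D\<^sub>R" using late_convex assms that by blast
    then have S: "kerS T\<^sub>R D\<^sub>R r \<noteq> 0" using kerS_neg_late by fastforce
    define V U E W where "V = ystart T\<^sub>R D\<^sub>R r" and "U = yend T\<^sub>R D\<^sub>R r" and "E = exp (T\<^sub>R * r)"
      and "W = wq T\<^sub>R D\<^sub>R (ystart T\<^sub>R D\<^sub>R r)"
    have W: "W > 0" using focus by (simp add: W_def)
    have "((\<lambda>t. G (yend T\<^sub>R D\<^sub>R t) - G (ystart T\<^sub>R D\<^sub>R t)) has_real_derivative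
      U / (E * W) * (- E * V / kerS T\<^sub>R D\<^sub>R r) - V / W * (- U / kerS T\<^sub>R D\<^sub>R r)) (at r)"
      unfolding U_def V_def E_def W_def wq_yend[OF S, symmetric]
      by (intro DERIV_diff DERIV_chain2[OF G_deriv] ystart_deriv yend_deriv S)
    moreover have "U / (E * W) * (- E * V / kerS T\<^sub>R D\<^sub>R r) - V / W * (- U / kerS T\<^sub>R D\<^sub>R r) = 0"
      using W S by (simp add: E_def field_simps)
    ultimately show ?thesis by simp
  qed
  show ?thesis
    by (rule DERIV_isconst_end[OF assms(3), of "\<lambda>t. G (yend T\<^sub>R D\<^sub>R t) - G (ystart T\<^sub>R D\<^sub>R t)", symmetric])
      (use D in \<open>auto intro!: continuous_at_imp_continuous_on DERIV_isCont\<close>)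
qed

text \<open>The right arc runs from \<open>Z l\<close> to \<open>Y l\<close>, opposite to the left
  one. So the two products in \<open>wq_cross_diff\<close> have the ratio
  \<open>exp (T\<^sub>L * l + T\<^sub>R * r)\<close>, and the sign of \<open>F\<close> compares it
  with 1.\<close>

lemma exponent_negative:
  assumes L: "l \<in> early T\<^sub>L D\<^sub>L" and R: "r \<in> late T\<^sub>R D\<^sub>R"
    and match: "Y l = yend T\<^sub>R D\<^sub>R r" "Z l = ystart T\<^sub>R D\<^sub>R r"
  shows "T\<^sub>L * l + T\<^sub>R * r < 0"
proof -
  note sg = early_signs[OF L]
  have S: "kerS T\<^sub>R D\<^sub>R r \<noteq> 0" using kerS_neg_late[OF R] by simp
  have "(Y l - Z l) * F (Y l) (Z l) > 0"
    using mixF_pos[OF L] sg by (intro mult_pos_pos) auto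
  then have "wq T\<^sub>L D\<^sub>L (Z l) * wq T\<^sub>R D\<^sub>R (Y l) < wq T\<^sub>L D\<^sub>L (Y l) * wq T\<^sub>R D\<^sub>R (Z l)"
    unfolding wq_cross_diff[symmetric] by simp
  moreover have "wq T\<^sub>L D\<^sub>L (Z l) = exp (T\<^sub>L * l) * wq T\<^sub>L D\<^sub>L (Y l)"
    using wq_yend sg(1) by simp
  moreover have "wq T\<^sub>R D\<^sub>R (Y l) = exp (T\<^sub>R * r) * wq T\<^sub>R D\<^sub>R (Z l)"
    unfolding match by (rule wq_yend[OF S])
  ultimately have "exp (T\<^sub>L * l + T\<^sub>R * r) * (wq T\<^sub>L D\<^sub>L (Y l) * wq T\<^sub>R D\<^sub>R (Z l))
      < 1 * (wq T\<^sub>L D\<^sub>L (Y l) * wq T\<^sub>R D\<^sub>R (Z l))"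
    by (simp add: exp_add mult_ac)
  moreover have "wq T\<^sub>L D\<^sub>L (Y l) * wq T\<^sub>R D\<^sub>R (Z l) > 0"
    using sg focus by simp
  ultimately have "exp (T\<^sub>L * l + T\<^sub>R * r) < 1" by (simp only: mult_less_cancel_right_pos)
  then show ?thesis by simp
qed

lemma match_unique:
  assumes L: "l \<in> early T\<^sub>L D\<^sub>L" "l' \<in> early T\<^sub>L D\<^sub>L" and R: "r \<in> late T\<^sub>R D\<^sub>R" "r' \<in> late T\<^sub>R D\<^sub>R"
    and match: "Y l = yend T\<^sub>R D\<^sub>R r" "Z l = ystart T\<^sub>R D\<^sub>R r"
      "Y l' = yend T\<^sub>R D\<^sub>R r'" "Z l' = ystart T\<^sub>R D\<^sub>R r'"
  shows "l = l'"
proof -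
  have "G (Y l) - G (Z l) = G (Y l') - G (Z l')"
    unfolding match
  proof (cases r r' rule: linorder_cases)
    case less
    then show "G (yend T\<^sub>R D\<^sub>R r) - G (ystart T\<^sub>R D\<^sub>R r) = G (yend T\<^sub>R D\<^sub>R r') - G (ystart T\<^sub>R D\<^sub>R r')"
      by (rule G_diff_const_right[OF R])
  next
    case greater
    then show "G (yend T\<^sub>R D\<^sub>R r) - G (ystart T\<^sub>R D\<^sub>R r) = G (yend T\<^sub>R D\<^sub>R r') - G (ystart T\<^sub>R D\<^sub>R r')"
      by (rule G_diff_const_right[OF R(2,1), symmetric])
  qed simp
  moreover have "\<not> l < l'" "\<not> l' < l"
    using G_diff_strict_mono_left[OF L] G_diff_strict_mono_left[OF L(2,1)] calculation by linarith+
  ultimately show ?thesis by linarith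
qed

end

section \<open>Arcs of the canonical form\<close>

locale affine_arc =
  fixes T D a :: real and x y :: "real \<Rightarrow> real" and t0 t1 :: real
  assumes order: "t0 < t1"
    and x_deriv: "\<And>s. t0 \<le> s \<Longrightarrow> s \<le> t1 \<Longrightarrow> (x has_real_derivative T * x s - y s) (at s)"
    and y_deriv: "\<And>s. t0 \<le> s \<Longrightarrow> s \<le> t1 \<Longrightarrow> (y has_real_derivative D * x s - a) (at s)"
    and start: "x t0 = 0"
begin

text \<open>The equations hold on the arc only, so uniqueness of global solutions does not apply.
  The errors \<open>e1\<close>, \<open>e2\<close> of the formulas solve the homogeneous system with
  zero initial values, and a Gronwall estimate shows that they vanish.\<close>

lemma explicit:
  assumes "t0 \<le> s" "s \<le> t1"
  shows "x s = a * kerC T D (s - t0) - y t0 * kerS T D (s - t0)"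
    and "y s = T * x s - (a * kerS T D (s - t0) - y t0 * kerS' T D (s - t0))"
proof -
  define X where "X s = a * kerC T D (s - t0) - y t0 * kerS T D (s - t0)" for s
  define X' where "X' s = a * kerS T D (s - t0) - y t0 * kerS' T D (s - t0)" for s
  define e1 where "e1 s = x s - X s" for s
  define e2 where "e2 s = y s - (T * X s - X' s)" for s
  \<comment> \<open>In the derivative of \<open>e1\<^sup>2 + e2\<^sup>2\<close> the square
    contributes \<open>2 * T\<close> and the mixed term \<open>2 * (D - 1) * e1 * e2\<close>, which
    is at most \<open>\<bar>D - 1\<bar>\<close> times the sum of squares.\<close>
  define k where "k = 2 * \<bar>T\<bar> + \<bar>D - 1\<bar>"
  define N where "N s = exp (- k * s) * ((e1 s)\<^sup>2 + (e2 s)\<^sup>2)" for s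
  have shift: "((\<lambda>s. g (s - t0)) has_real_derivative d) (at s)"
    if "(g has_real_derivative d) (at (s - t0))" for g d s
    using DERIV_shift[of g d s "- t0"] that by simp
  have Xd: "(X has_real_derivative X' s) (at s)" for s
    unfolding X_def[abs_def] X'_def
    by (intro DERIV_diff DERIV_cmult shift kerC_deriv kerS_deriv)
  have X'd: "(X' has_real_derivative a + T * X' s - D * X s) (at s)" for s
  proof -
    have "(X' has_real_derivative a * kerS' T D (s - t0) - y t0 * (T * kerS' T D (s - t0) - D * kerS T D (s - t0))) (at s)"
      unfolding X'_def[abs_def] by (intro DERIV_diff DERIV_cmult shift kerS'_deriv kerS_deriv)
    moreover have "a * kerS' T D (s - t0) - y t0 * (T * kerS' T D (s - t0) - D * kerS T D (s - t0)) = a + T * X' s - D * X s"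
      unfolding X_def X'_def by (subst (1) kerS'_eq) (simp add: algebra_simps)
    ultimately show ?thesis by simp
  qed
  have "N s \<le> N t0"
  proof (rule DERIV_nonpos_imp_nonincreasing[OF assms(1)])
    fix r assume "t0 \<le> r" "r \<le> s"
    then have r: "t0 \<le> r" "r \<le> t1" using assms by auto
    have e1d: "(e1 has_real_derivative T * e1 r - e2 r) (at r)"
    proof -
      have "(e1 has_real_derivative (T * x r - y r) - X' r) (at r)"
        unfolding e1_def[abs_def] by (intro DERIV_diff x_deriv r Xd)
      then show ?thesis by (simp add: e1_def e2_def algebra_simps)
    qed
    have e2d: "(e2 has_real_derivative D * e1 r) (at r)"
    proof -
      have "(e2 has_real_derivative (D * x r - a) - (T * X' r - (a + T * X' r - D * X r))) (at r)"
        unfolding e2_def[abs_def] by (intro DERIV_diff DERIV_cmult y_deriv r Xd X'd)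
      then show ?thesis by (simp add: e1_def algebra_simps)
    qed
    have "(N has_real_derivative exp (- k * r) * (2 * e1 r * (T * e1 r - e2 r) + 2 * e2 r * (D * e1 r))
        - k * exp (- k * r) * ((e1 r)\<^sup>2 + (e2 r)\<^sup>2)) (at r)"
      unfolding N_def[abs_def] by (rule derivative_eq_intros e1d e2d refl)+ (simp add: algebra_simps)
    moreover have "2 * e1 r * (T * e1 r - e2 r) + 2 * e2 r * (D * e1 r) \<le> k * ((e1 r)\<^sup>2 + (e2 r)\<^sup>2)"
    proof -
      have "T * (e1 r)\<^sup>2 \<le> \<bar>T\<bar> * (e1 r)\<^sup>2" by (intro mult_right_mono) auto
      moreover have "\<bar>T\<bar> * (e1 r)\<^sup>2 \<le> \<bar>T\<bar> * ((e1 r)\<^sup>2 + (e2 r)\<^sup>2)" by (intro mult_left_mono) auto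
      moreover have "2 * (e1 r * e2 r) \<le> (e1 r)\<^sup>2 + (e2 r)\<^sup>2" "- (2 * (e1 r * e2 r)) \<le> (e1 r)\<^sup>2 + (e2 r)\<^sup>2"
        using sum_squares_ge_zero[of "e1 r - e2 r" 0] sum_squares_ge_zero[of "e1 r + e2 r" 0]
        by (auto simp: power2_eq_square algebra_simps)
      then have "\<bar>2 * (e1 r * e2 r)\<bar> \<le> (e1 r)\<^sup>2 + (e2 r)\<^sup>2" by linarith
      then have "\<bar>D - 1\<bar> * \<bar>2 * (e1 r * e2 r)\<bar> \<le> \<bar>D - 1\<bar> * ((e1 r)\<^sup>2 + (e2 r)\<^sup>2)"
        by (intro mult_left_mono) auto
      then have "(D - 1) * (2 * (e1 r * e2 r)) \<le> \<bar>D - 1\<bar> * ((e1 r)\<^sup>2 + (e2 r)\<^sup>2)"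
        unfolding abs_mult[symmetric] by linarith
      moreover have "2 * e1 r * (T * e1 r - e2 r) + 2 * e2 r * (D * e1 r)
          = 2 * (T * (e1 r)\<^sup>2) + (D - 1) * (2 * (e1 r * e2 r))"
        by (simp add: power2_eq_square algebra_simps)
      moreover have "k * ((e1 r)\<^sup>2 + (e2 r)\<^sup>2) = 2 * (\<bar>T\<bar> * ((e1 r)\<^sup>2 + (e2 r)\<^sup>2)) + \<bar>D - 1\<bar> * ((e1 r)\<^sup>2 + (e2 r)\<^sup>2)"
        by (simp add: k_def algebra_simps)
      ultimately show ?thesis by linarith
    qed
    then have "exp (- k * r) * (2 * e1 r * (T * e1 r - e2 r) + 2 * e2 r * (D * e1 r))
        \<le> exp (- k * r) * (k * ((e1 r)\<^sup>2 + (e2 r)\<^sup>2))" by (intro mult_left_mono) auto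
    ultimately show "\<exists>d. (N has_real_derivative d) (at r) \<and> d \<le> 0"
      by (intro exI conjI) (auto simp: mult_ac)
  qed
  moreover have "e1 t0 = 0" "e2 t0 = 0"
    using start by (auto simp: e1_def e2_def X_def X'_def)
  ultimately have "N s \<le> 0" by (simp add: N_def)
  then have "(e1 s)\<^sup>2 + (e2 s)\<^sup>2 \<le> 0" by (simp add: N_def mult_le_0_iff)
  then have e: "e1 s = 0" "e2 s = 0" using sum_power2_le_zero_iff by blast+
  then show "x s = a * kerC T D (s - t0) - y t0 * kerS T D (s - t0)" by (simp add: e1_def X_def)
  from e show "y s = T * x s - (a * kerS T D (s - t0) - y t0 * kerS' T D (s - t0))"
    by (simp add: e1_def e2_def X'_def)
qed

lemma ends_eq:
  assumes "x t1 = 0" "kerS T D (t1 - t0) \<noteq> 0"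
  shows "y t0 = a * ystart T D (t1 - t0)" "y t1 = a * yend T D (t1 - t0)"
proof -
  define S C S' where "S = kerS T D (t1 - t0)" and "C = kerC T D (t1 - t0)" and "S' = kerS' T D (t1 - t0)"
  have S: "S \<noteq> 0" using assms by (simp add: S_def)
  have "a * C = y t0 * S" using explicit(1)[of t1] order assms(1) by (simp add: S_def C_def)
  then show y0: "y t0 = a * ystart T D (t1 - t0)"
    using S by (simp add: ystart_def S_def[symmetric] C_def[symmetric] field_simps)
  have "y t1 = - (a * S - y t0 * S')"
    using explicit(2)[of t1] order assms(1) by (simp add: S_def S'_def)
  also have "\<dots> = - (a * (S\<^sup>2 - C * S') / S)"
    unfolding y0 using S by (simp add: ystart_def S_def[symmetric] C_def[symmetric] field_simps power2_eq_square)
  also have "S\<^sup>2 - C * S' = exp (T * (t1 - t0)) * kerC T D (- (t1 - t0))"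
    using kerK_eq[of T D "t1 - t0"] unfolding S'_def kerS'_eq kerK_def C_def[symmetric] S_def[symmetric]
    by (simp add: algebra_simps power2_eq_square)
  finally show "y t1 = a * yend T D (t1 - t0)" by (simp add: yend_def S_def)
qed

definition H :: "real \<Rightarrow> real" where
  "H s = (T * x s - y s)\<^sup>2 / 2 + D * (x s)\<^sup>2 / 2 - a * x s"

lemma H_deriv:
  assumes "t0 \<le> s" "s \<le> t1"
  shows "(H has_real_derivative T * (T * x s - y s)\<^sup>2) (at s)"
proof -
  note d = x_deriv[OF assms] y_deriv[OF assms]
  let ?v = "T * x s - y s"
  have v: "((\<lambda>s. T * x s - y s) has_real_derivative T * ?v - (D * x s - a)) (at s)"
    by (intro DERIV_diff DERIV_cmult d)
  show ?thesis
    unfolding H_def[abs_def]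
    by (rule DERIV_cong[OF DERIV_diff[OF DERIV_add[OF DERIV_cdivide[OF DERIV_power[OF v, of 2], of 2]
        DERIV_cdivide[OF DERIV_cmult[OF DERIV_power[OF d(1), of 2], of D], of 2]] DERIV_cmult[OF d(1), of a]]])
      (simp add: field_simps power2_eq_square)
qed

lemma energy_mono:
  assumes "T \<ge> 0" "t0 \<le> r" "r \<le> s" "s \<le> t1"
  shows "H r \<le> H s"
proof (rule DERIV_nonneg_imp_nondecreasing[OF assms(3)])
  show "\<exists>d. (H has_real_derivative d) (at q) \<and> 0 \<le> d" if "r \<le> q" "q \<le> s" for q
    using H_deriv[of q] that assms by (intro exI[of _ "T * (T * x q - y q)\<^sup>2"]) auto
qed

text \<open>On \<open>x = 0\<close> the energy is \<open>y\<^sup>2 / 2\<close>. Strictness comes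
  from the start of the arc, where \<open>x' = - y t0\<close> is nonzero and the energy grows at
  once.\<close>

lemma energy_ends:
  assumes "x t1 = 0"
  shows "T \<ge> 0 \<Longrightarrow> (y t0)\<^sup>2 \<le> (y t1)\<^sup>2" "T > 0 \<Longrightarrow> y t0 \<noteq> 0 \<Longrightarrow> (y t0)\<^sup>2 < (y t1)\<^sup>2"
    "T = 0 \<Longrightarrow> (y t1)\<^sup>2 = (y t0)\<^sup>2"
proof -
  have H: "H t0 = (y t0)\<^sup>2 / 2" "H t1 = (y t1)\<^sup>2 / 2"
    using assms start by (auto simp: H_def)
  show ge: "T \<ge> 0 \<Longrightarrow> (y t0)\<^sup>2 \<le> (y t1)\<^sup>2"
    using energy_mono[of t0 t1] H order by simp
  show "(y t0)\<^sup>2 < (y t1)\<^sup>2" if "T > 0" "y t0 \<noteq> 0"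
  proof -
    have "T * (T * x t0 - y t0)\<^sup>2 > 0" using that start by simp
    from DERIV_pos_inc_right[OF H_deriv this] order obtain d where
      d: "d > 0" "\<And>h. 0 < h \<Longrightarrow> h < d \<Longrightarrow> H t0 < H (t0 + h)" by auto
    define h where "h = min d (t1 - t0) / 2"
    have h: "0 < h" "h < d" "t0 + h \<le> t1" using d order by (auto simp: h_def min_def field_simps)
    have "H t0 < H (t0 + h)" by (rule d(2)[OF h(1,2)])
    also have "\<dots> \<le> H t1" using h that by (intro energy_mono) auto
    finally show ?thesis using H by simp
  qed
  show "(y t1)\<^sup>2 = (y t0)\<^sup>2" if "T = 0"
  proof -
    have "H t1 = H t0"
    proof (rule DERIV_isconst_end[OF order])
      show "continuous_on {t0..t1} H"
        by (intro continuous_at_imp_continuous_on ballI DERIV_isCont[OF H_deriv]) auto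
      show "(H has_real_derivative 0) (at s)" if "t0 < s" "s < t1" for s
        using H_deriv[of s] that \<open>T = 0\<close> by simp
    qed
    then show ?thesis using H by simp
  qed
qed

text \<open>At the first zero of \<open>kerS\<close> the starting height drops out of
  \<open>explicit\<close>, leaving \<open>x = a C > 0\<close>, so the orbit has already left the
  left half plane.\<close>

lemma left_arc_early:
  assumes "a > 0" "\<And>s. t0 \<le> s \<Longrightarrow> s \<le> t1 \<Longrightarrow> x s \<le> 0"
  shows "t1 - t0 \<in> early T D"
proof (rule ccontr)
  assume "t1 - t0 \<notin> early T D"
  then have d: "disc T D < 0" "pi \<le> sqrt (- disc T D) * (t1 - t0)"
    using order by (auto simp: early_def not_less)
  define w where "w = sqrt (- disc T D)"
  have w: "w > 0" using d by (simp add: w_def)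
  define s where "s = pi / w"
  have s: "0 < s" "s \<le> t1 - t0" using d w by (auto simp: s_def w_def[symmetric] field_simps)
  have "r \<in> early T D" if "0 < r" "r < s" for r
    using that w d by (auto simp: early_def s_def w_def[symmetric] field_simps)
  then have "kerC T D s > 0" using kerC_pos(1) s(1) by blast
  moreover have "kerS T D s = 0"
    using d w by (simp add: kerS_def sn_def w_def[symmetric] s_def)
  ultimately have "x (t0 + s) > 0"
    using explicit(1)[of "t0 + s"] s assms(1) by simp
  then show False using assms(2)[of "t0 + s"] s by simp
qed

text \<open>An early time would give \<open>y t0 > 0\<close>, and at the first zero of
  \<open>kerS\<close> one has \<open>x = a C > 0\<close> instead of 0. At the second zero,
  \<open>S' = exp (T * s / 2) > 1\<close> forces \<open>D C < 0\<close>, hence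
  \<open>x = a C < 0\<close>; the arc must end before.\<close>

lemma right_arc_late:
  assumes "a > 0" "T > 0" "y t0 < 0" "x t1 = 0" "\<And>s. t0 \<le> s \<Longrightarrow> s \<le> t1 \<Longrightarrow> x s \<ge> 0"
  shows "t1 - t0 \<in> late T D"
proof -
  have n: "t1 - t0 \<notin> early T D"
  proof
    assume e: "t1 - t0 \<in> early T D"
    then have "y t0 = a * ystart T D (t1 - t0)"
      using ends_eq(1)[OF assms(4)] early_signs(1) by fastforce
    then show False using early_signs(4)[OF e] assms by (simp add: mult_less_0_iff)
  qed
  then have d: "disc T D < 0" "pi \<le> sqrt (- disc T D) * (t1 - t0)"
    using order by (auto simp: early_def not_less)
  define w where "w = sqrt (- disc T D)"
  have w: "w > 0" using d by (simp add: w_def)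
  have "w * (t1 - t0) \<noteq> pi"
  proof
    assume eq: "w * (t1 - t0) = pi"
    have "r \<in> early T D" if "0 < r" "r < t1 - t0" for r
      using mult_strict_left_mono[OF that(2) w] that eq by (auto simp: early_def w_def[symmetric])
    then have "kerC T D (t1 - t0) > 0" using kerC_pos(1) order by simp
    moreover have "kerS T D (t1 - t0) = 0"
      using d eq by (simp add: kerS_def sn_def w_def[symmetric])
    ultimately show False using explicit(1)[of t1] order assms by simp
  qed
  moreover have "w * (t1 - t0) < 2 * pi"
  proof (rule ccontr)
    assume "\<not> w * (t1 - t0) < 2 * pi"
    define s where "s = 2 * pi / w"
    have s: "0 < s" "s \<le> t1 - t0" using \<open>\<not> w * (t1 - t0) < 2 * pi\<close> w by (auto simp: s_def field_simps)
    have ws: "w * s = 2 * pi" using w by (simp add: s_def)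
    have S: "kerS T D s = 0" using d ws by (simp add: kerS_def sn_def w_def[symmetric])
    have S': "kerS' T D s = exp (T * s / 2)"
      using d ws by (simp add: kerS'_def sn_def cs_def w_def[symmetric])
    have "exp (T * s / 2) > 1" using assms s by simp
    moreover have "exp (T * s / 2) = 1 - D * kerC T D s" using kerS'_eq[of T D s] S S' by simp
    ultimately have "D * kerC T D s < 0" by linarith
    moreover have "D > 0" using d unfolding disc_def using zero_le_power2[of T] by linarith
    ultimately have "kerC T D s < 0" by (simp add: mult_less_0_iff)
    then have "x (t0 + s) < 0"
      using explicit(1)[of "t0 + s"] s S assms(1) by (simp add: mult_pos_neg)
    then show False using assms(5)[of "t0 + s"] s by simp
  qed
  ultimately show ?thesis using d by (simp add: late_def w_def)
qed

end

section \<open>Two-zone periodic orbits of the canonical form\<close>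

text \<open>The compact set of candidates starts at \<open>t + d / 2\<close>, because
  \<open>t\<close> may be a zero itself.\<close>

lemma next_zero:
  fixes \<phi> :: "real \<Rightarrow> real"
  assumes cont: "continuous_on UNIV \<phi>" and neg: "d > 0" "\<And>h. 0 < h \<Longrightarrow> h < d \<Longrightarrow> \<phi> (t + h) < 0"
    and later: "s > t" "\<phi> s \<ge> 0"
  obtains t1 where "t1 > t" "\<phi> t1 = 0" "\<And>r. t < r \<Longrightarrow> r < t1 \<Longrightarrow> \<phi> r < 0"
proof -
  define B where "B = {t + d / 2..s} \<inter> {r. 0 \<le> \<phi> r}"
  have ds: "t + d \<le> s" using neg(2)[of "s - t"] later by (cases "s < t + d") auto
  have "closed {r. 0 \<le> \<phi> r}" by (intro closed_Collect_le continuous_on_const cont)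
  then have "compact B" unfolding B_def by (intro compact_Int_closed) auto
  moreover have "s \<in> B" using ds neg(1) later by (auto simp: B_def)
  ultimately obtain t1 where t1: "t1 \<in> B" "\<And>r. r \<in> B \<Longrightarrow> t1 \<le> r"
    using compact_attains_inf[of B] by blast
  have negr: "\<phi> r < 0" if "t < r" "r < t1" for r
  proof (cases "r < t + d")
    case True
    then show ?thesis using neg(2)[of "r - t"] that by simp
  next
    case False
    then show ?thesis using t1(2)[of r] that t1(1) neg(1) by (force simp: B_def not_le)
  qed
  have tt: "t < t + d / 2" "t + d / 2 \<le> t1" using neg(1) t1(1) by (auto simp: B_def)
  obtain r where r: "t + d / 2 \<le> r" "r \<le> t1" "\<phi> r = 0"
    using IVT'[of \<phi> "t + d / 2" 0 t1] tt t1(1) neg(2)[of "d / 2"] neg(1) continuous_on_subset[OF cont]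
    by (force simp: B_def)
  then have "r = t1" using t1(2)[of r] t1(1) by (auto simp: B_def)
  then show thesis using r tt negr by (intro that[of t1]) auto
qed

lemma previous_zero:
  fixes \<phi> :: "real \<Rightarrow> real"
  assumes cont: "continuous_on UNIV \<phi>" and neg: "d > 0" "\<And>h. 0 < h \<Longrightarrow> h < d \<Longrightarrow> \<phi> (t - h) < 0"
    and earlier: "s < t" "\<phi> s \<ge> 0"
  obtains t1 where "t1 < t" "\<phi> t1 = 0" "\<And>r. t1 < r \<Longrightarrow> r < t \<Longrightarrow> \<phi> r < 0"
proof -
  have c: "continuous_on UNIV (\<lambda>r. \<phi> (- r))"
    by (intro continuous_on_compose2[OF cont] continuous_intros) auto
  have n: "\<phi> (- (- t + h)) < 0" if "0 < h" "h < d" for h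
    using neg(2)[OF that] by simp
  obtain u where u: "u > - t" "\<phi> (- u) = 0" "\<And>r. - t < r \<Longrightarrow> r < u \<Longrightarrow> \<phi> (- r) < 0"
    by (rule next_zero[OF c neg(1) n, of "- s"]) (use earlier in auto)
  show thesis using u(3)[of "- _"] u(1,2) by (intro that[of "- u"]) (auto simp: minus_less_iff less_minus_iff)
qed

definition canonical_solution ::
  "real \<Rightarrow> real \<Rightarrow> real \<Rightarrow> real \<Rightarrow> real \<Rightarrow> (real \<Rightarrow> real) \<Rightarrow> (real \<Rightarrow> real) \<Rightarrow> bool" where
  "canonical_solution T\<^sub>L D\<^sub>L T\<^sub>R D\<^sub>R a x y \<longleftrightarrow>
     (\<forall>t. (x has_real_derivative (if x t \<le> 0 then T\<^sub>L else T\<^sub>R) * x t - y t) (at t) \<and>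
          (y has_real_derivative (if x t \<le> 0 then D\<^sub>L else D\<^sub>R) * x t - a) (at t))"

text \<open>The middle condition is uniqueness of solutions, stated for this one orbit: a repeated
  state repeats the whole motion. In this form it passes to reversed and reflected orbits without
  reference to a vector field.\<close>

definition two_zone_periodic :: "(real \<Rightarrow> real) \<Rightarrow> (real \<Rightarrow> real) \<Rightarrow> bool" where
  "two_zone_periodic x y \<longleftrightarrow>
     (\<exists>P>0. \<forall>t. x (t + P) = x t \<and> y (t + P) = y t) \<and>
     (\<forall>s t. x s = x t \<and> y s = y t \<longrightarrow> (\<forall>r. x (r + s) = x (r + t) \<and> y (r + s) = y (r + t))) \<and>
     (\<exists>t. x t < 0) \<and> (\<exists>t. x t > 0)"

definition two_arcs :: "(real \<Rightarrow> real) \<Rightarrow> (real \<Rightarrow> real) \<Rightarrow> real \<Rightarrow> real \<Rightarrow> real \<Rightarrow> bool" where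
  "two_arcs x y t0 t1 t2 \<longleftrightarrow> t0 < t1 \<and> t1 < t2 \<and> x t0 = 0 \<and> x t1 = 0 \<and> x t2 = 0 \<and> y t2 = y t0 \<and> y t0 > 0 \<and> y t1 < 0 \<and>
     (\<forall>t. t0 < t \<and> t < t1 \<longrightarrow> x t < 0) \<and> (\<forall>t. t1 < t \<and> t < t2 \<longrightarrow> x t > 0)"

section \<open>Crossings of the switching line for \<open>a > 0\<close>\<close>

locale canonical_orbit =
  fixes T\<^sub>L D\<^sub>L T\<^sub>R D\<^sub>R a :: real and x y :: "real \<Rightarrow> real"
  assumes sol: "canonical_solution T\<^sub>L D\<^sub>L T\<^sub>R D\<^sub>R a x y" and two_zone: "two_zone_periodic x y"
    and a_pos: "a > 0"
begin

lemma x_deriv: "(x has_real_derivative (if x t \<le> 0 then T\<^sub>L else T\<^sub>R) * x t - y t) (at t)"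
  and y_deriv: "(y has_real_derivative (if x t \<le> 0 then D\<^sub>L else D\<^sub>R) * x t - a) (at t)"
  using sol by (auto simp: canonical_solution_def)

lemma cont_x: "continuous_on S x" and cont_y: "continuous_on S y"
  using x_deriv y_deriv by (meson DERIV_isCont continuous_at_imp_continuous_on)+

lemma deterministic: "x s = x t \<Longrightarrow> y s = y t \<Longrightarrow> x (r + s) = x (r + t)"
  "x s = x t \<Longrightarrow> y s = y t \<Longrightarrow> y (r + s) = y (r + t)"
  using two_zone unfolding two_zone_periodic_def by blast+

lemma x_deriv_zero: "x t = 0 \<Longrightarrow> (x has_real_derivative - y t) (at t)"
  using x_deriv[of t] by simp

lemma recurs:
  obtains s1 s2 where "s1 < t" "t < s2" "x s1 = x r" "x s2 = x r"
proof -
  obtain P where P: "P > 0" "\<And>t. x (t + P) = x t"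
    using two_zone unfolding two_zone_periodic_def by blast
  obtain s2 where "t + P \<le> s2" "x s2 = x r" using periodic_representative[where x = x, OF P(2,1)] by blast
  moreover obtain s1 where "s1 < t - P + P" "x s1 = x r"
    using periodic_representative[where x = x, OF P(2,1), of "t - P" r] by blast
  ultimately show thesis using P(1) by (intro that[of s1 s2]) auto
qed

lemma neg_later: "\<exists>s>t. x s < 0"
  and neg_earlier: "\<exists>s<t. x s < 0"
  and pos_later: "\<exists>s>t. x s > 0"
  and pos_earlier: "\<exists>s<t. x s > 0"
proof -
  obtain n p where "x n < 0" "x p > 0" using two_zone unfolding two_zone_periodic_def by blast
  then show "\<exists>s>t. x s < 0" "\<exists>s<t. x s < 0" "\<exists>s>t. x s > 0" "\<exists>s<t. x s > 0"
    by (metis recurs)+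
qed

lemma y_end_of_right: "x t = 0 \<Longrightarrow> s < t \<Longrightarrow> (\<And>r. s < r \<Longrightarrow> r < t \<Longrightarrow> x r > 0) \<Longrightarrow> y t \<ge> 0"
proof (rule ccontr)
  assume *: "x t = 0" "s < t" "\<And>r. s < r \<Longrightarrow> r < t \<Longrightarrow> x r > 0" "\<not> y t \<ge> 0"
  obtain d where d: "d > 0" "\<And>h. 0 < h \<Longrightarrow> h < d \<Longrightarrow> x (t - h) < x t"
    using DERIV_pos_inc_left[OF x_deriv_zero[OF *(1)]] *(4) by auto
  define h where "h = min d (t - s) / 2"
  have "0 < h" "h < d" "h < t - s" using d *(2) by (auto simp: h_def min_def)
  then show False using d(2)[of h] *(3)[of "t - h"] *(1) by simp
qed

lemma y_start_of_right: "x s = 0 \<Longrightarrow> s < t \<Longrightarrow> (\<And>r. s < r \<Longrightarrow> r < t \<Longrightarrow> x r > 0) \<Longrightarrow> y s \<le> 0"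
proof (rule ccontr)
  assume *: "x s = 0" "s < t" "\<And>r. s < r \<Longrightarrow> r < t \<Longrightarrow> x r > 0" "\<not> y s \<le> 0"
  obtain d where d: "d > 0" "\<And>h. 0 < h \<Longrightarrow> h < d \<Longrightarrow> x s > x (s + h)"
    using DERIV_neg_dec_right[OF x_deriv_zero[OF *(1)]] *(4) by auto
  define h where "h = min d (t - s) / 2"
  have "0 < h" "h < d" "h < t - s" using d *(2) by (auto simp: h_def min_def)
  then show False using d(2)[of h] *(3)[of "s + h"] *(1) by simp
qed

lemma left_arc:
  assumes "t0 < t1" "x t0 = 0" "x t1 = 0" "\<forall>t. t0 < t \<and> t < t1 \<longrightarrow> x t < 0"
  shows "affine_arc T\<^sub>L D\<^sub>L a x y t0 t1" "t1 - t0 \<in> early T\<^sub>L D\<^sub>L"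
    "y t0 = a * ystart T\<^sub>L D\<^sub>L (t1 - t0)" "y t1 = a * yend T\<^sub>L D\<^sub>L (t1 - t0)" "y t0 > 0" "y t1 < 0"
proof -
  have le: "x s \<le> 0" if "t0 \<le> s" "s \<le> t1" for s
    using assms that by (cases "s = t0"; cases "s = t1") (auto simp: less_imp_le)
  show arc: "affine_arc T\<^sub>L D\<^sub>L a x y t0 t1"
    by unfold_locales (use assms le x_deriv y_deriv in \<open>auto dest: le\<close>, (metis le x_deriv y_deriv)+)
  then interpret affine_arc T\<^sub>L D\<^sub>L a x y t0 t1 .
  show e: "t1 - t0 \<in> early T\<^sub>L D\<^sub>L" by (rule left_arc_early[OF a_pos le])
  note sg = early_signs[OF e]
  show y: "y t0 = a * ystart T\<^sub>L D\<^sub>L (t1 - t0)" "y t1 = a * yend T\<^sub>L D\<^sub>L (t1 - t0)"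
    using ends_eq[OF assms(3)] sg(1) by auto
  show "y t0 > 0" "y t1 < 0"
    unfolding y using sg a_pos by (auto simp: mult_pos_neg)
qed

text \<open>Unlike for left arcs, the inequalities at the ends are weak, since a right arc may touch
  the line at the origin.\<close>

lemma right_arc:
  assumes "t0 < t1" "x t0 = 0" "x t1 = 0" "\<forall>t. t0 < t \<and> t < t1 \<longrightarrow> x t > 0"
  shows "affine_arc T\<^sub>R D\<^sub>R a x y t0 t1" "y t0 \<le> 0" "y t1 \<ge> 0"
    "T\<^sub>R > 0 \<Longrightarrow> y t0 < 0 \<Longrightarrow> t1 - t0 \<in> late T\<^sub>R D\<^sub>R \<and> y t0 = a * ystart T\<^sub>R D\<^sub>R (t1 - t0) \<and> y t1 = a * yend T\<^sub>R D\<^sub>R (t1 - t0)"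
proof -
  have ge: "x s \<ge> 0" if "t0 \<le> s" "s \<le> t1" for s
    using assms that by (cases "s = t0"; cases "s = t1") (auto simp: less_imp_le)
  show arc: "affine_arc T\<^sub>R D\<^sub>R a x y t0 t1"
  proof
    fix s assume s: "t0 \<le> s" "s \<le> t1"
    have "x s \<ge> 0" by (rule ge[OF s])
    then show "(x has_real_derivative T\<^sub>R * x s - y s) (at s)" "(y has_real_derivative D\<^sub>R * x s - a) (at s)"
      using x_deriv[of s] y_deriv[of s] by (cases "x s = 0"; simp)+
  qed (use assms in auto)
  then interpret affine_arc T\<^sub>R D\<^sub>R a x y t0 t1 .
  show "y t0 \<le> 0" by (rule y_start_of_right[OF assms(2,1)]) (use assms(4) in auto)
  show "y t1 \<ge> 0" by (rule y_end_of_right[OF assms(3,1)]) (use assms(4) in auto)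
  show "t1 - t0 \<in> late T\<^sub>R D\<^sub>R \<and> y t0 = a * ystart T\<^sub>R D\<^sub>R (t1 - t0) \<and> y t1 = a * yend T\<^sub>R D\<^sub>R (t1 - t0)"
    if "T\<^sub>R > 0" "y t0 < 0"
  proof -
    have l: "t1 - t0 \<in> late T\<^sub>R D\<^sub>R" by (rule right_arc_late[OF a_pos that assms(3) ge])
    then show ?thesis using ends_eq[OF assms(3)] kerS_neg_late[OF l] by auto
  qed
qed

lemma next_left:
  assumes "x t = 0" "y t > 0"
  obtains t1 where "t < t1" "x t1 = 0" "\<forall>r. t < r \<and> r < t1 \<longrightarrow> x r < 0"
proof -
  obtain d where d: "d > 0" "\<And>h. 0 < h \<Longrightarrow> h < d \<Longrightarrow> x t > x (t + h)"
    using DERIV_neg_dec_right[OF x_deriv_zero[OF assms(1)]] assms(2) by auto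
  obtain s where "s > t" "x s > 0" using pos_later by blast
  then show thesis using next_zero[OF cont_x d(1), of t s] d(2) assms(1) that by (metis less_imp_le)
qed

lemma next_right:
  assumes "x t = 0" "y t < 0"
  obtains t1 where "t < t1" "x t1 = 0" "\<forall>r. t < r \<and> r < t1 \<longrightarrow> x r > 0"
proof -
  obtain d where d: "d > 0" "\<And>h. 0 < h \<Longrightarrow> h < d \<Longrightarrow> x t < x (t + h)"
    using DERIV_pos_inc_right[OF x_deriv_zero[OF assms(1)]] assms(2) by auto
  obtain s where "s > t" "x s < 0" using neg_later by blast
  then show thesis
    using next_zero[of "\<lambda>t. - x t", OF continuous_on_minus[OF cont_x] d(1), of t s] d(2) assms(1) that
    by (metis less_imp_le neg_0_less_iff_less neg_equal_0_iff_equal neg_less_0_iff_less)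
qed

lemma previous_left:
  assumes "x t = 0" "y t < 0"
  obtains t1 where "t1 < t" "x t1 = 0" "\<forall>r. t1 < r \<and> r < t \<longrightarrow> x r < 0"
proof -
  obtain d where d: "d > 0" "\<And>h. 0 < h \<Longrightarrow> h < d \<Longrightarrow> x (t - h) < x t"
    using DERIV_pos_inc_left[OF x_deriv_zero[OF assms(1)]] assms(2) by auto
  obtain s where "s < t" "x s > 0" using pos_earlier by blast
  then show thesis using previous_zero[OF cont_x d(1), of t s] d(2) assms(1) that by (metis less_imp_le)
qed

text \<open>Just before \<open>t\<close> the value of \<open>y\<close> is about \<open>a\<close>
  times the time left, while \<open>x\<close> is of smaller order. So \<open>- y\<close> dominates
  in \<open>x'\<close>, whichever trace is in force, and \<open>x\<close> decreases to 0.\<close>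

lemma grazing:
  assumes "x t = 0" "y t = 0"
  obtains d where "d > 0" "\<And>h. 0 < h \<Longrightarrow> h < d \<Longrightarrow> x (t - h) > 0"
proof -
  define M where "M = \<bar>T\<^sub>L\<bar> + \<bar>T\<^sub>R\<bar> + 1"
  have M: "M > 0" by (simp add: M_def)
  have "(x has_real_derivative 0) (at t)" "(y has_real_derivative - a) (at t)"
    using x_deriv[of t] y_deriv[of t] assms by auto
  then have lim: "((\<lambda>h. x (t + h) / h) \<longlongrightarrow> 0) (at 0)" "((\<lambda>h. y (t + h) / h) \<longlongrightarrow> - a) (at 0)"
    unfolding DERIV_def using assms by auto
  have "\<forall>\<^sub>F h in at 0. \<bar>x (t + h) / h\<bar> < a / (4 * M)"
    using tendstoD[OF lim(1), of "a / (4 * M)"] a_pos M by simp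
  moreover have "\<forall>\<^sub>F h in at 0. y (t + h) / h < - a / 2"
    using order_tendstoD(2)[OF lim(2), of "- a / 2"] a_pos by simp
  ultimately have "\<forall>\<^sub>F h in at 0. \<bar>x (t + h) / h\<bar> < a / (4 * M) \<and> y (t + h) / h < - a / 2"
    by (rule eventually_conj)
  then obtain d where d: "d > 0" "\<And>h. h \<noteq> 0 \<Longrightarrow> \<bar>h\<bar> < d \<Longrightarrow> \<bar>x (t + h) / h\<bar> < a / (4 * M) \<and> y (t + h) / h < - a / 2"
    unfolding eventually_at by (auto simp: dist_real_def)
  have "x (t - h) > 0" if h: "0 < h" "h < d" for h
  proof -
    have "x t < x (t - h)"
    proof (rule DERIV_neg_imp_decreasing_open[of "t - h" t x])
      show "t - h < t" using h by simp
      show "continuous_on {t - h..t} x" by (rule cont_x)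
      fix s assume s: "t - h < s" "s < t"
      define k where "k = t - s"
      have k: "0 < k" "k < d" using s h by (auto simp: k_def)
      have "\<bar>x s / (- k)\<bar> < a / (4 * M) \<and> y s / (- k) < - a / 2"
        using d(2)[of "- k"] k by (simp add: k_def)
      then have "\<bar>x s\<bar> * (4 * M) < a * k" "y s > a * k / 2"
        using k M by (auto simp: field_simps)
      moreover have "\<bar>(if x s \<le> 0 then T\<^sub>L else T\<^sub>R) * x s\<bar> \<le> M * \<bar>x s\<bar>"
        unfolding abs_mult by (intro mult_right_mono) (auto simp: M_def)
      moreover have "a * k > 0" using a_pos k by simp
      ultimately have "(if x s \<le> 0 then T\<^sub>L else T\<^sub>R) * x s - y s < 0"
        by (simp only: mult.commute mult.left_commute)
      then show "\<exists>d. (x has_real_derivative d) (at s) \<and> d < 0" using x_deriv by blast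
    qed
    then show ?thesis using assms by simp
  qed
  then show thesis using d(1) that by blast
qed

lemma previous_right:
  assumes "x t = 0" "y t \<ge> 0"
  obtains t1 where "t1 < t" "x t1 = 0" "\<forall>r. t1 < r \<and> r < t \<longrightarrow> x r > 0"
proof -
  obtain d where d: "d > 0" "\<And>h. 0 < h \<Longrightarrow> h < d \<Longrightarrow> x (t - h) > 0"
  proof (cases "y t = 0")
    case True
    then show thesis using grazing assms that by blast
  next
    case False
    then show thesis using DERIV_neg_dec_left[OF x_deriv_zero[OF assms(1)]] assms that by auto
  qed
  obtain s where "s < t" "x s < 0" using neg_earlier by blast
  then show thesis
    using previous_zero[of "\<lambda>t. - x t", OF continuous_on_minus[OF cont_x] d(1), of t s] d(2) that
    by (metis less_imp_le neg_0_less_iff_less neg_equal_0_iff_equal neg_less_0_iff_less)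
qed

text \<open>The crossings in one period form a compact set, so a highest one exists; it is positive
  because the left arc around a point with \<open>x < 0\<close> starts at a positive height.\<close>

lemma highest_crossing:
  obtains t0 where "x t0 = 0" "y t0 > 0" "\<And>t. x t = 0 \<Longrightarrow> y t \<le> y t0"
proof -
  obtain P where P: "P > 0" "\<And>t. x (t + P) = x t" "\<And>t. y (t + P) = y t"
    using two_zone unfolding two_zone_periodic_def by blast
  have rep: "\<exists>r\<in>{0..P}. x r = x t \<and> y r = y t" for t
  proof -
    obtain r where "0 \<le> r" "r < 0 + P" "(x r, y r) = (x t, y t)"
      using periodic_representative[where x = "\<lambda>t. (x t, y t)" and T = P and a = 0 and t = t] P by auto
    then show ?thesis by (intro bexI[of _ r]) auto
  qed
  obtain n where n: "x n < 0" using two_zone unfolding two_zone_periodic_def by blast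
  obtain p where p: "p < n" "x p > 0" using pos_earlier by blast
  obtain q where q: "q > n" "x q > 0" using pos_later by blast
  have "isCont x n" using x_deriv DERIV_isCont by blast
  then have "\<forall>\<^sub>F r in at n. x r < 0" using n order_tendstoD(2) unfolding isCont_def by blast
  then obtain d where d: "d > 0" "\<And>r. r \<noteq> n \<Longrightarrow> dist r n < d \<Longrightarrow> x r < 0"
    unfolding eventually_at by auto
  have dn: "x (n + h) < 0" "x (n - h) < 0" if "0 < h" "h < d" for h
    using d(2)[of "n + h"] d(2)[of "n - h"] that by (auto simp: dist_real_def)
  obtain t1 where t1: "t1 > n" "x t1 = 0" "\<And>r. n < r \<Longrightarrow> r < t1 \<Longrightarrow> x r < 0"
    by (rule next_zero[OF cont_x d(1) dn(1), of q]) (use q in auto)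
  obtain t0 where t0: "t0 < n" "x t0 = 0" "\<And>r. t0 < r \<Longrightarrow> r < n \<Longrightarrow> x r < 0"
    by (rule previous_zero[OF cont_x d(1) dn(2), of p]) (use p in auto)
  have y0: "y t0 > 0"
  proof (rule left_arc(5))
    have "x r < 0" if "t0 < r" "r < t1" for r
      using t0(3)[of r] t1(3)[of r] n that by (cases r n rule: linorder_cases) auto
    then show "\<forall>r. t0 < r \<and> r < t1 \<longrightarrow> x r < 0" by blast
  qed (use t0 t1 in auto)
  define Zs where "Zs = {0..P} \<inter> {t. x t = 0}"
  have "closed {t. x t = 0}" by (intro closed_Collect_eq cont_x continuous_on_const)
  then have "compact Zs" unfolding Zs_def by (intro compact_Int_closed) auto
  moreover have "Zs \<noteq> {}" using rep[of t0] t0(2) by (auto simp: Zs_def)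
  ultimately obtain m where m: "m \<in> Zs" "\<And>t. t \<in> Zs \<Longrightarrow> y t \<le> y m"
    using continuous_attains_sup[of Zs y] cont_y by blast
  have max: "y t \<le> y m" if "x t = 0" for t
    using rep[of t] m(2) that by (force simp: Zs_def)
  show thesis
    by (rule that[of m]) (use m(1) max y0 max[OF t0(2)] in \<open>auto simp: Zs_def\<close>)
qed


text \<open>After one left and one right arc from the highest crossing the energy has strictly
  grown, so a still higher crossing would follow.\<close>

lemma traces_not_nonneg:
  assumes "T\<^sub>L \<ge> 0" "T\<^sub>R \<ge> 0"
  shows "T\<^sub>L = 0 \<and> T\<^sub>R = 0"
proof (rule ccontr)
  assume nz: "\<not> (T\<^sub>L = 0 \<and> T\<^sub>R = 0)"
  obtain t0 where t0: "x t0 = 0" "y t0 > 0" "\<And>t. x t = 0 \<Longrightarrow> y t \<le> y t0"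
    using highest_crossing by blast
  obtain t1 where t1: "t0 < t1" "x t1 = 0" "\<forall>r. t0 < r \<and> r < t1 \<longrightarrow> x r < 0"
    using next_left[OF t0(1,2)] by blast
  note L = left_arc[OF t1(1) t0(1) t1(2,3)]
  obtain t2 where t2: "t1 < t2" "x t2 = 0" "\<forall>r. t1 < r \<and> r < t2 \<longrightarrow> x r > 0"
    using next_right[OF t1(2) L(6)] by blast
  note R = right_arc[OF t2(1) t1(2) t2(2,3)]
  have "(y t0)\<^sup>2 \<le> (y t1)\<^sup>2" "T\<^sub>L > 0 \<Longrightarrow> (y t0)\<^sup>2 < (y t1)\<^sup>2"
    using affine_arc.energy_ends[OF L(1) t1(2)] assms L(5) by auto
  moreover have "(y t1)\<^sup>2 \<le> (y t2)\<^sup>2" "T\<^sub>R > 0 \<Longrightarrow> (y t1)\<^sup>2 < (y t2)\<^sup>2"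
    using affine_arc.energy_ends[OF R(1) t2(2)] assms L(6) by auto
  ultimately have "(y t0)\<^sup>2 < (y t2)\<^sup>2" using nz assms by linarith
  moreover have "(y t2)\<^sup>2 \<le> (y t0)\<^sup>2" using t0(3)[OF t2(2)] R(3) by (intro power_mono) auto
  ultimately show False by simp
qed

lemma two_arcs_if_traces_zero:
  assumes "T\<^sub>L = 0" "T\<^sub>R = 0"
  shows "\<exists>t0 t1 t2. two_arcs x y t0 t1 t2"
proof -
  obtain t0 where t0: "x t0 = 0" "y t0 > 0" "\<And>t. x t = 0 \<Longrightarrow> y t \<le> y t0"
    using highest_crossing by blast
  obtain t1 where t1: "t0 < t1" "x t1 = 0" "\<forall>r. t0 < r \<and> r < t1 \<longrightarrow> x r < 0"
    using next_left[OF t0(1,2)] by blast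
  note L = left_arc[OF t1(1) t0(1) t1(2,3)]
  obtain t2 where t2: "t1 < t2" "x t2 = 0" "\<forall>r. t1 < r \<and> r < t2 \<longrightarrow> x r > 0"
    using next_right[OF t1(2) L(6)] by blast
  note R = right_arc[OF t2(1) t1(2) t2(2,3)]
  have "(y t2)\<^sup>2 = (y t0)\<^sup>2"
    using affine_arc.energy_ends(3)[OF L(1) t1(2)] affine_arc.energy_ends(3)[OF R(1) t2(2)] assms by simp
  then have "y t2 = y t0" using R(3) t0(2) by (simp add: power2_eq_iff)
  then show ?thesis
    using t0 t1 t2 L(6) unfolding two_arcs_def by blast
qed

text \<open>Both half-return maps are decreasing, so the return map is increasing. If the crossing
  before the highest one were lower, the crossing after the highest one would be higher.\<close>

lemma two_arcs_if_traces_opposite: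
  assumes T: "T\<^sub>L < 0" "T\<^sub>R > 0"
  obtains t0 t1 t2 where "two_arcs x y t0 t1 t2" "t1 - t0 \<in> early T\<^sub>L D\<^sub>L" "t2 - t1 \<in> late T\<^sub>R D\<^sub>R"
    "y t0 = a * ystart T\<^sub>L D\<^sub>L (t1 - t0)" "ystart T\<^sub>L D\<^sub>L (t1 - t0) = yend T\<^sub>R D\<^sub>R (t2 - t1)"
    "yend T\<^sub>L D\<^sub>L (t1 - t0) = ystart T\<^sub>R D\<^sub>R (t2 - t1)"
proof -
  obtain t0 where t0: "x t0 = 0" "y t0 > 0" "\<And>t. x t = 0 \<Longrightarrow> y t \<le> y t0"
    using highest_crossing by blast
  obtain t1 where t1: "t0 < t1" "x t1 = 0" "\<forall>r. t0 < r \<and> r < t1 \<longrightarrow> x r < 0"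
    using next_left[OF t0(1,2)] by blast
  note L = left_arc[OF t1(1) t0(1) t1(2,3)]
  obtain t2 where t2: "t1 < t2" "x t2 = 0" "\<forall>r. t1 < r \<and> r < t2 \<longrightarrow> x r > 0"
    using next_right[OF t1(2) L(6)] by blast
  note R = right_arc[OF t2(1) t1(2) t2(2,3)]
  obtain s1 where s1: "s1 < t0" "x s1 = 0" "\<forall>r. s1 < r \<and> r < t0 \<longrightarrow> x r > 0"
    using previous_right[OF t0(1)] t0(2) by (metis less_imp_le)
  note R' = right_arc[OF s1(1,2) t0(1) s1(3)]
  \<comment> \<open>If the right arc into \<open>t0\<close> started at the tangency, the energy
    would force the right arc before it to start there too. That arc would be a full period, and the
    orbit would never enter the left zone.\<close>
  have "y s1 \<noteq> 0"
  proof
    assume 0: "y s1 = 0"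
    obtain q where q: "q < s1" "x q = 0" "\<forall>r. q < r \<and> r < s1 \<longrightarrow> x r > 0"
      using previous_right[OF s1(2)] 0 by auto
    note Q = right_arc[OF q(1,2) s1(2) q(3)]
    have "(y q)\<^sup>2 \<le> (y s1)\<^sup>2" using affine_arc.energy_ends(1)[OF Q(1) s1(2)] T by simp
    then have yq: "y q = y s1" using 0 by simp
    define P where "P = s1 - q"
    have "x (r + P) = x r" for r
      using deterministic(1)[of q s1 "r - q"] q(2) s1(2) yq by (simp add: P_def algebra_simps)
    moreover obtain n where "x n < 0" using neg_later by blast
    ultimately obtain r where r: "q \<le> r" "r < q + P" "x r < 0"
      using periodic_representative[where x = x and T = P and a = q and t = n] q(1) by (metis P_def diff_gt_0_iff_gt)
    then show False using q(3)[rule_format, of r] q(2) by (cases "r = q") (auto simp: P_def)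
  qed
  then have ys1: "y s1 < 0" using R'(2) by simp
  obtain s0 where s0: "s0 < s1" "x s0 = 0" "\<forall>r. s0 < r \<and> r < s1 \<longrightarrow> x r < 0"
    using previous_left[OF s1(2) ys1] by blast
  note L' = left_arc[OF s0(1,2) s1(2) s0(3)]
  define l where "l = t1 - t0"
  define l' where "l' = s1 - s0"
  define r where "r = t2 - t1"
  define r' where "r' = t0 - s1"
  have l: "l \<in> early T\<^sub>L D\<^sub>L" "y t0 = a * ystart T\<^sub>L D\<^sub>L l" "y t1 = a * yend T\<^sub>L D\<^sub>L l"
    using L by (auto simp: l_def)
  have l': "l' \<in> early T\<^sub>L D\<^sub>L" "y s0 = a * ystart T\<^sub>L D\<^sub>L l'" "y s1 = a * yend T\<^sub>L D\<^sub>L l'"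
    using L' by (auto simp: l'_def)
  have r: "r \<in> late T\<^sub>R D\<^sub>R" "y t1 = a * ystart T\<^sub>R D\<^sub>R r" "y t2 = a * yend T\<^sub>R D\<^sub>R r"
    using R(4)[OF T(2) L(6)] by (auto simp: r_def)
  have r': "r' \<in> late T\<^sub>R D\<^sub>R" "y s1 = a * ystart T\<^sub>R D\<^sub>R r'" "y t0 = a * yend T\<^sub>R D\<^sub>R r'"
    using R'(4)[OF T(2) ys1] by (auto simp: r'_def)
  have "y s0 = y t0"
  proof (rule ccontr)
    assume "y s0 \<noteq> y t0"
    then have "y s0 < y t0" using t0(3)[OF s0(2)] by simp
    then have lt: "ystart T\<^sub>L D\<^sub>L l' < ystart T\<^sub>L D\<^sub>L l" using l(2) l'(2) a_pos by simp
    have "l' < l"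
    proof (rule ccontr)
      assume "\<not> l' < l"
      then have "l = l' \<or> l < l'" by linarith
      then show False using ystart_strict_mono_early[OF l(1) l'(1)] lt by auto
    qed
    then have "yend T\<^sub>L D\<^sub>L l < yend T\<^sub>L D\<^sub>L l'" by (rule yend_strict_antimono_early[OF l'(1) l(1)])
    then have "y t1 < y s1" using l(3) l'(3) a_pos by simp
    then have lt': "ystart T\<^sub>R D\<^sub>R r < ystart T\<^sub>R D\<^sub>R r'" using r(2) r'(2) a_pos by simp
    \<comment> \<open>Strict growth of the energy excludes \<open>y t2 = 0\<close>, so that the sign
      conditions of \<open>half_return_antimono_late\<close> are met.\<close>
    have "(y t1)\<^sup>2 < (y t2)\<^sup>2"
      using affine_arc.energy_ends(2)[OF R(1) t2(2) T(2)] L(6) by simp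
    then have "y t2 \<noteq> 0" using L(6) zero_le_power2[of "y t1"] by auto
    then have yt2: "y t2 > 0" using R(3) by simp
    have "yend T\<^sub>R D\<^sub>R r' < yend T\<^sub>R D\<^sub>R r"
    proof (rule half_return_antimono_late[OF r(1) _ _ r'(1) _ _ lt'])
      show "ystart T\<^sub>R D\<^sub>R r < 0" "yend T\<^sub>R D\<^sub>R r > 0" "ystart T\<^sub>R D\<^sub>R r' < 0" "yend T\<^sub>R D\<^sub>R r' > 0"
        using r(2,3) r'(2,3) a_pos L(6) yt2 ys1 t0(2) by (auto simp: mult_less_0_iff zero_less_mult_iff)
    qed
    then have "y t0 < y t2" using r(3) r'(3) a_pos by simp
    then show False using t0(3)[OF t2(2)] by simp
  qed
  \<comment> \<open>The pair of arcs that closes up is the one before \<open>t0\<close>, as it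
    starts and ends at the same height.\<close>
  have arcs: "two_arcs x y s0 s1 t0"
    unfolding two_arcs_def using s0 s1 t0 \<open>y s0 = y t0\<close> ys1 by auto
  show thesis
    by (rule that[OF arcs])
      (use l' r' \<open>y s0 = y t0\<close> a_pos in \<open>auto simp: l'_def r'_def\<close>)
qed

end

section \<open>Time reversal and reflection of the zones\<close>

lemma canonical_solution_reverse:
  assumes "canonical_solution T\<^sub>L D\<^sub>L T\<^sub>R D\<^sub>R a x y"
  shows "canonical_solution (- T\<^sub>L) D\<^sub>L (- T\<^sub>R) D\<^sub>R a (\<lambda>t. x (- t)) (\<lambda>t. - y (- t))"
  unfolding canonical_solution_def
proof (intro allI conjI)
  fix t
  have d: "(x has_real_derivative (if x s \<le> 0 then T\<^sub>L else T\<^sub>R) * x s - y s) (at s)"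
    "(y has_real_derivative (if x s \<le> 0 then D\<^sub>L else D\<^sub>R) * x s - a) (at s)" for s
    using assms by (auto simp: canonical_solution_def)
  show "((\<lambda>t. x (- t)) has_real_derivative (if x (- t) \<le> 0 then - T\<^sub>L else - T\<^sub>R) * x (- t) - - y (- t)) (at t)"
    using minus_arg_deriv[of x, OF d(1)] by (rule DERIV_cong) auto
  show "((\<lambda>t. - y (- t)) has_real_derivative (if x (- t) \<le> 0 then D\<^sub>L else D\<^sub>R) * x (- t) - a) (at t)"
    using DERIV_minus[OF minus_arg_deriv[of y, OF d(2)]] by (rule DERIV_cong) auto
qed

lemma canonical_solution_reflect:
  assumes "canonical_solution T\<^sub>L D\<^sub>L T\<^sub>R D\<^sub>R a x y"
  shows "canonical_solution T\<^sub>R D\<^sub>R T\<^sub>L D\<^sub>L (- a) (\<lambda>t. - x t) (\<lambda>t. - y t)"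
  unfolding canonical_solution_def
proof (intro allI conjI)
  fix t
  have d: "(x has_real_derivative (if x t \<le> 0 then T\<^sub>L else T\<^sub>R) * x t - y t) (at t)"
    "(y has_real_derivative (if x t \<le> 0 then D\<^sub>L else D\<^sub>R) * x t - a) (at t)"
    using assms by (auto simp: canonical_solution_def)
  show "((\<lambda>t. - x t) has_real_derivative (if - x t \<le> 0 then T\<^sub>R else T\<^sub>L) * - x t - - y t) (at t)"
    using DERIV_minus[OF d(1)] by (rule DERIV_cong) auto
  show "((\<lambda>t. - y t) has_real_derivative (if - x t \<le> 0 then D\<^sub>R else D\<^sub>L) * - x t - - a) (at t)"
    using DERIV_minus[OF d(2)] by (rule DERIV_cong) auto
qed

lemma two_zone_periodic_reverse:
  assumes "two_zone_periodic x y"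
  shows "two_zone_periodic (\<lambda>t. x (- t)) (\<lambda>t. - y (- t))"
proof -
  obtain P where P: "P > 0" "\<And>t. x (t + P) = x t" "\<And>t. y (t + P) = y t"
    using assms unfolding two_zone_periodic_def by blast
  have "x (- (t + P)) = x (- t)" "y (- (t + P)) = y (- t)" for t
    using P(2)[of "- t - P"] P(3)[of "- t - P"] by auto
  moreover have "x (- (r + s)) = x (- (r + t)) \<and> y (- (r + s)) = y (- (r + t))" if "x (- s) = x (- t)" "y (- s) = y (- t)" for r s t
  proof -
    have "\<forall>r. x (r + (- s)) = x (r + (- t)) \<and> y (r + (- s)) = y (r + (- t))"
      using assms that unfolding two_zone_periodic_def by blast
    from this[rule_format, of "- r"] show ?thesis by simp
  qed
  moreover have "\<exists>t. x (- t) < 0" "\<exists>t. x (- t) > 0"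
    using assms unfolding two_zone_periodic_def by (metis minus_minus)+
  ultimately show ?thesis unfolding two_zone_periodic_def neg_equal_iff_equal using P(1) by blast
qed

lemma two_zone_periodic_reflect:
  assumes "two_zone_periodic x y"
  shows "two_zone_periodic (\<lambda>t. - x t) (\<lambda>t. - y t)"
  using assms unfolding two_zone_periodic_def neg_equal_iff_equal neg_less_0_iff_less neg_0_less_iff_less
  by blast

lemma two_zone_periodic_shift:
  assumes "two_zone_periodic x y" "two_arcs x y t0 t1 t2"
  shows "x (r + (t2 - t0)) = x r" "y (r + (t2 - t0)) = y r"
proof -
  have "\<forall>r. x (r + t2) = x (r + t0) \<and> y (r + t2) = y (r + t0)"
    using assms unfolding two_zone_periodic_def two_arcs_def by metis
  from this[rule_format, of "r - t0"] show "x (r + (t2 - t0)) = x r" "y (r + (t2 - t0)) = y r"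
    by (auto simp: algebra_simps)
qed

text \<open>Reversal maps the left arc on \<open>[t0, t1]\<close> to one on
  \<open>[- t1, - t0]\<close>. The right arc that follows is the reversed one moved by a
  period.\<close>

lemma two_arcs_reverse:
  assumes per: "two_zone_periodic x y" and arcs: "two_arcs (\<lambda>t. x (- t)) (\<lambda>t. - y (- t)) t0 t1 t2"
  shows "two_arcs x y (- t1) (- t0) (- t1 + (t2 - t0))"
proof -
  have sh: "x (r + (t2 - t0)) = x r" "y (r + (t2 - t0)) = y r" for r
    using two_zone_periodic_shift[OF two_zone_periodic_reverse[OF per] arcs, of "- r - (t2 - t0)"]
    by (auto simp: add.commute[of r])
  have A: "t0 < t1" "t1 < t2" "x (- t0) = 0" "x (- t1) = 0" "y (- t0) < 0" "y (- t1) > 0"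
    "\<And>t. t0 < t \<Longrightarrow> t < t1 \<Longrightarrow> x (- t) < 0" "\<And>t. t1 < t \<Longrightarrow> t < t2 \<Longrightarrow> x (- t) > 0"
    using arcs unfolding two_arcs_def by auto
  have "x t < 0" if "- t1 < t" "t < - t0" for t
    using A(7)[of "- t"] that by simp
  moreover have "x t > 0" if "- t0 < t" "t < - t1 + (t2 - t0)" for t
    using A(8)[of "- (t - (t2 - t0))"] sh(1)[of "t - (t2 - t0)"] that by simp
  ultimately show ?thesis
    unfolding two_arcs_def sh using A(1-6) by auto
qed

lemma two_arcs_reflect:
  assumes per: "two_zone_periodic x y" and arcs: "two_arcs (\<lambda>t. - x t) (\<lambda>t. - y t) t0 t1 t2"
  shows "two_arcs x y t1 t2 (t1 + (t2 - t0))"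
proof -
  have sh: "x (r + (t2 - t0)) = x r" "y (r + (t2 - t0)) = y r" for r
    using two_zone_periodic_shift[OF two_zone_periodic_reflect[OF per] arcs, of r] by auto
  have A: "t0 < t1" "t1 < t2" "x t1 = 0" "x t2 = 0" "y t2 < 0" "y t1 > 0"
    "\<And>t. t0 < t \<Longrightarrow> t < t1 \<Longrightarrow> x t > 0" "\<And>t. t1 < t \<Longrightarrow> t < t2 \<Longrightarrow> x t < 0"
    using arcs unfolding two_arcs_def by auto
  have "x t > 0" if "t2 < t" "t < t1 + (t2 - t0)" for t
    using A(7)[of "t - (t2 - t0)"] sh(1)[of "t - (t2 - t0)"] that by simp
  then show ?thesis
    unfolding two_arcs_def sh using A by auto
qed

text \<open>The sign conditions are compatible with both symmetries. Reversal changes the signs of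
  the traces and of the exponent; reflection exchanges the zones and the sign of \<open>a\<close>,
  and \<open>a * T\<^sub>L\<close> and \<open>- a * T\<^sub>R\<close> have the same sign when the
  traces are opposite.\<close>

definition orbit_structure ::
  "real \<Rightarrow> real \<Rightarrow> real \<Rightarrow> (real \<Rightarrow> real) \<Rightarrow> (real \<Rightarrow> real) \<Rightarrow> bool" where
  "orbit_structure T\<^sub>L T\<^sub>R a x y \<longleftrightarrow> (T\<^sub>L * T\<^sub>R < 0 \<or> T\<^sub>L = 0 \<and> T\<^sub>R = 0) \<and>
     (\<exists>t0 t1 t2. two_arcs x y t0 t1 t2 \<and>
        (a * T\<^sub>L < 0 \<longrightarrow> T\<^sub>L * (t1 - t0) + T\<^sub>R * (t2 - t1) < 0) \<and>
        (a * T\<^sub>L > 0 \<longrightarrow> T\<^sub>L * (t1 - t0) + T\<^sub>R * (t2 - t1) > 0))"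

lemma orbit_structure_stable:
  assumes "canonical_orbit T\<^sub>L D\<^sub>L T\<^sub>R D\<^sub>R a x y" and T: "T\<^sub>L < 0 \<and> T\<^sub>R > 0 \<or> T\<^sub>L \<ge> 0 \<and> T\<^sub>R \<ge> 0"
  shows "orbit_structure T\<^sub>L T\<^sub>R a x y"
proof -
  interpret canonical_orbit T\<^sub>L D\<^sub>L T\<^sub>R D\<^sub>R a x y by fact
  from T show ?thesis
  proof
    assume "T\<^sub>L \<ge> 0 \<and> T\<^sub>R \<ge> 0"
    then show ?thesis
      using traces_not_nonneg two_arcs_if_traces_zero by (auto simp: orbit_structure_def)
  next
    assume T: "T\<^sub>L < 0 \<and> T\<^sub>R > 0"
    then obtain t0 t1 t2 where t: "two_arcs x y t0 t1 t2" "t1 - t0 \<in> early T\<^sub>L D\<^sub>L" "t2 - t1 \<in> late T\<^sub>R D\<^sub>R"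
      "ystart T\<^sub>L D\<^sub>L (t1 - t0) = yend T\<^sub>R D\<^sub>R (t2 - t1)"
      "yend T\<^sub>L D\<^sub>L (t1 - t0) = ystart T\<^sub>R D\<^sub>R (t2 - t1)"
      using two_arcs_if_traces_opposite by metis
    interpret expanding_right_focus T\<^sub>L D\<^sub>L T\<^sub>R D\<^sub>R
      by unfold_locales (use T wq_pos_late[OF t(3)] in auto)
    have "T\<^sub>L * (t1 - t0) + T\<^sub>R * (t2 - t1) < 0"
      by (rule exponent_negative[OF t(2-5)])
    then show ?thesis
      using T t(1) a_pos unfolding orbit_structure_def
      by (intro conjI exI[of _ t0] exI[of _ t1] exI[of _ t2]) (auto simp: mult_neg_pos mult_pos_neg zero_less_mult_iff)
  qed
qed

lemma orbit_structure_pos: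
  assumes "canonical_orbit T\<^sub>L D\<^sub>L T\<^sub>R D\<^sub>R a x y"
  shows "orbit_structure T\<^sub>L T\<^sub>R a x y"
proof (cases "T\<^sub>L < 0 \<and> T\<^sub>R > 0 \<or> T\<^sub>L \<ge> 0 \<and> T\<^sub>R \<ge> 0")
  case True
  then show ?thesis by (rule orbit_structure_stable[OF assms])
next
  case False
  interpret canonical_orbit T\<^sub>L D\<^sub>L T\<^sub>R D\<^sub>R a x y by fact
  have "canonical_orbit (- T\<^sub>L) D\<^sub>L (- T\<^sub>R) D\<^sub>R a (\<lambda>t. x (- t)) (\<lambda>t. - y (- t))"
    by unfold_locales (use canonical_solution_reverse[OF sol] two_zone_periodic_reverse[OF two_zone] a_pos in auto)
  then have "orbit_structure (- T\<^sub>L) (- T\<^sub>R) a (\<lambda>t. x (- t)) (\<lambda>t. - y (- t))"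
    by (rule orbit_structure_stable) (use False in auto)
  then obtain t0 t1 t2 where *: "T\<^sub>L * T\<^sub>R < 0 \<or> T\<^sub>L = 0 \<and> T\<^sub>R = 0"
    "two_arcs (\<lambda>t. x (- t)) (\<lambda>t. - y (- t)) t0 t1 t2"
    "a * (- T\<^sub>L) < 0 \<Longrightarrow> - T\<^sub>L * (t1 - t0) + - T\<^sub>R * (t2 - t1) < 0"
    "a * (- T\<^sub>L) > 0 \<Longrightarrow> - T\<^sub>L * (t1 - t0) + - T\<^sub>R * (t2 - t1) > 0"
    unfolding orbit_structure_def by auto
  have eq: "T\<^sub>L * (- t0 - - t1) + T\<^sub>R * (- t1 + (t2 - t0) - - t0) = - (- T\<^sub>L * (t1 - t0) + - T\<^sub>R * (t2 - t1))"
    by (simp add: algebra_simps)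
  have "a * T\<^sub>L < 0 \<longrightarrow> T\<^sub>L * (- t0 - - t1) + T\<^sub>R * (- t1 + (t2 - t0) - - t0) < 0"
    "a * T\<^sub>L > 0 \<longrightarrow> T\<^sub>L * (- t0 - - t1) + T\<^sub>R * (- t1 + (t2 - t0) - - t0) > 0"
    unfolding eq using *(3,4) by auto
  then show ?thesis
    using two_arcs_reverse[OF two_zone *(2)] *(1) unfolding orbit_structure_def by blast
qed

lemma orbit_structure:
  assumes sol: "canonical_solution T\<^sub>L D\<^sub>L T\<^sub>R D\<^sub>R a x y" and per: "two_zone_periodic x y" and "a \<noteq> 0"
  shows "orbit_structure T\<^sub>L T\<^sub>R a x y"
proof (cases "a > 0")
  case True
  then show ?thesis using assms by (intro orbit_structure_pos) (unfold_locales)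
next
  case False
  have "canonical_orbit T\<^sub>R D\<^sub>R T\<^sub>L D\<^sub>L (- a) (\<lambda>t. - x t) (\<lambda>t. - y t)"
    by unfold_locales (use canonical_solution_reflect[OF sol] two_zone_periodic_reflect[OF per] False \<open>a \<noteq> 0\<close> in auto)
  then have "orbit_structure T\<^sub>R T\<^sub>L (- a) (\<lambda>t. - x t) (\<lambda>t. - y t)"
    by (rule orbit_structure_pos)
  then obtain t0 t1 t2 where *: "T\<^sub>L * T\<^sub>R < 0 \<or> T\<^sub>L = 0 \<and> T\<^sub>R = 0"
    "two_arcs (\<lambda>t. - x t) (\<lambda>t. - y t) t0 t1 t2"
    "- a * T\<^sub>R < 0 \<Longrightarrow> T\<^sub>R * (t1 - t0) + T\<^sub>L * (t2 - t1) < 0"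
    "- a * T\<^sub>R > 0 \<Longrightarrow> T\<^sub>R * (t1 - t0) + T\<^sub>L * (t2 - t1) > 0"
    unfolding orbit_structure_def by (auto simp: mult.commute)
  have "a * T\<^sub>L < 0 \<Longrightarrow> - a * T\<^sub>R < 0" "a * T\<^sub>L > 0 \<Longrightarrow> - a * T\<^sub>R > 0"
    using *(1) by (auto simp: mult_less_0_iff zero_less_mult_iff)
  then have "a * T\<^sub>L < 0 \<longrightarrow> T\<^sub>L * (t2 - t1) + T\<^sub>R * (t1 + (t2 - t0) - t2) < 0"
    "a * T\<^sub>L > 0 \<longrightarrow> T\<^sub>L * (t2 - t1) + T\<^sub>R * (t1 + (t2 - t0) - t2) > 0"
    using *(3,4) by (auto simp: algebra_simps)
  then show ?thesis
    using two_arcs_reflect[OF per *(2)] *(1) unfolding orbit_structure_def by blast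
qed

section \<open>Two orbits have a common point\<close>

lemma orbits_meet_stable:
  assumes "canonical_orbit T\<^sub>L D\<^sub>L T\<^sub>R D\<^sub>R a x y" "canonical_orbit T\<^sub>L D\<^sub>L T\<^sub>R D\<^sub>R a x' y'" and T: "T\<^sub>L < 0" "T\<^sub>R > 0"
  shows "\<exists>s s'. x s = x' s' \<and> y s = y' s'"
proof -
  obtain t0 t1 t2 where t: "two_arcs x y t0 t1 t2" "t1 - t0 \<in> early T\<^sub>L D\<^sub>L" "t2 - t1 \<in> late T\<^sub>R D\<^sub>R"
    "y t0 = a * ystart T\<^sub>L D\<^sub>L (t1 - t0)" "ystart T\<^sub>L D\<^sub>L (t1 - t0) = yend T\<^sub>R D\<^sub>R (t2 - t1)"
    "yend T\<^sub>L D\<^sub>L (t1 - t0) = ystart T\<^sub>R D\<^sub>R (t2 - t1)"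
    using canonical_orbit.two_arcs_if_traces_opposite[OF assms(1) T] by metis
  obtain s0 s1 s2 where s: "two_arcs x' y' s0 s1 s2" "s1 - s0 \<in> early T\<^sub>L D\<^sub>L" "s2 - s1 \<in> late T\<^sub>R D\<^sub>R"
    "y' s0 = a * ystart T\<^sub>L D\<^sub>L (s1 - s0)" "ystart T\<^sub>L D\<^sub>L (s1 - s0) = yend T\<^sub>R D\<^sub>R (s2 - s1)"
    "yend T\<^sub>L D\<^sub>L (s1 - s0) = ystart T\<^sub>R D\<^sub>R (s2 - s1)"
    using canonical_orbit.two_arcs_if_traces_opposite[OF assms(2) T] by metis
  interpret expanding_right_focus T\<^sub>L D\<^sub>L T\<^sub>R D\<^sub>R
    by unfold_locales (use T wq_pos_late[OF t(3)] in auto)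
  have "t1 - t0 = s1 - s0"
    by (rule match_unique[OF t(2) s(2) t(3) s(3) t(5,6) s(5,6)])
  then have "y t0 = y' s0" using t(4) s(4) by simp
  moreover have "x t0 = x' s0" using t(1) s(1) by (auto simp: two_arcs_def)
  ultimately show ?thesis by blast
qed

lemma orbits_meet_pos:
  assumes "canonical_orbit T\<^sub>L D\<^sub>L T\<^sub>R D\<^sub>R a x y" "canonical_orbit T\<^sub>L D\<^sub>L T\<^sub>R D\<^sub>R a x' y'" and T: "T\<^sub>L * T\<^sub>R < 0"
  shows "\<exists>s s'. x s = x' s' \<and> y s = y' s'"
proof (cases "T\<^sub>L < 0")
  case True
  then show ?thesis using orbits_meet_stable[OF assms(1,2)] T by (simp add: mult_less_0_iff)
next
  case False
  have rev: "canonical_orbit (- T\<^sub>L) D\<^sub>L (- T\<^sub>R) D\<^sub>R a (\<lambda>t. x (- t)) (\<lambda>t. - y (- t))"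
    if "canonical_orbit T\<^sub>L D\<^sub>L T\<^sub>R D\<^sub>R a x y" for x y
    using that canonical_solution_reverse two_zone_periodic_reverse by (simp add: canonical_orbit_def)
  from orbits_meet_stable[OF rev[OF assms(1)] rev[OF assms(2)]] show ?thesis
    using T False by (auto simp: mult_less_0_iff)
qed

lemma orbits_meet:
  assumes "canonical_solution T\<^sub>L D\<^sub>L T\<^sub>R D\<^sub>R a x y" "two_zone_periodic x y"
    "canonical_solution T\<^sub>L D\<^sub>L T\<^sub>R D\<^sub>R a x' y'" "two_zone_periodic x' y'"
    and "T\<^sub>L * T\<^sub>R < 0" "a \<noteq> 0"
  shows "\<exists>s s'. x s = x' s' \<and> y s = y' s'"
proof (cases "a > 0")
  case True
  then show ?thesis
    by (intro orbits_meet_pos) (unfold_locales, use assms in auto)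
next
  case False
  have "canonical_orbit T\<^sub>R D\<^sub>R T\<^sub>L D\<^sub>L (- a) (\<lambda>t. - x t) (\<lambda>t. - y t)"
    "canonical_orbit T\<^sub>R D\<^sub>R T\<^sub>L D\<^sub>L (- a) (\<lambda>t. - x' t) (\<lambda>t. - y' t)"
    using assms False canonical_solution_reflect two_zone_periodic_reflect by (auto simp: canonical_orbit_def)
  from orbits_meet_pos[OF this] assms(5) show ?thesis by (auto simp: mult.commute)
qed

section \<open>Closed orbits that are not isolated\<close>

text \<open>Scaling by \<open>l\<close> near 1 moves each point by less than the room
  \<open>d\<close> in the neighbourhood, but the largest distance from \<open>e\<close> drops from
  \<open>M\<close> to \<open>l * M\<close>, so the scaled orbit is a different set.\<close>

lemma closed_orbit_not_isolated:
  fixes f :: "'a::euclidean_space \<Rightarrow> 'a"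
  assumes x: "solution f x" "\<And>t. x (t + P) = x t" "P > 0" "x q \<noteq> x 0"
    and scaled: "\<And>l. 0 < l \<Longrightarrow> l < 1 \<Longrightarrow> solution f (\<lambda>t. e + l *\<^sub>R (x t - e))"
  shows "\<not> limit_cycle f (range x)"
proof
  assume "limit_cycle f (range x)"
  then obtain U where U: "open U" "range x \<subseteq> U" and
      "\<forall>\<Gamma>'. closed_orbit f \<Gamma>' \<and> \<Gamma>' \<subseteq> U \<longrightarrow> \<Gamma>' = range x"
    unfolding limit_cycle_def by (elim conjE exE) (rule that)
  then have U3: "\<Gamma> = range x" if "closed_orbit f \<Gamma>" "\<Gamma> \<subseteq> U" for \<Gamma>
    using that by simp
  have range: "range x = x ` {0..P}"
  proof -
    have "x t \<in> x ` {0..P}" for t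
      using periodic_representative[where x = x, OF x(2,3), of 0 t] by (metis add_0 atLeastAtMost_iff image_eqI less_imp_le)
    then show ?thesis by auto
  qed
  then have comp: "compact (range x)"
    by (simp add: compact_continuous_image solution_continuous[OF x(1)])
  obtain d where d: "d > 0" "(\<Union>w\<in>range x. ball w d) \<subseteq> U"
    using compact_subset_open_imp_ball_epsilon_subset[OF comp U] by blast
  have "continuous_on (range x) (\<lambda>w. norm (w - e))" by (intro continuous_intros)
  then obtain w where w: "w \<in> range x" "\<And>w'. w' \<in> range x \<Longrightarrow> norm (w' - e) \<le> norm (w - e)"
    using continuous_attains_sup[OF comp] by blast
  define M where "M = norm (w - e)"
  have M: "norm (x t - e) \<le> M" for t using w(2) by (auto simp: M_def)
  have "M \<noteq> 0" using M[of q] M[of 0] x(4) by auto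
  then have Mpos: "M > 0" by (simp add: M_def)
  \<comment> \<open>The deviation \<open>(1 - l) * M\<close> is at most \<open>d / 2\<close>, and
    \<open>l\<close> is at least \<open>1 / 2\<close>.\<close>
  define l where "l = 1 - min (1 / 2) (d / (2 * M))"
  have l: "0 < l" "l < 1" "(1 - l) * M < d"
  proof -
    have "(1 - l) * M \<le> d / (2 * M) * M" unfolding l_def using Mpos by (intro mult_right_mono) auto
    also have "\<dots> < d" using Mpos d by simp
    finally show "(1 - l) * M < d" .
  qed (use d Mpos in \<open>auto simp: l_def min_def\<close>)
  define y where "y t = e + l *\<^sub>R (x t - e)" for t
  have y: "solution f y" unfolding y_def using scaled l by blast
  have "closed_orbit f (range y)"
    unfolding closed_orbit_def
  proof (rule exI[of _ y], rule exI[of _ P], intro conjI allI)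
    show "\<exists>t. y t \<noteq> y 0" using x(4) l by (intro exI[of _ q]) (simp add: y_def)
  qed (use y x(2,3) in \<open>auto simp: y_def\<close>)
  moreover have "range y \<subseteq> U"
  proof -
    have "y t \<in> ball (x t) d" for t
    proof -
      have "x t - y t = (1 - l) *\<^sub>R (x t - e)" by (simp add: y_def algebra_simps)
      then have "norm (x t - y t) = (1 - l) * norm (x t - e)" using l by simp
      also have "\<dots> \<le> (1 - l) * M" using M l by (intro mult_left_mono) auto
      also have "\<dots> < d" by (rule l(3))
      finally show ?thesis by (simp add: dist_norm)
    qed
    then show ?thesis using d(2) by blast
  qed
  ultimately have "range y = range x" by (rule U3)
  then obtain t where "w = y t" using w(1) by blast
  then have "M = l * norm (x t - e)" using l by (simp add: M_def y_def)
  also have "\<dots> \<le> l * M" using M l by (intro mult_left_mono) auto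
  finally show False using l Mpos by simp
qed

text \<open>The mean of a periodic solution of an affine system is an equilibrium, about which the
  orbit can be shrunk.\<close>

lemma one_zone_not_isolated:
  fixes f :: "real^2 \<Rightarrow> real^2" and A :: "real^2^2"
  assumes x: "solution f x" "\<And>t. x (t + P) = x t" "P > 0" "x q \<noteq> x 0"
    and zone: "\<And>w. c * w $ 1 \<le> 0 \<Longrightarrow> f w = A *v w + b" and in_zone: "\<And>t. c * x t $ 1 \<le> 0"
  shows "\<not> limit_cycle f (range x)"
proof -
  define X where "X = primitive x"
  have Xd: "(X has_vector_derivative x t) (at t)" for t
    unfolding X_def by (rule has_vector_derivative_primitive[OF solution_continuous[OF x(1)]])
  have xd: "(x has_vector_derivative A *v x t + b) (at t)" for t
    using x(1) zone in_zone by (simp add: solution_def)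
  define m where "m = (1 / P) *\<^sub>R X P"
  have Xm: "X P = P *\<^sub>R m" using x(3) by (simp add: m_def)
  have X0: "X 0 = 0" by (simp add: X_def)
  have "((\<lambda>t. A *v X t + t *\<^sub>R b - x t) has_vector_derivative A *v x t + 1 *\<^sub>R b - (A *v x t + b)) (at t)" for t
    by (intro has_vector_derivative_diff has_vector_derivative_add xd
        bounded_linear.has_vector_derivative[OF matrix_vector_mul_bounded_linear Xd]
        bounded_linear.has_vector_derivative[OF bounded_linear_scaleR_left])
      (auto intro!: derivative_eq_intros)
  then have zd: "((\<lambda>t. A *v X t + t *\<^sub>R b - x t) has_vector_derivative 0) (at t)" for t by simp
  \<comment> \<open>Integrating \<open>x' = A x + b\<close> over a period gives
    \<open>A X(P) + P b = 0\<close>, as \<open>x\<close> returns to its value.\<close>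
  have "norm ((A *v X P + P *\<^sub>R b - x P) - (A *v X 0 + 0 *\<^sub>R b - x 0)) \<le> 0 * \<bar>P - 0\<bar>"
    by (rule norm_diff_le_vector_derivative[OF zd]) simp
  then have "P *\<^sub>R (A *v m + b) = 0"
    using x(2)[of 0] by (simp add: X0 Xm matrix_vector_mult_scaleR scaleR_add_right)
  then have eq: "A *v m + b = 0" using x(3) by simp
  \<comment> \<open>The mean stays in the half plane of the orbit; the uses have
    \<open>c = 1\<close> and \<open>c = - 1\<close> for the two zones.\<close>
  have "c * m $ 1 \<le> 0"
  proof -
    have "c * X P $ 1 \<le> c * X 0 $ 1"
    proof (rule DERIV_nonpos_imp_nonincreasing[of 0 P "\<lambda>t. c * X t $ 1"])
      fix t
      have "((\<lambda>t. c * X t $ 1) has_real_derivative c * x t $ 1) (at t)"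
        unfolding has_real_derivative_iff_has_vector_derivative
        by (intro has_vector_derivative_mult_right bounded_linear.has_vector_derivative[OF bounded_linear_vec_nth Xd])
      then show "\<exists>y. ((\<lambda>t. c * X t $ 1) has_real_derivative y) (at t) \<and> y \<le> 0" using in_zone by blast
    qed (use x(3) in simp)
    then have "P * (c * m $ 1) \<le> 0" by (simp add: X0 Xm mult_ac)
    then show ?thesis using x(3) by (simp add: mult_le_0_iff)
  qed
  show ?thesis
  proof (rule closed_orbit_not_isolated[OF x, of m])
    fix l :: real assume l: "0 < l" "l < 1"
    show "solution f (\<lambda>t. m + l *\<^sub>R (x t - m))"
      unfolding solution_def
    proof
      fix t
      have "c * (m + l *\<^sub>R (x t - m)) $ 1 = (1 - l) * (c * m $ 1) + l * (c * x t $ 1)"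
        by (simp add: algebra_simps)
      also have "\<dots> \<le> 0"
        using mult_nonneg_nonpos[OF _ in_zone[of t], of l] mult_nonneg_nonpos[OF _ \<open>c * m $ 1 \<le> 0\<close>, of "1 - l"] l
        by linarith
      finally have "f (m + l *\<^sub>R (x t - m)) = A *v (m + l *\<^sub>R (x t - m)) + b" by (rule zone)
      also have "\<dots> = l *\<^sub>R (A *v x t + b) + (1 - l) *\<^sub>R (A *v m + b)"
        by (simp add: matrix_vector_right_distrib matrix_vector_mult_diff_distrib matrix_vector_mult_scaleR algebra_simps)
      finally have "f (m + l *\<^sub>R (x t - m)) = l *\<^sub>R (A *v x t + b)" by (simp add: eq)
      moreover have "((\<lambda>t. m + l *\<^sub>R (x t - m)) has_vector_derivative 0 + l *\<^sub>R ((A *v x t + b) - 0)) (at t)"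
        by (intro has_vector_derivative_add has_vector_derivative_const
            bounded_linear.has_vector_derivative[OF bounded_linear_scaleR_right] has_vector_derivative_diff xd)
      ultimately show "((\<lambda>t. m + l *\<^sub>R (x t - m)) has_vector_derivative f (m + l *\<^sub>R (x t - m))) (at t)" by simp
    qed
  qed
qed

text \<open>At a maximum the derivative vanishes, so the solution sits at an equilibrium there, and
  uniqueness makes it constant.\<close>

lemma scalar_periodic_constant:
  fixes g :: "real \<Rightarrow> real"
  assumes "lipschitz_field g K" "solution g x" "\<And>t. x (t + P) = x t" "P > 0"
  shows "x t = x s"
proof -
  interpret lipschitz_field g K by fact
  obtain m where m: "m \<in> {0..P}" "\<And>r. r \<in> {0..P} \<Longrightarrow> x r \<le> x m"
    using continuous_attains_sup[of "{0..P}" x] solution_continuous[OF assms(2)] assms(4) by auto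
  have max: "x r \<le> x m" for r
  proof -
    obtain r' where "0 \<le> r'" "r' < 0 + P" "x r' = x r"
      using periodic_representative[where x = x, OF assms(3,4), of 0 r] by blast
    then show ?thesis using m(2)[of r'] by simp
  qed
  have "(x has_real_derivative g (x m)) (at m)"
    using assms(2) by (simp add: solution_def has_real_derivative_iff_has_vector_derivative)
  then have "g (x m) = 0"
    using DERIV_local_max[of x "g (x m)" m 1] max by simp
  then show ?thesis using solution_constant[OF assms(2), of m] by metis
qed

text \<open>Lets one formula serve as first integral in both zones. At 0 the difference quotient is
  \<open>max 0 z\<close>, which is continuous.\<close>

lemma max_0_square_deriv:
  "((\<lambda>u. (max 0 u)\<^sup>2) has_real_derivative 2 * max 0 u) (at (u::real))"
proof -
  consider "u < 0" | "u = 0" | "u > 0" by linarith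
  then show ?thesis
  proof cases
    case 1
    have "((\<lambda>u. (0::real)) has_real_derivative 2 * max 0 u) (at u)" using 1 by (simp add: max_def)
    then show ?thesis
      by (rule has_field_derivative_transform_within_open[where S = "{..<0}"]) (use 1 in \<open>auto simp: max_def\<close>)
  next
    case 2
    show ?thesis
      unfolding CARAT_DERIV
    proof (intro exI conjI allI)
      show "isCont (\<lambda>z. max 0 z) u" by (intro continuous_intros)
    qed (use 2 in \<open>auto simp: power2_eq_square max_def\<close>)
  next
    case 3
    have "((\<lambda>u. u\<^sup>2) has_real_derivative 2 * max 0 u) (at u)"
      using 3 by (auto simp: max_def intro!: derivative_eq_intros)
    then show ?thesis
      by (rule has_field_derivative_transform_within_open[where S = "{0<..}"]) (use 3 in \<open>auto simp: max_def\<close>)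
  qed
qed

section \<open>Canonical coordinates of the piecewise linear field and its degenerate cases\<close>

context pwl
begin

definition a12 :: real where "a12 = A\<^sub>L $ 1 $ 2"
definition a22 :: real where "a22 = A\<^sub>L $ 2 $ 2"
definition offset :: real where "offset = a12 * b $ 2 - a22 * b $ 1"

definition cy :: "real^2 \<Rightarrow> real" where "cy z = a22 * z $ 1 - a12 * z $ 2 - b $ 1"

lemma entries: "A\<^sub>L $ 1 $ 2 = a12" "A\<^sub>R $ 1 $ 2 = a12" "A\<^sub>L $ 2 $ 2 = a22" "A\<^sub>R $ 2 $ 2 = a22"
  using col12 col22 by (auto simp: a12_def a22_def)

lemma field_components:
  "f z $ 1 = (if z $ 1 \<le> 0 then A\<^sub>L $ 1 $ 1 else A\<^sub>R $ 1 $ 1) * z $ 1 + a12 * z $ 2 + b $ 1"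
  "f z $ 2 = (if z $ 1 \<le> 0 then A\<^sub>L $ 2 $ 1 else A\<^sub>R $ 2 $ 1) * z $ 1 + a22 * z $ 2 + b $ 2"
  by (auto simp: pwl_field_def matrix_vector_mult_def sum_2 entries)

lemma component_deriv:
  assumes "solution f x"
  shows "((\<lambda>t. x t $ i) has_real_derivative f (x t) $ i) (at t)"
  unfolding has_real_derivative_iff_has_vector_derivative
  by (rule bounded_linear.has_vector_derivative[OF bounded_linear_vec_nth])
    (use assms in \<open>simp add: solution_def\<close>)

lemma canonical_solutionI:
  assumes x: "solution f x"
  shows "canonical_solution (trace A\<^sub>L) (det A\<^sub>L) (trace A\<^sub>R) (det A\<^sub>R) offset (\<lambda>t. x t $ 1) (\<lambda>t. cy (x t))"
  unfolding canonical_solution_def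
proof (intro allI conjI)
  fix t
  show "((\<lambda>t. x t $ 1) has_real_derivative (if x t $ 1 \<le> 0 then trace A\<^sub>L else trace A\<^sub>R) * x t $ 1 - cy (x t)) (at t)"
    by (rule DERIV_cong[OF component_deriv[OF x]])
      (auto simp: field_components cy_def trace_def sum_2 entries algebra_simps)
  have "((\<lambda>t. cy (x t)) has_real_derivative a22 * f (x t) $ 1 - a12 * f (x t) $ 2 - 0) (at t)"
    unfolding cy_def by (intro DERIV_diff DERIV_cmult component_deriv[OF x] DERIV_const)
  then show "((\<lambda>t. cy (x t)) has_real_derivative (if x t $ 1 \<le> 0 then det A\<^sub>L else det A\<^sub>R) * x t $ 1 - offset) (at t)"
    by (rule DERIV_cong)
      (auto simp: field_components offset_def det_2 entries algebra_simps)
qed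

lemma coordinates_inj:
  assumes "a12 \<noteq> 0" "z $ 1 = w $ 1" "cy z = cy w"
  shows "z = w"
  using assms by (simp add: cy_def vec_eq_iff forall_2)

lemma no_closed_orbit_if_a12_eq_0:
  assumes "a12 = 0"
  shows "\<not> closed_orbit f \<Gamma>"
proof
  assume "closed_orbit f \<Gamma>"
  then obtain x P q where x: "solution f x" "P > 0" "\<And>t. x (t + P) = x t" "x q \<noteq> x 0"
    unfolding closed_orbit_def by blast
  define g1 where "g1 u = A\<^sub>L $ 1 $ 1 * u + max 0 u * (A\<^sub>R $ 1 $ 1 - A\<^sub>L $ 1 $ 1) + b $ 1" for u
  have "lipschitz_field g1 (\<bar>A\<^sub>L $ 1 $ 1\<bar> + \<bar>A\<^sub>R $ 1 $ 1 - A\<^sub>L $ 1 $ 1\<bar>)"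
  proof (unfold_locales, rule lipschitz_onI)
    fix u w :: real
    have "g1 u - g1 w = A\<^sub>L $ 1 $ 1 * (u - w) + (A\<^sub>R $ 1 $ 1 - A\<^sub>L $ 1 $ 1) * (max 0 u - max 0 w)"
      by (simp add: g1_def algebra_simps)
    then have "\<bar>g1 u - g1 w\<bar> \<le> \<bar>A\<^sub>L $ 1 $ 1\<bar> * \<bar>u - w\<bar> + \<bar>A\<^sub>R $ 1 $ 1 - A\<^sub>L $ 1 $ 1\<bar> * \<bar>max 0 u - max 0 w\<bar>"
      by (metis abs_mult abs_triangle_ineq)
    also have "\<dots> \<le> \<bar>A\<^sub>L $ 1 $ 1\<bar> * \<bar>u - w\<bar> + \<bar>A\<^sub>R $ 1 $ 1 - A\<^sub>L $ 1 $ 1\<bar> * \<bar>u - w\<bar>"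
      by (intro add_left_mono mult_left_mono) (auto simp: max_def)
    finally show "dist (g1 u) (g1 w) \<le> (\<bar>A\<^sub>L $ 1 $ 1\<bar> + \<bar>A\<^sub>R $ 1 $ 1 - A\<^sub>L $ 1 $ 1\<bar>) * dist u w"
      by (simp add: dist_real_def algebra_simps)
  qed simp
  moreover have "solution g1 (\<lambda>t. x t $ 1)"
    unfolding solution_def has_real_derivative_iff_has_vector_derivative[symmetric]
  proof
    fix t
    show "((\<lambda>t. x t $ 1) has_real_derivative g1 (x t $ 1)) (at t)"
      by (rule DERIV_cong[OF component_deriv[OF x(1)]])
        (auto simp: field_components assms g1_def algebra_simps)
  qed
  ultimately have c1: "x t $ 1 = x 0 $ 1" for t
    using scalar_periodic_constant[of g1 _ "\<lambda>t. x t $ 1" P t 0] x(2,3) by simp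
  \<comment> \<open>With the first component constant, its contribution to the second equation is a
    constant, read off at time 0.\<close>
  define g2 where "g2 u = a22 * u + (f (x 0) $ 2 - a22 * x 0 $ 2)" for u
  have "lipschitz_field g2 \<bar>a22\<bar>"
    by (unfold_locales, rule lipschitz_onI) (auto simp: g2_def dist_real_def abs_mult simp flip: right_diff_distrib)
  moreover have "solution g2 (\<lambda>t. x t $ 2)"
    unfolding solution_def has_real_derivative_iff_has_vector_derivative[symmetric]
  proof
    fix t
    show "((\<lambda>t. x t $ 2) has_real_derivative g2 (x t $ 2)) (at t)"
      by (rule DERIV_cong[OF component_deriv[OF x(1)]])
        (simp add: field_components c1[of t] g2_def algebra_simps)
  qed
  ultimately have "x t $ 2 = x 0 $ 2" for t
    using scalar_periodic_constant[of g2 _ "\<lambda>t. x t $ 2" P t 0] x(2,3) by simp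
  then show False using c1 x(4) by (simp add: vec_eq_iff forall_2)
qed

lemma not_isolated_if_offset_eq_0:
  assumes "a12 \<noteq> 0" "offset = 0" and x: "solution f x" "\<And>t. x (t + P) = x t" "P > 0" "x q \<noteq> x 0"
  shows "\<not> limit_cycle f (range x)"
proof -
  \<comment> \<open>For \<open>offset = 0\<close> this is an equilibrium on the switching line,
    about which the field is positively homogeneous.\<close>
  define e :: "real^2" where "e = (\<chi> i. if i = 1 then 0 else - b $ 1 / a12)"
  have e: "e $ 1 = 0" "e $ 2 = - b $ 1 / a12" by (auto simp: e_def)
  show ?thesis
  proof (rule closed_orbit_not_isolated[OF x, of e])
    fix l :: real assume l: "0 < l" "l < 1"
    have "f (e + l *\<^sub>R (z - e)) = l *\<^sub>R f z" for z
    proof -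
      have "l * z $ 1 \<le> 0 \<longleftrightarrow> z $ 1 \<le> 0" using l by (auto simp: mult_le_0_iff)
      moreover have "b $ 2 = a22 * b $ 1 / a12"
        using assms(1,2) by (simp add: offset_def field_simps)
      ultimately show ?thesis
        using assms(1) by (simp add: vec_eq_iff forall_2 field_components e) (simp add: field_simps)
    qed
    moreover have "((\<lambda>t. e + l *\<^sub>R (x t - e)) has_vector_derivative 0 + l *\<^sub>R (f (x t) - 0)) (at t)" for t
      using x(1) unfolding solution_def
      by (intro has_vector_derivative_add has_vector_derivative_const
          bounded_linear.has_vector_derivative[OF bounded_linear_scaleR_right] has_vector_derivative_diff) auto
    ultimately show "solution f (\<lambda>t. e + l *\<^sub>R (x t - e))"
      unfolding solution_def by simp
  qed
qed

text \<open>\<open>H\<close> is twice the energy. The \<open>max\<close> term switches between the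
  determinants of the two zones while keeping \<open>H\<close> differentiable.\<close>

lemma first_integral:
  assumes "trace A\<^sub>L = 0" "trace A\<^sub>R = 0" and x: "solution f x" and "x s $ 1 = 0" "x t $ 1 = 0"
  shows "(cy (x s))\<^sup>2 = (cy (x t))\<^sup>2"
proof -
  define H where "H t = (cy (x t))\<^sup>2 + det A\<^sub>L * (x t $ 1)\<^sup>2 + (det A\<^sub>R - det A\<^sub>L) * (max 0 (x t $ 1))\<^sup>2 - 2 * offset * x t $ 1" for t
  have d: "((\<lambda>t. x t $ 1) has_real_derivative - cy (x t)) (at t)"
    "((\<lambda>t. cy (x t)) has_real_derivative (if x t $ 1 \<le> 0 then det A\<^sub>L else det A\<^sub>R) * x t $ 1 - offset) (at t)" for t
    using canonical_solutionI[OF x, unfolded canonical_solution_def, rule_format, of t] assms(1,2)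
    by (cases "x t $ 1 \<le> 0"; simp)+
  have "(H has_real_derivative 0) (at t)" for t
  proof -
    let ?y' = "(if x t $ 1 \<le> 0 then det A\<^sub>L else det A\<^sub>R) * x t $ 1 - offset"
    have "(H has_real_derivative 2 * cy (x t) * ?y' + det A\<^sub>L * (2 * x t $ 1 * (- cy (x t)))
        + (det A\<^sub>R - det A\<^sub>L) * (2 * max 0 (x t $ 1) * (- cy (x t))) - 2 * offset * (- cy (x t))) (at t)"
      unfolding H_def[abs_def]
      by (rule DERIV_cong[OF DERIV_diff[OF DERIV_add[OF DERIV_add[OF DERIV_power[OF d(2)] DERIV_cmult[OF DERIV_power[OF d(1)]]]
          DERIV_cmult[OF DERIV_chain2[OF max_0_square_deriv d(1)]]] DERIV_cmult[OF d(1)]]]) simp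
    moreover have "2 * cy (x t) * ?y' + det A\<^sub>L * (2 * x t $ 1 * (- cy (x t)))
        + (det A\<^sub>R - det A\<^sub>L) * (2 * max 0 (x t $ 1) * (- cy (x t))) - 2 * offset * (- cy (x t)) = 0"
      by (auto simp: max_def algebra_simps)
    ultimately show ?thesis by simp
  qed
  then have "H s = H t" using DERIV_isconst_all[of H s t] by blast
  then show ?thesis using assms(4,5) by (simp add: H_def)
qed

end

section \<open>Limit cycles\<close>

lemma repelling_if_attracting_reversed:
  assumes "attracting (\<lambda>z. - f z) \<Gamma>"
  shows "repelling f \<Gamma>"
proof -
  obtain U where U: "open U" "\<Gamma> \<subseteq> U" and
    "\<forall>x. solution (\<lambda>z. - f z) x \<and> x 0 \<in> U \<longrightarrow> ((\<lambda>t. infdist (x t) \<Gamma>) \<longlongrightarrow> 0) at_top"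
    using assms unfolding attracting_def by (elim exE conjE) (rule that)
  then have conv: "((\<lambda>t. infdist (x t) \<Gamma>) \<longlongrightarrow> 0) at_top"
    if "solution (\<lambda>z. - f z) x" "x 0 \<in> U" for x
    using that by simp
  have "((\<lambda>t. infdist (x t) \<Gamma>) \<longlongrightarrow> 0) at_bot" if "solution f x" "x 0 \<in> U" for x
    using conv[OF solution_reverse[OF that(1)]] that(2) by (subst filterlim_at_bot_mirror) simp
  then show ?thesis unfolding repelling_def using U by blast
qed

context two_zone_orbit
begin

lemma reversed_field: "pwl_field (- A\<^sub>L) (- A\<^sub>R) (- b) = (\<lambda>z. - f z)"
  by (auto simp: fun_eq_iff pwl_field_def vec_eq_iff matrix_vector_mult_def sum_2)

lemma reversed_orbit: "two_zone_orbit (- A\<^sub>L) (- A\<^sub>R) (- b) (\<lambda>t. x (- t)) (- t1) (- t0) (- t1 + period)"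
proof unfold_locales
  show "solution (pwl_field (- A\<^sub>L) (- A\<^sub>R) (- b)) (\<lambda>t. x (- t))"
    unfolding reversed_field by (rule solution_reverse[OF sol])
  show "x (- (- t1 + period)) = x (- (- t1))"
    using periodic[of "t1 - period"] by simp
  show "x (- t) $ 1 < 0" if "- t1 < t" "t < - t0" for t
    using left[of "- t"] that by simp
  show "x (- t) $ 1 > 0" if "- t0 < t" "t < - t1 + period" for t
    using right[of "- t + period"] that periodic[of "- t"] by (simp add: period_def)
qed (use col12 col22 order in \<open>auto simp: period_def\<close>)

lemma repelling_if_exponent_pos:
  assumes "exponent > 0"
  shows "repelling f (range x)"
proof -
  interpret rev: two_zone_orbit "- A\<^sub>L" "- A\<^sub>R" "- b" "\<lambda>t. x (- t)" "- t1" "- t0" "- t1 + period"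
    by (rule reversed_orbit)
  have "rev.exponent = - exponent"
    by (subst rev.exponent_def) (simp add: exponent_def trace_def sum_2 period_def algebra_simps)
  then have "attracting (\<lambda>z. - f z) (range (\<lambda>t. x (- t)))"
    using rev.attracting_if_exponent_neg assms unfolding reversed_field by simp
  moreover have "range (\<lambda>t. x (- t)) = range x"
  proof -
    have "x t \<in> range (\<lambda>t. x (- t))" for t by (rule image_eqI[of _ _ "- t"]) auto
    then show ?thesis by auto
  qed
  ultimately show ?thesis using repelling_if_attracting_reversed by simp
qed

text \<open>If both traces vanish, the first integral makes the return map to \<open>x\<^sub>1 = 0\<close> the
  identity.\<close>

lemma not_isolated_if_traces_zero:
  assumes traces: "trace A\<^sub>L = 0" "trace A\<^sub>R = 0" and "a12 \<noteq> 0" and cy: "cy (x t0) > 0" "cy (x t1) < 0"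
  shows "\<not> limit_cycle f (range x)"
proof
  assume "limit_cycle f (range x)"
  then obtain U where U: "open U" "range x \<subseteq> U" and
      "\<forall>\<Gamma>'. closed_orbit f \<Gamma>' \<and> \<Gamma>' \<subseteq> U \<longrightarrow> \<Gamma>' = range x"
    unfolding limit_cycle_def by (elim conjE exE) (rule that)
  then have U3: "\<Gamma> = range x" if "closed_orbit f \<Gamma>" "\<Gamma> \<subseteq> U" for \<Gamma>
    using that by simp
  define p where "p = x t0"
  define v :: "real^2" where "v = (\<chi> i. if i = 1 then 0 else 1)"
  have v: "v $ 1 = 0" "v $ 2 = 1" by (auto simp: v_def)
  have p1: "p $ 1 = 0" using crossings by (simp add: p_def)
  have f1: "f z $ 1 = - cy z" if "z $ 1 = 0" for z
    using that by (simp add: field_components cy_def)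
  have "cross2 (f (x t0)) v \<noteq> 0"
    using f1[OF p1] cy by (simp add: cross2_def v p_def)
  then interpret periodic_section f lip_const "x t0" v "\<lambda>t. x (t + t0)" period
    by (rule periodic_sectionI)
  have "range x = x ` {0..period}"
  proof -
    have "x t \<in> x ` {0..period}" for t
      using periodic_representative[where x = x, OF two_zone_orbit.periodic[OF two_zone_orbit_axioms] period_pos, of 0 t]
      by (metis add_0 atLeastAtMost_iff image_eqI less_imp_le)
    then show ?thesis by auto
  qed
  then have comp: "compact (range x)"
    using two_zone_orbit.sol[OF two_zone_orbit_axioms] by (simp add: compact_continuous_image solution_continuous)
  obtain d where d: "d > 0" "(\<Union>w\<in>range x. ball w d) \<subseteq> U"
    using compact_subset_open_imp_ball_epsilon_subset[OF comp U] by blast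
  obtain C \<eta> where C: "C > 0" and \<eta>: "\<eta> > 0" and hits:
    "\<And>z t0'. solution f z \<Longrightarrow> norm (z t0' - x t0) < \<eta> \<Longrightarrow>
       \<exists>t. \<bar>t - t0'\<bar> \<le> C * norm (z t0' - x t0) \<and> phase (z t) = 0 \<and>
           \<bar>coord (z t) - coord (z t0')\<bar> \<le> C * (norm (z t0' - x t0))\<^sup>2"
    using hits_section by blast
  define E where "E = exp (lip_const * (2 * period)) * norm v"
  have "v \<noteq> 0" using v(2) by auto
  then have E: "E > 0" by (simp add: E_def)
  have cb: "cbound + C > 0" using cbound_ge_1 C by linarith
  define y0 where "y0 = cy p"
  have y0: "y0 > 0" using cy by (simp add: y0_def p_def)
  \<comment> \<open>In this order the bounds ensure that \<open>hits\<close> applies, that the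
    displacement is at most 1, that the return time differs from the period by less than half of it,
    that the returned and the starting point have positive \<open>cy\<close>, and that the new orbit
    stays in \<open>U\<close>.\<close>
  define m where "m = Min {\<eta> / E, 1 / E, period / (2 * C * E), y0 / ((\<bar>a12\<bar> + 1) * ((cbound + C) * E)), y0 / (\<bar>a12\<bar> + 1), d / E}"
  have "m > 0"
    unfolding m_def using E C \<eta> period_pos y0 cb d by (auto intro!: divide_pos_pos mult_pos_pos add_nonneg_pos)
  define s where "s = m / 2"
  have s: "s > 0" and sm: "s < m" using \<open>m > 0\<close> by (auto simp: s_def)
  have "\<And>u. u \<in> {\<eta> / E, 1 / E, period / (2 * C * E), y0 / ((\<bar>a12\<bar> + 1) * ((cbound + C) * E)), y0 / (\<bar>a12\<bar> + 1), d / E} \<Longrightarrow> s < u"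
    using sm unfolding m_def by (meson Min_le finite.emptyI finite.insertI less_le_trans)
  then have sl: "s < \<eta> / E" "s < 1 / E" "s < period / (2 * C * E)" "s < y0 / ((\<bar>a12\<bar> + 1) * ((cbound + C) * E))"
      "s < y0 / (\<bar>a12\<bar> + 1)" "s < d / E"
    by blast+
  have a1: "\<bar>a12\<bar> + 1 > 0" by linarith
  have s1: "E * s < \<eta>" "E * s < 1" "E * s < d"
    using sl(1,2,6) E by (auto simp: pos_less_divide_eq mult.commute)
  have s2: "C * (E * s) < period / 2"
    using sl(3) E C by (simp add: pos_less_divide_eq mult_ac)
  have s3: "(\<bar>a12\<bar> + 1) * ((cbound + C) * (E * s)) < y0" "(\<bar>a12\<bar> + 1) * s < y0"
    using sl(4,5) E cb a1 by (auto simp: pos_less_divide_eq mult_ac)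
  obtain z where z: "solution f z" "z 0 = p + s *\<^sub>R v" using solution_exists by blast
  have close: "norm (z t - x (t + t0)) \<le> E * s" if "0 \<le> t" "t \<le> 2 * period" for t
  proof -
    have "norm (z t - x (t + t0)) \<le> exp (lip_const * (2 * period)) * norm (z 0 - x t0)"
      by (rule dist_orbit_le[OF z(1) that])
    then show ?thesis using z(2) s by (simp add: E_def p_def mult_ac)
  qed
  define \<delta> where "\<delta> = norm (z period - x t0)"
  have \<delta>: "0 \<le> \<delta>" "\<delta> \<le> E * s" "\<delta> \<le> 1"
    using close[of period] period_pos x_T s1 by (auto simp: \<delta>_def)
  obtain \<tau> where \<tau>: "\<bar>\<tau> - period\<bar> \<le> C * \<delta>" "phase (z \<tau>) = 0" "\<bar>coord (z \<tau>) - coord (z period)\<bar> \<le> C * \<delta>\<^sup>2"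
    using hits[OF z(1), of period] \<delta>(2) s1(1) unfolding \<delta>_def by force
  have "C * \<delta> \<le> C * (E * s)" using \<delta> C by simp
  then have \<tau>P: "0 < \<tau>" "\<tau> \<le> 2 * period" using \<tau>(1) s2 period_pos by linarith+
  define r where "r = coord (z \<tau>)"
  have zr: "z \<tau> = p + r *\<^sub>R v" using on_section[OF \<tau>(2)] by (simp add: r_def p_def)
  have cyv: "cy (p + q *\<^sub>R v) = y0 - a12 * q" for q
    by (simp add: cy_def y0_def v algebra_simps)
  have "\<delta>\<^sup>2 \<le> \<delta> * 1" unfolding power2_eq_square using \<delta> by (intro mult_left_mono) auto
  then have "C * \<delta>\<^sup>2 \<le> C * \<delta>" using C by simp
  then have "\<bar>r\<bar> \<le> (cbound + C) * \<delta>"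
    using \<tau>(3) abs_coord_le[of "z period"] unfolding r_def \<delta>_def by (simp add: algebra_simps)
  also have "\<dots> \<le> (cbound + C) * (E * s)" using \<delta> cb by (intro mult_left_mono) auto
  finally have "(\<bar>a12\<bar> + 1) * \<bar>r\<bar> \<le> (\<bar>a12\<bar> + 1) * ((cbound + C) * (E * s))"
    by (intro mult_left_mono) auto
  then have "\<bar>a12 * r\<bar> < y0" using s3(1) by (simp add: abs_mult algebra_simps)
  moreover have "\<bar>a12 * s\<bar> < y0" using s3(2) s by (simp add: abs_mult algebra_simps)
  ultimately have cpos: "y0 - a12 * r > 0" "y0 - a12 * s > 0" by linarith+
  have "(cy (z \<tau>))\<^sup>2 = (cy (z 0))\<^sup>2"
    by (rule first_integral[OF traces z(1)]) (simp_all add: zr z(2) v p1)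
  \<comment> \<open>Equal squares of two positive numbers: the first integral determines the height
    of the returned point.\<close>
  then have "y0 - a12 * r = y0 - a12 * s"
    unfolding zr z(2) cyv using cpos by (simp add: power2_eq_iff)
  then have "z \<tau> = z 0" using \<open>a12 \<noteq> 0\<close> by (simp add: zr z(2))
  then have zper: "z (t + \<tau>) = z t" for t
    using solution_periodic[OF z(1), of 0 \<tau> t] by simp
  have "\<exists>t. z t \<noteq> z 0"
  proof (rule ccontr)
    assume "\<nexists>t. z t \<noteq> z 0"
    then have "z = (\<lambda>t. z 0)" by auto
    then have "(z has_vector_derivative 0) (at 0)" by (metis has_vector_derivative_const)
    moreover have "(z has_vector_derivative f (z 0)) (at 0)" using z(1) by (simp add: solution_def)
    ultimately have "f (z 0) = 0" by (metis vector_derivative_unique_at)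
    moreover have "f (z 0) $ 1 = - (y0 - a12 * s)"
      using f1[of "z 0"] cyv[of s] by (simp add: z(2) v p1)
    ultimately show False using cpos by simp
  qed
  then have "closed_orbit f (range z)"
    unfolding closed_orbit_def using z(1) \<tau>P(1) zper by blast
  moreover have "range z \<subseteq> U"
  proof -
    have "z t \<in> U" for t
    proof -
      obtain q where q: "0 \<le> q" "q < 0 + \<tau>" "z q = z t"
        using periodic_representative[where x = z, OF zper \<tau>P(1), of 0 t] by blast
      have "norm (z q - x (q + t0)) < d" using close[of q] q \<tau>P s1(3) by simp
      then have "z q \<in> ball (x (q + t0)) d" by (simp add: dist_norm norm_minus_commute)
      then show ?thesis using d(2) q(3) by (metis UN_I rangeI subsetD)
    qed
    then show ?thesis by blast
  qed
  ultimately have "range z = range x" by (rule U3)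
  \<comment> \<open>The starting point of the new orbit lies on \<open>x\<^sub>1 = 0\<close>, but
    the old orbit meets this line only in \<open>x t0\<close> and \<open>x t1\<close>; the former
    differs by \<open>s\<close>, the latter has negative \<open>cy\<close>.\<close>
  then obtain c where c: "x c = z 0" by (metis rangeE rangeI)
  obtain q where q: "t0 \<le> q" "q < t0 + period" "x q = x c"
    using periodic_representative[where x = x, OF two_zone_orbit.periodic[OF two_zone_orbit_axioms] period_pos, of t0 c] by blast
  have xq: "x q = p + s *\<^sub>R v" using q(3) c z(2) by simp
  then have "x q $ 1 = 0" by (simp add: v p1)
  then have "q = t0 \<or> q = t1"
    using left[of q] right[of q] q(1,2) by (force simp: period_def)
  then show False
  proof
    assume "q = t0"
    then have "s *\<^sub>R v = 0" using xq by (simp add: p_def)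
    then show False using s \<open>v \<noteq> 0\<close> by simp
  next
    assume "q = t1"
    then show False using cy(2) xq cyv[of s] cpos by simp
  qed
qed

end

context pwl
begin

lemma limit_cycle_structure:
  assumes lc: "limit_cycle f \<Gamma>"
  obtains x t0 t1 t2 where "two_zone_orbit A\<^sub>L A\<^sub>R b x t0 t1 t2" "\<Gamma> = range x"
    "two_zone_periodic (\<lambda>t. x t $ 1) (\<lambda>t. cy (x t))" "a12 \<noteq> 0" "offset \<noteq> 0" "trace A\<^sub>L * trace A\<^sub>R < 0"
    "offset * trace A\<^sub>L < 0 \<longrightarrow> trace A\<^sub>L * (t1 - t0) + trace A\<^sub>R * (t2 - t1) < 0"
    "offset * trace A\<^sub>L > 0 \<longrightarrow> trace A\<^sub>L * (t1 - t0) + trace A\<^sub>R * (t2 - t1) > 0"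
proof -
  have co: "closed_orbit f \<Gamma>" using lc by (simp add: limit_cycle_def)
  then obtain x P q where x: "solution f x" "\<And>t. x (t + P) = x t" "P > 0" "x q \<noteq> x 0" and \<Gamma>: "\<Gamma> = range x"
    unfolding closed_orbit_def by blast
  have a12: "a12 \<noteq> 0" using no_closed_orbit_if_a12_eq_0 co by blast
  have offset: "offset \<noteq> 0" using not_isolated_if_offset_eq_0[OF a12 _ x] lc \<Gamma> by blast
  have "\<exists>t. x t $ 1 > 0"
    using one_zone_not_isolated[OF x, of 1 A\<^sub>L b] field_left lc \<Gamma> by (auto simp: not_less[symmetric])
  moreover have "\<exists>t. x t $ 1 < 0"
    using one_zone_not_isolated[OF x, of "- 1" A\<^sub>R b] field_right lc \<Gamma> by (auto simp: not_less[symmetric])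
  moreover have "x (r + s) $ 1 = x (r + t) $ 1 \<and> cy (x (r + s)) = cy (x (r + t))"
    if "x s $ 1 = x t $ 1" "cy (x s) = cy (x t)" for r s t
    using solution_unique_shift[OF x(1,1) coordinates_inj[OF a12 that]] by simp
  moreover have "\<exists>P>0. \<forall>t. x (t + P) $ 1 = x t $ 1 \<and> cy (x (t + P)) = cy (x t)"
    using x(2,3) by (intro exI[of _ P]) simp
  ultimately have per: "two_zone_periodic (\<lambda>t. x t $ 1) (\<lambda>t. cy (x t))"
    unfolding two_zone_periodic_def by blast
  have "orbit_structure (trace A\<^sub>L) (trace A\<^sub>R) offset (\<lambda>t. x t $ 1) (\<lambda>t. cy (x t))"
    by (rule orbit_structure[OF canonical_solutionI[OF x(1)] per offset])
  then obtain t0 t1 t2 where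
    tr: "trace A\<^sub>L * trace A\<^sub>R < 0 \<or> trace A\<^sub>L = 0 \<and> trace A\<^sub>R = 0" and
    arcs: "two_arcs (\<lambda>t. x t $ 1) (\<lambda>t. cy (x t)) t0 t1 t2" and
    exps: "offset * trace A\<^sub>L < 0 \<longrightarrow> trace A\<^sub>L * (t1 - t0) + trace A\<^sub>R * (t2 - t1) < 0"
    "offset * trace A\<^sub>L > 0 \<longrightarrow> trace A\<^sub>L * (t1 - t0) + trace A\<^sub>R * (t2 - t1) > 0"
    unfolding orbit_structure_def by (elim conjE exE) (rule that)
  have orbit: "two_zone_orbit A\<^sub>L A\<^sub>R b x t0 t1 t2"
    by unfold_locales (use arcs x(1) coordinates_inj[OF a12, of "x t2" "x t0"] in \<open>auto simp: two_arcs_def\<close>)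
  have "cy (x t0) > 0" "cy (x t1) < 0" using arcs by (auto simp: two_arcs_def)
  then have "\<not> (trace A\<^sub>L = 0 \<and> trace A\<^sub>R = 0)"
    using two_zone_orbit.not_isolated_if_traces_zero[OF orbit] a12 lc \<Gamma> by blast
  then show thesis
    using that[OF orbit \<Gamma> per a12 offset] tr exps by blast
qed

lemma limit_cycle_unique:
  assumes "limit_cycle f \<Gamma>" "limit_cycle f \<Gamma>'"
  shows "\<Gamma> = \<Gamma>'"
proof -
  obtain x t0 t1 t2 where x: "two_zone_orbit A\<^sub>L A\<^sub>R b x t0 t1 t2" "\<Gamma> = range x"
    "two_zone_periodic (\<lambda>t. x t $ 1) (\<lambda>t. cy (x t))" "a12 \<noteq> 0" "offset \<noteq> 0" "trace A\<^sub>L * trace A\<^sub>R < 0"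
    by (rule limit_cycle_structure[OF assms(1)])
  obtain x' s0 s1 s2 where x': "two_zone_orbit A\<^sub>L A\<^sub>R b x' s0 s1 s2" "\<Gamma>' = range x'"
    "two_zone_periodic (\<lambda>t. x' t $ 1) (\<lambda>t. cy (x' t))"
    by (rule limit_cycle_structure[OF assms(2)])
  have sol: "solution f x" "solution f x'"
    using two_zone_orbit.sol[OF x(1)] two_zone_orbit.sol[OF x'(1)] by auto
  obtain s s' where "x s $ 1 = x' s' $ 1" "cy (x s) = cy (x' s')"
    using orbits_meet[OF canonical_solutionI[OF sol(1)] x(3) canonical_solutionI[OF sol(2)] x'(3) x(6,5)] by blast
  then have "x s = x' s'" by (rule coordinates_inj[OF x(4)])
  then have eq: "x (t + s) = x' (t + s')" for t by (rule solution_unique_shift[OF sol])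
  have "x t \<in> range x'" for t using eq[of "t - s"] by simp
  moreover have "x' t \<in> range x" for t using eq[of "t - s'", symmetric] by simp
  ultimately show ?thesis using x(2) x'(2) by auto
qed

end

theorem theorem1:
  fixes A\<^sub>L A\<^sub>R :: "real^2^2" and b :: "real^2" and a12 a22 :: real
  assumes "A\<^sub>L $ 1 $ 2 = a12" and "A\<^sub>R $ 1 $ 2 = a12"
    and "A\<^sub>L $ 2 $ 2 = a22" and "A\<^sub>R $ 2 $ 2 = a22"
  shows "(\<forall>\<Gamma> \<Gamma>'. limit_cycle (pwl_field A\<^sub>L A\<^sub>R b) \<Gamma> \<and> limit_cycle (pwl_field A\<^sub>L A\<^sub>R b) \<Gamma>' \<longrightarrow> \<Gamma> = \<Gamma>') \<and>
    (\<forall>\<Gamma>. limit_cycle (pwl_field A\<^sub>L A\<^sub>R b) \<Gamma> \<longrightarrow>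
       hyperbolic (pwl_field A\<^sub>L A\<^sub>R b) \<Gamma> \<and>
       (a12 * b $ 2 - a22 * b $ 1) * trace A\<^sub>L \<noteq> 0 \<and>
       ((a12 * b $ 2 - a22 * b $ 1) * trace A\<^sub>L < 0 \<longrightarrow> attracting (pwl_field A\<^sub>L A\<^sub>R b) \<Gamma>) \<and>
       ((a12 * b $ 2 - a22 * b $ 1) * trace A\<^sub>L > 0 \<longrightarrow> repelling (pwl_field A\<^sub>L A\<^sub>R b) \<Gamma>))"
proof (intro conjI allI impI)
  interpret P: pwl A\<^sub>L A\<^sub>R b
    by unfold_locales (use assms in auto)
  have offset: "a12 * b $ 2 - a22 * b $ 1 = P.offset"
    using assms by (simp add: P.offset_def P.a12_def P.a22_def)
  show "\<Gamma> = \<Gamma>'" if "limit_cycle (pwl_field A\<^sub>L A\<^sub>R b) \<Gamma> \<and> limit_cycle (pwl_field A\<^sub>L A\<^sub>R b) \<Gamma>'" for \<Gamma> \<Gamma>'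
    using P.limit_cycle_unique that by blast
  fix \<Gamma> assume "limit_cycle (pwl_field A\<^sub>L A\<^sub>R b) \<Gamma>"
  then obtain x t0 t1 t2 where x: "two_zone_orbit A\<^sub>L A\<^sub>R b x t0 t1 t2" "\<Gamma> = range x"
    "P.offset \<noteq> 0" "trace A\<^sub>L * trace A\<^sub>R < 0"
    "P.offset * trace A\<^sub>L < 0 \<longrightarrow> trace A\<^sub>L * (t1 - t0) + trace A\<^sub>R * (t2 - t1) < 0"
    "P.offset * trace A\<^sub>L > 0 \<longrightarrow> trace A\<^sub>L * (t1 - t0) + trace A\<^sub>R * (t2 - t1) > 0"
    by (rule P.limit_cycle_structure)
  interpret two_zone_orbit A\<^sub>L A\<^sub>R b x t0 t1 t2 by fact
  have sign: "P.offset * trace A\<^sub>L \<noteq> 0" using x(3,4) by auto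
  then show "(a12 * b $ 2 - a22 * b $ 1) * trace A\<^sub>L \<noteq> 0" by (simp add: offset)
  have "exponent \<noteq> 0"
    unfolding exponent_def using x(5,6) sign by linarith
  then show "hyperbolic (pwl_field A\<^sub>L A\<^sub>R b) \<Gamma>" unfolding x(2) by (rule hyperbolic_orbit)
  show "attracting (pwl_field A\<^sub>L A\<^sub>R b) \<Gamma>" if "(a12 * b $ 2 - a22 * b $ 1) * trace A\<^sub>L < 0"
    unfolding x(2) using that x(5) by (intro attracting_if_exponent_neg) (simp add: exponent_def offset)
  show "repelling (pwl_field A\<^sub>L A\<^sub>R b) \<Gamma>" if "(a12 * b $ 2 - a22 * b $ 1) * trace A\<^sub>L > 0"
    unfolding x(2) using that x(6) by (intro repelling_if_exponent_pos) (simp add: exponent_def offset)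
qed

end
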